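(* Let $R$ be a Noetherian commutative ring, $\Lambda$ a module-finite $R$-algebra (not necessarily commutative), and $C$ a finitely generated right $\Lambda$-module. (1) For $n=0,1$, $\mathrm{Syz}_{\Lambda^{\mathrm{op}}}(n,C)=\mathrm{UP}_{\Lambda^{\mathrm{op}}}(n,C)$. (2) For every $n\geq 0$, $\mathrm{TF}_{\Lambda^{\mathrm{op}}}(n,C)=\mathrm{UP}_{\Lambda^{\mathrm{op}}}(n,C)$.
   Context: A module-finite $R$-algebra is an associative unital $R$-algebra finitely generated as an $R$-module. $\operatorname{mod}\Lambda$ is the category of finitely generated right $\Lambda$-modules; $\operatorname{Hom}_{\Lambda^{\mathrm{op}}}$, $\operatorname{End}_{\Lambda^{\mathrm{op}}}$ refer to right $\Lambda$-modules. $\operatorname{add} C$ is the class of direct summands of finite direct sums of copies of $C$. Put $\Gamma=\operatorname{End}_{\Lambda^{\mathrm{op}}}C$, $(?)^\dagger=\operatorname{Hom}_{\Lambda^{\mathrm{op}}}(?,C)$ (a left $\Gamma$-module), and $(?)^\ddagger=\operatorname{Hom}_\Gamma(?,C)$ (a right $\Lambda$-module). For $n\ge1$, $\mathrm{Syz}_{\Lambda^{\mathrm{op}}}(n,C)$ is the class of $M\in\operatorname{mod}\Lambda$ for which there is an exact sequence $0\to M\to C^0\to C^1\to\cdots\to C^{n-1}$ in $\operatorname{mod}\Lambda$ with all $C^i\in\operatorname{add}C$; $\mathrm{UP}_{\Lambda^{\mathrm{op}}}(n,C)$ is the class of those $M$ for which such a sequence exists with $0\leftarrow M^\dagger\leftarrow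 (C^0)^\dagger\leftarrow\cdots\leftarrow (C^{n-1})^\dagger$ also exact. For $n=0$ the conditions are empty: $\mathrm{Syz}_{\Lambda^{\mathrm{op}}}(0,C)=\mathrm{UP}_{\Lambda^{\mathrm{op}}}(0,C)=\operatorname{mod}\Lambda$. Let $\lambda_M:M\to M^{\dagger\ddagger}$, $\lambda_M(m)(\psi)=\psi(m)$. $\mathrm{TF}_{\Lambda^{\mathrm{op}}}(0,C)=\operatorname{mod}\Lambda$; $M\in\mathrm{TF}_{\Lambda^{\mathrm{op}}}(1,C)$ if $\lambda_M$ is injective; $M\in\mathrm{TF}_{\Lambda^{\mathrm{op}}}(2,C)$ if $\lambda_M$ is bijective; for $n\ge3$, $M\in\mathrm{TF}_{\Lambda^{\mathrm{op}}}(n,C)$ if $\lambda_M$ is bijective and $\operatorname{Ext}^i_\Gamma(M^\dagger,C)=0$ for $1\le i\le n-2$. *)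

theory Defs
  imports "HOL-Algebra.Module" "HOL-Algebra.Ring_Divisibility" "HOL-Algebra.Elementary_Groups"
begin

section \<open>Modules over noncommutative rings\<close>

text \<open>The library locale \<open>module\<close> requires a commutative ring of scalars. The following is the same
  list of axioms for left modules over an arbitrary ring.\<close>

locale lmodule = R?: ring R + M?: abelian_group M
  for R :: "('a, 'x) ring_scheme" (structure) and M :: "('a, 'm, 'y) module_scheme" (structure) +
  assumes smult_closed [simp, intro]:
      "\<lbrakk> a \<in> carrier R; x \<in> carrier M \<rbrakk> \<Longrightarrow> a \<odot>\<^bsub>M\<^esub> x \<in> carrier M"
    and smult_l_distr:
      "\<lbrakk> a \<in> carrier R; b \<in> carrier R; x \<in> carrier M \<rbrakk> \<Longrightarrow>
      (a \<oplus> b) \<odot>\<^bsub>M\<^esub> x = a \<odot>\<^bsub>M\<^esub> x \<oplus>\<^bsub>M\<^esub> b \<odot>\<^bsub>M\<^esub> x"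
    and smult_r_distr:
      "\<lbrakk> a \<in> carrier R; x \<in> carrier M; y \<in> carrier M \<rbrakk> \<Longrightarrow>
      a \<odot>\<^bsub>M\<^esub> (x \<oplus>\<^bsub>M\<^esub> y) = a \<odot>\<^bsub>M\<^esub> x \<oplus>\<^bsub>M\<^esub> a \<odot>\<^bsub>M\<^esub> y"
    and smult_assoc1:
      "\<lbrakk> a \<in> carrier R; b \<in> carrier R; x \<in> carrier M \<rbrakk> \<Longrightarrow>
      (a \<otimes> b) \<odot>\<^bsub>M\<^esub> x = a \<odot>\<^bsub>M\<^esub> (b \<odot>\<^bsub>M\<^esub> x)"
    and smult_one [simp]:
      "x \<in> carrier M \<Longrightarrow> \<one> \<odot>\<^bsub>M\<^esub> x = x"

text \<open>A right \<open>\<Lambda>\<close>-module is a left module over \<open>opp_ring \<Lambda>\<close>, with \<open>a \<odot> x\<close> standing for \<open>x a\<close>. All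
  notions below are therefore formulated for left modules over a ring \<open>A\<close>; the right modules over
  \<open>\<Lambda>\<close> are the case \<open>A = opp_ring \<Lambda>\<close>.\<close>

definition opp_ring :: "('a, 'x) ring_scheme \<Rightarrow> 'a ring" where
  "opp_ring A = \<lparr>carrier = carrier A, mult = (\<lambda>x y. y \<otimes>\<^bsub>A\<^esub> x), one = \<one>\<^bsub>A\<^esub>,
     zero = \<zero>\<^bsub>A\<^esub>, add = (\<oplus>\<^bsub>A\<^esub>)\<rparr>"

definition finitely_generated :: "('a, 'x) ring_scheme \<Rightarrow> ('a, 'm, 'y) module_scheme \<Rightarrow> bool" where
  "finitely_generated A M \<longleftrightarrow> (\<exists>G. finite G \<and> G \<subseteq> carrier M \<and>
     carrier M = {(\<Oplus>\<^bsub>M\<^esub>g\<in>G. c g \<odot>\<^bsub>M\<^esub> g) | c. c \<in> G \<rightarrow> carrier A})"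

definition fg_modules :: "('a, 'x) ring_scheme \<Rightarrow> ('a, 'm) module set" where
  "fg_modules A = {M. lmodule A M \<and> finitely_generated A M}"

text \<open>The record \<open>\<Lambda>\<close> carries both the ring structure and the \<open>R\<close>-module structure of the algebra. The
  library locale \<open>algebra\<close> is the commutative case.\<close>

locale module_finite_algebra = module R \<Lambda> + \<Lambda>?: ring \<Lambda>
  for R :: "('r, 'x) ring_scheme" (structure) and \<Lambda> :: "('r, 'l, 'y) module_scheme" (structure) +
  assumes smult_mult_left: "\<lbrakk> r \<in> carrier R; a \<in> carrier \<Lambda>; b \<in> carrier \<Lambda> \<rbrakk> \<Longrightarrow>
      (r \<odot>\<^bsub>\<Lambda>\<^esub> a) \<otimes>\<^bsub>\<Lambda>\<^esub> b = r \<odot>\<^bsub>\<Lambda>\<^esub> (a \<otimes>\<^bsub>\<Lambda>\<^esub> b)"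
    and smult_mult_right: "\<lbrakk> r \<in> carrier R; a \<in> carrier \<Lambda>; b \<in> carrier \<Lambda> \<rbrakk> \<Longrightarrow>
      a \<otimes>\<^bsub>\<Lambda>\<^esub> (r \<odot>\<^bsub>\<Lambda>\<^esub> b) = r \<odot>\<^bsub>\<Lambda>\<^esub> (a \<otimes>\<^bsub>\<Lambda>\<^esub> b)"
    and module_finite: "finitely_generated R \<Lambda>"

section \<open>Homomorphisms\<close>

text \<open>Maps are extensional on the carrier, so that equality of functions is equality of
  homomorphisms.\<close>

definition lhom :: "('a, 'x) ring_scheme \<Rightarrow> ('a, 'm, 'y) module_scheme \<Rightarrow>
    ('a, 'n, 'z) module_scheme \<Rightarrow> ('m \<Rightarrow> 'n) set" where
  "lhom A M N = {f \<in> carrier M \<rightarrow>\<^sub>E carrier N.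
     (\<forall>x\<in>carrier M. \<forall>y\<in>carrier M. f (x \<oplus>\<^bsub>M\<^esub> y) = f x \<oplus>\<^bsub>N\<^esub> f y) \<and>
     (\<forall>a\<in>carrier A. \<forall>x\<in>carrier M. f (a \<odot>\<^bsub>M\<^esub> x) = a \<odot>\<^bsub>N\<^esub> f x)}"

definition lker :: "('a, 'm, 'y) module_scheme \<Rightarrow> ('b, 'n, 'z) module_scheme \<Rightarrow>
    ('m \<Rightarrow> 'n) \<Rightarrow> 'm set" where
  "lker M N f = {x \<in> carrier M. f x = \<zero>\<^bsub>N\<^esub>}"

definition lmod_iso :: "('a, 'x) ring_scheme \<Rightarrow> ('a, 'm, 'y) module_scheme \<Rightarrow>
    ('a, 'n, 'z) module_scheme \<Rightarrow> bool" where
  "lmod_iso A M N \<longleftrightarrow> (\<exists>h \<in> lhom A M N. bij_betw h (carrier M) (carrier N))"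

definition hom_group :: "('a, 'x) ring_scheme \<Rightarrow> ('a, 'm, 'y) module_scheme \<Rightarrow>
    ('a, 'n, 'z) module_scheme \<Rightarrow> ('m \<Rightarrow> 'n) monoid" where
  "hom_group A M N = \<lparr>carrier = lhom A M N,
     mult = (\<lambda>f g. \<lambda>x\<in>carrier M. f x \<oplus>\<^bsub>N\<^esub> g x), one = (\<lambda>x\<in>carrier M. \<zero>\<^bsub>N\<^esub>)\<rparr>"

text \<open>\<open>Hom\<^sub>A(M,N)\<close> as a module over a second ring acting on \<open>N\<close> through \<open>act\<close>. The fields \<open>mult\<close> and
  \<open>one\<close> of a module record are irrelevant.\<close>

definition hom_module :: "('a, 'x) ring_scheme \<Rightarrow> ('a, 'm, 'y) module_scheme \<Rightarrow>
    ('a, 'n, 'z) module_scheme \<Rightarrow> ('b \<Rightarrow> 'n \<Rightarrow> 'n) \<Rightarrow> ('b, 'm \<Rightarrow> 'n) module" where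
  "hom_module A M N act = \<lparr>carrier = lhom A M N, mult = undefined, one = undefined,
     zero = \<one>\<^bsub>hom_group A M N\<^esub>, add = (\<otimes>\<^bsub>hom_group A M N\<^esub>),
     smult = (\<lambda>b f. \<lambda>x\<in>carrier M. act b (f x))\<rparr>"

definition pullback :: "('a, 'm, 'y) module_scheme \<Rightarrow> ('m \<Rightarrow> 'n) \<Rightarrow> ('n \<Rightarrow> 'k) \<Rightarrow> 'm \<Rightarrow> 'k" where
  "pullback M f \<phi> = compose (carrier M) \<phi> f"

section \<open>Direct sums of copies of a module and \<open>add C\<close>\<close>

definition dirsum :: "('a, 'm, 'y) module_scheme \<Rightarrow> 'i set \<Rightarrow> ('a, 'i \<Rightarrow> 'm) module" where
  "dirsum M I = \<lparr>carrier = {f \<in> I \<rightarrow>\<^sub>E carrier M. finite {i \<in> I. f i \<noteq> \<zero>\<^bsub>M\<^esub>}},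
     mult = undefined, one = undefined, zero = (\<lambda>i\<in>I. \<zero>\<^bsub>M\<^esub>),
     add = (\<lambda>f g. \<lambda>i\<in>I. f i \<oplus>\<^bsub>M\<^esub> g i), smult = (\<lambda>a f. \<lambda>i\<in>I. a \<odot>\<^bsub>M\<^esub> f i)\<rparr>"

definition direct_summand :: "('a, 'x) ring_scheme \<Rightarrow> 'm set \<Rightarrow> ('a, 'm, 'y) module_scheme \<Rightarrow> bool" where
  "direct_summand A U M \<longleftrightarrow> submodule U A M \<and>
     (\<exists>V. submodule V A M \<and> U \<inter> V = {\<zero>\<^bsub>M\<^esub>} \<and> U <+>\<^bsub>M\<^esub> V = carrier M)"

definition add_class :: "('a, 'x) ring_scheme \<Rightarrow> ('a, 'c) module \<Rightarrow> ('a, 'm) module set" where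
  "add_class A C = {X. lmodule A X \<and> (\<exists>(k::nat) U. direct_summand A U (dirsum C {..<k}) \<and>
     lmod_iso A X ((dirsum C {..<k})\<lparr>carrier := U\<rparr>))}"

section \<open>Free resolutions and Ext\<close>

definition regular_module :: "('s, 'x) ring_scheme \<Rightarrow> ('s, 's) module" where
  "regular_module S = \<lparr>carrier = carrier S, mult = undefined, one = undefined,
     zero = \<zero>\<^bsub>S\<^esub>, add = (\<oplus>\<^bsub>S\<^esub>), smult = (\<otimes>\<^bsub>S\<^esub>)\<rparr>"

definition free_module :: "('s, 'x) ring_scheme \<Rightarrow> 'i set \<Rightarrow> ('s, 'i \<Rightarrow> 's) module" where
  "free_module S I = dirsum (regular_module S) I"

definition free_resolution :: "('s, 'x) ring_scheme \<Rightarrow> ('s, 'n, 'y) module_scheme \<Rightarrow>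
    (nat \<Rightarrow> 'i set) \<Rightarrow> (nat \<Rightarrow> ('i \<Rightarrow> 's) \<Rightarrow> ('i \<Rightarrow> 's)) \<Rightarrow> (('i \<Rightarrow> 's) \<Rightarrow> 'n) \<Rightarrow> bool" where
  "free_resolution S N I d e \<longleftrightarrow> (let F = (\<lambda>k. free_module S (I k)) in
     e \<in> lhom S (F 0) N \<and> e ` carrier (F 0) = carrier N \<and>
     (\<forall>k. d k \<in> lhom S (F (Suc k)) (F k)) \<and>
     d 0 ` carrier (F 1) = lker (F 0) N e \<and>
     (\<forall>k. d (Suc k) ` carrier (F (Suc (Suc k))) = lker (F (Suc k)) (F k) (d k)))"

text \<open>The cohomology of \<open>Hom\<^sub>S(F 0,Y) \<rightarrow> Hom\<^sub>S(F 1,Y) \<rightarrow> \<cdots>\<close> for a complex with differentials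
  \<open>d k : F (k+1) \<rightarrow> F k\<close>.\<close>

definition hom_cocycles :: "('s, 'x) ring_scheme \<Rightarrow> (nat \<Rightarrow> ('s, 'p) module) \<Rightarrow>
    (nat \<Rightarrow> 'p \<Rightarrow> 'p) \<Rightarrow> ('s, 'm) module \<Rightarrow> nat \<Rightarrow> ('p \<Rightarrow> 'm) set" where
  "hom_cocycles S F d Y i = {\<phi> \<in> lhom S (F i) Y.
     pullback (F (Suc i)) (d i) \<phi> = \<one>\<^bsub>hom_group S (F (Suc i)) Y\<^esub>}"

definition hom_coboundaries :: "('s, 'x) ring_scheme \<Rightarrow> (nat \<Rightarrow> ('s, 'p) module) \<Rightarrow>
    (nat \<Rightarrow> 'p \<Rightarrow> 'p) \<Rightarrow> ('s, 'm) module \<Rightarrow> nat \<Rightarrow> ('p \<Rightarrow> 'm) set" where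
  "hom_coboundaries S F d Y i = (case i of 0 \<Rightarrow> {\<one>\<^bsub>hom_group S (F 0) Y\<^esub>}
     | Suc j \<Rightarrow> pullback (F (Suc j)) (d j) ` lhom S (F j) Y)"

definition hom_cohomology :: "('s, 'x) ring_scheme \<Rightarrow> (nat \<Rightarrow> ('s, 'p) module) \<Rightarrow>
    (nat \<Rightarrow> 'p \<Rightarrow> 'p) \<Rightarrow> ('s, 'm) module \<Rightarrow> nat \<Rightarrow> ('p \<Rightarrow> 'm) set monoid" where
  "hom_cohomology S F d Y i =
     (hom_group S (F i) Y)\<lparr>carrier := hom_cocycles S F d Y i\<rparr> Mod hom_coboundaries S F d Y i"

text \<open>A single type of basis elements that is large enough for a free resolution of every
  \<open>S\<close>-module on the type \<open>'n\<close>, see \<open>free_resolution_exists\<close> below: the basis in degree 0 consists of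
  elements of the module, the basis in degree \<open>k + 1\<close> of codes for linear combinations of basis
  elements in degree \<open>k\<close>.\<close>

datatype ('n, 's) gen = Elt 'n | Rel "(('n, 's) gen \<times> 's) list"

definition Ext :: "nat \<Rightarrow> ('s, 'x) ring_scheme \<Rightarrow> ('s, 'n) module \<Rightarrow> ('s, 'm) module \<Rightarrow>
    ((('n, 's) gen \<Rightarrow> 's) \<Rightarrow> 'm) set monoid" where
  "Ext i S N Y = (case (SOME (I, d, e). free_resolution S N I d e) of
     (I, d, e) \<Rightarrow> hom_cohomology S (\<lambda>k. free_module S (I k)) d Y i)"

section \<open>Dualities with respect to \<open>C\<close>\<close>

definition End_ring :: "('a, 'x) ring_scheme \<Rightarrow> ('a, 'c) module \<Rightarrow> ('c \<Rightarrow> 'c) ring" where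
  "End_ring A C = \<lparr>carrier = lhom A C C, mult = compose (carrier C),
     one = (\<lambda>x\<in>carrier C. x), zero = \<one>\<^bsub>hom_group A C C\<^esub>, add = (\<otimes>\<^bsub>hom_group A C C\<^esub>)\<rparr>"

definition End_module :: "('a, 'c) module \<Rightarrow> ('c \<Rightarrow> 'c, 'c) module" where
  "End_module C = \<lparr>carrier = carrier C, mult = undefined, one = undefined,
     zero = \<zero>\<^bsub>C\<^esub>, add = (\<oplus>\<^bsub>C\<^esub>), smult = (\<lambda>\<gamma> c. \<gamma> c)\<rparr>"

text \<open>\<open>M\<^sup>\<dagger> = Hom\<^sub>A(M,C)\<close> as a left module over \<open>\<Gamma> = End_ring A C\<close>, where \<open>\<gamma>\<close> acts by \<open>f \<mapsto> \<gamma> \<circ> f\<close>.\<close>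

definition dagger :: "('a, 'x) ring_scheme \<Rightarrow> ('a, 'c) module \<Rightarrow> ('a, 'm) module \<Rightarrow>
    ('c \<Rightarrow> 'c, 'm \<Rightarrow> 'c) module" where
  "dagger A C M = hom_module A M C (\<lambda>\<gamma> c. \<gamma> c)"

text \<open>\<open>N\<^sup>\<ddagger> = Hom\<^sub>\<Gamma>(N,C)\<close> as an \<open>A\<close>-module through the action of \<open>A\<close> on \<open>C\<close>.\<close>

definition ddagger :: "('a, 'x) ring_scheme \<Rightarrow> ('a, 'c) module \<Rightarrow> ('c \<Rightarrow> 'c, 'n) module \<Rightarrow>
    ('a, 'n \<Rightarrow> 'c) module" where
  "ddagger A C N = hom_module (End_ring A C) N (End_module C) (\<odot>\<^bsub>C\<^esub>)"

definition eval_map :: "('a, 'x) ring_scheme \<Rightarrow> ('a, 'c) module \<Rightarrow> ('a, 'm) module \<Rightarrow>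
    'm \<Rightarrow> ('m \<Rightarrow> 'c) \<Rightarrow> 'c" where
  "eval_map A C M = (\<lambda>m\<in>carrier M. \<lambda>\<psi>\<in>carrier (dagger A C M). \<psi> m)"

section \<open>The classes Syz, UP and TF\<close>

text \<open>Exactness of \<open>0 \<rightarrow> M \<rightarrow> X 0 \<rightarrow> X 1 \<rightarrow> \<cdots> \<rightarrow> X (n - 1)\<close>, with maps \<open>f : M \<rightarrow> X 0\<close> and
  \<open>d k : X k \<rightarrow> X (k+1)\<close>, for \<open>n \<ge> 1\<close>. There is no condition at the last term.\<close>

definition exact_copresentation :: "('a, 'x) ring_scheme \<Rightarrow> nat \<Rightarrow> ('a, 'm) module \<Rightarrow>
    (nat \<Rightarrow> ('a, 'k) module) \<Rightarrow> ('m \<Rightarrow> 'k) \<Rightarrow> (nat \<Rightarrow> 'k \<Rightarrow> 'k) \<Rightarrow> bool" where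
  "exact_copresentation A n M X f d \<longleftrightarrow>
     f \<in> lhom A M (X 0) \<and> (\<forall>k. Suc k < n \<longrightarrow> d k \<in> lhom A (X k) (X (Suc k))) \<and>
     lker M (X 0) f = {\<zero>\<^bsub>M\<^esub>} \<and>
     (1 < n \<longrightarrow> f ` carrier M = lker (X 0) (X 1) (d 0)) \<and>
     (\<forall>k. Suc (Suc k) < n \<longrightarrow>
        d k ` carrier (X k) = lker (X (Suc k)) (X (Suc (Suc k))) (d (Suc k)))"

text \<open>Exactness of \<open>0 \<leftarrow> M\<^sup>\<dagger> \<leftarrow> (X 0)\<^sup>\<dagger> \<leftarrow> \<cdots> \<leftarrow> (X (n - 1))\<^sup>\<dagger>\<close>, again for \<open>n \<ge> 1\<close>.\<close>

definition exact_dual :: "('a, 'x) ring_scheme \<Rightarrow> ('a, 'c) module \<Rightarrow> nat \<Rightarrow> ('a, 'm) module \<Rightarrow>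
    (nat \<Rightarrow> ('a, 'k) module) \<Rightarrow> ('m \<Rightarrow> 'k) \<Rightarrow> (nat \<Rightarrow> 'k \<Rightarrow> 'k) \<Rightarrow> bool" where
  "exact_dual A C n M X f d \<longleftrightarrow> (let D = (\<lambda>k. dagger A C (X k)) in
     pullback M f ` carrier (D 0) = carrier (dagger A C M) \<and>
     (1 < n \<longrightarrow>
        pullback (X 0) (d 0) ` carrier (D 1) = lker (D 0) (dagger A C M) (pullback M f)) \<and>
     (\<forall>k. Suc (Suc k) < n \<longrightarrow>
        pullback (X (Suc k)) (d (Suc k)) ` carrier (D (Suc (Suc k))) =
          lker (D (Suc k)) (D k) (pullback (X k) (d k))))"

text \<open>Up to isomorphism, every object of \<open>add C\<close> is a submodule of some power of \<open>C\<close> and hence a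
  module on the type \<open>nat \<Rightarrow> 'c\<close>; the terms \<open>X k\<close> range over the modules in \<open>add C\<close> on this type.\<close>

definition Syz_class :: "('a, 'x) ring_scheme \<Rightarrow> nat \<Rightarrow> ('a, 'c) module \<Rightarrow> ('a, 'm) module set" where
  "Syz_class A n C = {M \<in> fg_modules A. n = 0 \<or>
     (\<exists>(X :: nat \<Rightarrow> ('a, nat \<Rightarrow> 'c) module) f d.
        (\<forall>k<n. X k \<in> add_class A C) \<and> exact_copresentation A n M X f d)}"

definition UP_class :: "('a, 'x) ring_scheme \<Rightarrow> nat \<Rightarrow> ('a, 'c) module \<Rightarrow> ('a, 'm) module set" where
  "UP_class A n C = {M \<in> fg_modules A. n = 0 \<or>
     (\<exists>(X :: nat \<Rightarrow> ('a, nat \<Rightarrow> 'c) module) f d.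
        (\<forall>k<n. X k \<in> add_class A C) \<and> exact_copresentation A n M X f d \<and>
        exact_dual A C n M X f d)}"

definition TF_class :: "('a, 'x) ring_scheme \<Rightarrow> nat \<Rightarrow> ('a, 'c) module \<Rightarrow> ('a, 'm) module set" where
  "TF_class A n C = {M \<in> fg_modules A.
     (n = 1 \<longrightarrow> inj_on (eval_map A C M) (carrier M)) \<and>
     (n \<ge> 2 \<longrightarrow> bij_betw (eval_map A C M) (carrier M)
        (carrier (ddagger A C (dagger A C M)))) \<and>
     (n \<ge> 3 \<longrightarrow> (\<forall>i\<in>{1..n - 2}.
        trivial_group (Ext i (End_ring A C) (dagger A C M) (End_module C))))}"

section \<open>Existence of free resolutions\<close>

text \<open>The choice in the definition of \<open>Ext\<close> is always from a nonempty set.\<close>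

lemma lmodule_dirsum:
  assumes "lmodule S N" shows "lmodule S (dirsum N I)"
proof -
  interpret lmodule S N by fact
  have fin: "finite {i \<in> I. (if i \<in> I then f i \<oplus>\<^bsub>N\<^esub> g i else undefined) \<noteq> \<zero>\<^bsub>N\<^esub>}"
    if "finite {i \<in> I. f i \<noteq> \<zero>\<^bsub>N\<^esub>}" "finite {i \<in> I. g i \<noteq> \<zero>\<^bsub>N\<^esub>}" for f g
    by (rule finite_subset[OF _ finite_UnI[OF that]]) auto
  have null: "a \<odot>\<^bsub>N\<^esub> \<zero>\<^bsub>N\<^esub> = \<zero>\<^bsub>N\<^esub>" if "a \<in> carrier S" for a
    using smult_r_distr[of a "\<zero>\<^bsub>N\<^esub>" "\<zero>\<^bsub>N\<^esub>"] that
    by (metis M.add.l_cancel_one' M.zero_closed smult_closed M.l_zero)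
  have fin2: "finite {i \<in> I. (if i \<in> I then a \<odot>\<^bsub>N\<^esub> f i else undefined) \<noteq> \<zero>\<^bsub>N\<^esub>}"
    if "finite {i \<in> I. f i \<noteq> \<zero>\<^bsub>N\<^esub>}" "a \<in> carrier S" for a f
    by (rule finite_subset[OF _ that(1)]) (use null that in auto)
  have fin3: "finite {i \<in> I. (if i \<in> I then \<ominus>\<^bsub>N\<^esub> f i else undefined) \<noteq> \<zero>\<^bsub>N\<^esub>}"
    if "finite {i \<in> I. f i \<noteq> \<zero>\<^bsub>N\<^esub>}" for f
    by (rule finite_subset[OF _ that]) auto
  show ?thesis
  proof (intro lmodule.intro lmodule_axioms.intro)
    show "ring S" by unfold_locales
    show "abelian_group (dirsum N I)"
    proof (rule abelian_groupI)
      fix f assume f: "f \<in> carrier (dirsum N I)"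
      let ?g = "\<lambda>i\<in>I. \<ominus>\<^bsub>N\<^esub> f i"
      have "?g \<in> carrier (dirsum N I)" using f fin3[of f] by (auto simp: dirsum_def)
      moreover have "?g \<oplus>\<^bsub>dirsum N I\<^esub> f = \<zero>\<^bsub>dirsum N I\<^esub>"
        using f M.l_neg by (auto simp: dirsum_def PiE_iff fun_eq_iff)
      ultimately show "\<exists>g\<in>carrier (dirsum N I). g \<oplus>\<^bsub>dirsum N I\<^esub> f = \<zero>\<^bsub>dirsum N I\<^esub>" by blast
    qed (auto simp: dirsum_def fin M.a_assoc PiE_iff extensional_def fun_eq_iff intro: M.a_comm)
  qed (auto simp: dirsum_def fin2 PiE_mem smult_l_distr smult_r_distr smult_assoc1 PiE_iff
      extensional_def fun_eq_iff)
qed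

lemma lmodule_regular: "ring S \<Longrightarrow> lmodule S (regular_module S)"
proof -
  assume "ring S"
  then interpret ring S .
  have "abelian_group (regular_module S)"
  proof (rule abelian_groupI)
    fix x assume "x \<in> carrier (regular_module S)"
    then show "\<exists>y\<in>carrier (regular_module S). y \<oplus>\<^bsub>regular_module S\<^esub> x = \<zero>\<^bsub>regular_module S\<^esub>"
      by (intro bexI[of _ "\<ominus>\<^bsub>S\<^esub> x"]) (auto simp: regular_module_def l_neg)
  qed (auto simp: regular_module_def a_assoc intro: a_comm)
  then show ?thesis
    by (intro lmodule.intro lmodule_axioms.intro)
      (auto simp: regular_module_def l_distr r_distr m_assoc ring_axioms)
qed

lemma lmodule_free: "ring S \<Longrightarrow> lmodule S (free_module S I)"
  by (simp add: free_module_def lmodule_dirsum lmodule_regular)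

lemma lmodule_lker:
  assumes "lmodule S M" "lmodule S N" "f \<in> lhom S M N"
  shows "lmodule S (M\<lparr>carrier := lker M N f\<rparr>)"
proof -
  interpret M: lmodule S M by fact
  interpret N: lmodule S N by fact
  have f: "f x \<in> carrier N" if "x \<in> carrier M" for x
    using assms(3) that by (auto simp: lhom_def)
  have fadd: "f (x \<oplus>\<^bsub>M\<^esub> y) = f x \<oplus>\<^bsub>N\<^esub> f y" if "x \<in> carrier M" "y \<in> carrier M" for x y
    using assms(3) that by (auto simp: lhom_def)
  have fsmult: "f (a \<odot>\<^bsub>M\<^esub> x) = a \<odot>\<^bsub>N\<^esub> f x" if "a \<in> carrier S" "x \<in> carrier M" for a x
    using assms(3) that by (auto simp: lhom_def)
  have null: "a \<odot>\<^bsub>N\<^esub> \<zero>\<^bsub>N\<^esub> = \<zero>\<^bsub>N\<^esub>" if "a \<in> carrier S" for a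
    using N.smult_r_distr[of a "\<zero>\<^bsub>N\<^esub>" "\<zero>\<^bsub>N\<^esub>"] that
    by (metis N.M.add.l_cancel_one' N.M.zero_closed N.smult_closed N.M.l_zero)
  have f0: "f \<zero>\<^bsub>M\<^esub> = \<zero>\<^bsub>N\<^esub>"
    using fadd[of "\<zero>\<^bsub>M\<^esub>" "\<zero>\<^bsub>M\<^esub>"] f[of "\<zero>\<^bsub>M\<^esub>"] M.M.zero_closed
    by (metis N.M.add.l_cancel_one' M.M.l_zero)
  have fneg: "f (\<ominus>\<^bsub>M\<^esub> x) = \<zero>\<^bsub>N\<^esub>" if "x \<in> carrier M" "f x = \<zero>\<^bsub>N\<^esub>" for x
    using fadd[of "\<ominus>\<^bsub>M\<^esub> x" x] f[of "\<ominus>\<^bsub>M\<^esub> x"] that f0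
    by (metis M.M.a_inv_closed M.M.l_neg N.M.r_zero)
  show ?thesis
  proof (intro lmodule.intro lmodule_axioms.intro)
    show "ring S" by unfold_locales
    show "abelian_group (M\<lparr>carrier := lker M N f\<rparr>)"
    proof (rule abelian_groupI)
      fix x assume "x \<in> carrier (M\<lparr>carrier := lker M N f\<rparr>)"
      then show "\<exists>y\<in>carrier (M\<lparr>carrier := lker M N f\<rparr>).
          y \<oplus>\<^bsub>M\<lparr>carrier := lker M N f\<rparr>\<^esub> x = \<zero>\<^bsub>M\<lparr>carrier := lker M N f\<rparr>\<^esub>"
        by (intro bexI[of _ "\<ominus>\<^bsub>M\<^esub> x"]) (auto simp: lker_def fneg M.M.l_neg)
    qed (auto simp: lker_def fadd f0 M.M.a_assoc intro: M.M.a_comm)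
  qed (auto simp: lker_def fsmult null M.smult_l_distr M.smult_r_distr M.smult_assoc1)
qed

lemma free_cover:
  assumes N: "lmodule S N" and inj: "inj_on c (carrier N)"
  shows "\<exists>h \<in> lhom S (free_module S (c ` carrier N)) N.
           h ` carrier (free_module S (c ` carrier N)) = carrier N"
proof -
  interpret lmodule S N by fact
  define I where "I = c ` carrier N"
  define g where "g = the_inv_into (carrier N) c"
  have g: "g i \<in> carrier N" if "i \<in> I" for i
    using that inj by (auto simp: I_def g_def the_inv_into_f_f)
  let ?F = "free_module S I"
  define supp where "supp f = {i \<in> I. f i \<noteq> \<zero>\<^bsub>S\<^esub>}" for f
  define t where "t A f = (\<Oplus>\<^bsub>N\<^esub>i\<in>A. f i \<odot>\<^bsub>N\<^esub> g i)" for A f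
  define h where "h = (\<lambda>f\<in>carrier ?F. t (supp f) f)"
  have F: "f \<in> carrier ?F \<longleftrightarrow> f \<in> I \<rightarrow>\<^sub>E carrier S \<and> finite (supp f)" for f
    by (simp add: free_module_def dirsum_def regular_module_def supp_def)
  have add: "x \<oplus>\<^bsub>?F\<^esub> y = (\<lambda>i\<in>I. x i \<oplus>\<^bsub>S\<^esub> y i)" and sm: "a \<odot>\<^bsub>?F\<^esub> x = (\<lambda>i\<in>I. a \<otimes>\<^bsub>S\<^esub> x i)"
    for a x y by (simp_all add: free_module_def dirsum_def regular_module_def)
  interpret F: lmodule S ?F by (rule lmodule_free) unfold_locales
  have null: "\<zero>\<^bsub>S\<^esub> \<odot>\<^bsub>N\<^esub> x = \<zero>\<^bsub>N\<^esub>" if "x \<in> carrier N" for x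
    using smult_l_distr[of "\<zero>\<^bsub>S\<^esub>" "\<zero>\<^bsub>S\<^esub>" x] that
    by (metis M.add.l_cancel_one' smult_closed R.zero_closed R.l_zero)
  have null': "a \<odot>\<^bsub>N\<^esub> \<zero>\<^bsub>N\<^esub> = \<zero>\<^bsub>N\<^esub>" if "a \<in> carrier S" for a
    using smult_r_distr[of a "\<zero>\<^bsub>N\<^esub>" "\<zero>\<^bsub>N\<^esub>"] that
    by (metis M.add.l_cancel_one' M.zero_closed smult_closed M.l_zero)
  have tm: "(\<lambda>i. f i \<odot>\<^bsub>N\<^esub> g i) \<in> A \<rightarrow> carrier N" if "f \<in> carrier ?F" "A \<subseteq> I" for f A
    using that g by (auto simp: F)
  have h_eq: "h f = t A f" if "f \<in> carrier ?F" "finite A" "supp f \<subseteq> A" "A \<subseteq> I" for f A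
  proof -
    have "t (supp f) f = t A f"
      unfolding t_def
      by (rule M.add.finprod_mono_neutral_cong_left) (use that tm g null in \<open>auto simp: supp_def\<close>)
    then show ?thesis using that by (simp add: h_def)
  qed
  have sub: "supp f \<subseteq> I" for f by (auto simp: supp_def)
  have "h \<in> lhom S ?F N"
  proof -
    have "h \<in> carrier ?F \<rightarrow>\<^sub>E carrier N"
      by (auto simp: h_def t_def intro!: M.finsum_closed tm sub)
        (use g sub in \<open>force simp: F PiE_iff\<close>)
    moreover have "h (x \<oplus>\<^bsub>?F\<^esub> y) = h x \<oplus>\<^bsub>N\<^esub> h y" if "x \<in> carrier ?F" "y \<in> carrier ?F" for x y
    proof -
      let ?A = "supp x \<union> supp y"
      have A: "finite ?A" "?A \<subseteq> I" using that sub by (auto simp: F)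
      have xy: "x \<oplus>\<^bsub>?F\<^esub> y \<in> carrier ?F" using that by simp
      have "supp (x \<oplus>\<^bsub>?F\<^esub> y) \<subseteq> ?A" by (auto simp: add supp_def)
      then have "h (x \<oplus>\<^bsub>?F\<^esub> y) = t ?A (x \<oplus>\<^bsub>?F\<^esub> y)" by (rule h_eq[OF xy A(1) _ A(2)])
      also have "\<dots> = (\<Oplus>\<^bsub>N\<^esub>i\<in>?A. x i \<odot>\<^bsub>N\<^esub> g i \<oplus>\<^bsub>N\<^esub> y i \<odot>\<^bsub>N\<^esub> g i)"
        unfolding t_def
      proof (rule M.add.finprod_cong')
        show "(\<lambda>i. x i \<odot>\<^bsub>N\<^esub> g i \<oplus>\<^bsub>N\<^esub> y i \<odot>\<^bsub>N\<^esub> g i) \<in> ?A \<rightarrow> carrier N"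
          using tm[OF that(1) A(2)] tm[OF that(2) A(2)] by blast
        fix i assume "i \<in> ?A"
        then have "i \<in> I" using A by blast
        then show "(x \<oplus>\<^bsub>?F\<^esub> y) i \<odot>\<^bsub>N\<^esub> g i = x i \<odot>\<^bsub>N\<^esub> g i \<oplus>\<^bsub>N\<^esub> y i \<odot>\<^bsub>N\<^esub> g i"
          using that g by (auto simp: add F intro!: smult_l_distr)
      qed simp
      also have "\<dots> = t ?A x \<oplus>\<^bsub>N\<^esub> t ?A y"
        unfolding t_def by (rule M.finsum_addf) (use tm that A in auto)
      also have "\<dots> = h x \<oplus>\<^bsub>N\<^esub> h y" using that A by (simp add: h_eq[where A = ?A])
      finally show ?thesis .
    qed
    moreover have "h (a \<odot>\<^bsub>?F\<^esub> x) = a \<odot>\<^bsub>N\<^esub> h x" if "a \<in> carrier S" "x \<in> carrier ?F" for a x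
    proof -
      have fx: "finite (supp x)" using that by (simp add: F)
      have ax: "a \<odot>\<^bsub>?F\<^esub> x \<in> carrier ?F" using that by simp
      have *: "a \<odot>\<^bsub>N\<^esub> t A x = t A (a \<odot>\<^bsub>?F\<^esub> x)" if "finite A" "A \<subseteq> I" for A
        using that
      proof (induction A rule: finite_induct)
        case empty then show ?case using \<open>a \<in> carrier S\<close> by (simp add: t_def null')
      next
        case (insert i A)
        then have i: "i \<in> I" and A: "A \<subseteq> I" by auto
        have ti: "t (insert i A) u = u i \<odot>\<^bsub>N\<^esub> g i \<oplus>\<^bsub>N\<^esub> t A u" if "u \<in> carrier ?F" for u
          unfolding t_def
          by (rule M.finsum_insert) (use insert tm[OF that A] tm[OF that, of "{i}"] i in auto)
        have c: "t A u \<in> carrier N" "u i \<odot>\<^bsub>N\<^esub> g i \<in> carrier N" "u i \<in> carrier S"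
          if "u \<in> carrier ?F" for u
          using tm[OF that A] tm[OF that, of "{i}"] i that
          by (auto simp: t_def F intro: M.finsum_closed)
        have "(a \<odot>\<^bsub>?F\<^esub> x) i = a \<otimes>\<^bsub>S\<^esub> x i" using i by (simp add: sm)
        then show ?case
          unfolding ti[OF \<open>x \<in> carrier ?F\<close>] ti[OF ax] insert.IH[OF A, symmetric]
          using c[OF \<open>x \<in> carrier ?F\<close>] g[OF i] \<open>a \<in> carrier S\<close>
          by (simp add: smult_r_distr smult_assoc1)
      qed
      have "supp (a \<odot>\<^bsub>?F\<^esub> x) \<subseteq> supp x" using that by (auto simp: sm supp_def)
      then show ?thesis using *[OF fx sub] that ax fx sub
        by (simp add: h_eq[OF ax fx] h_eq[OF _ fx])
    qed
    ultimately show ?thesis by (auto simp: lhom_def)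
  qed
  moreover have "h ` carrier ?F = carrier N"
  proof
    show "h ` carrier ?F \<subseteq> carrier N" using calculation by (auto simp: lhom_def)
    show "carrier N \<subseteq> h ` carrier ?F"
    proof
      fix x assume x: "x \<in> carrier N"
      let ?u = "\<lambda>i\<in>I. if i = c x then \<one>\<^bsub>S\<^esub> else \<zero>\<^bsub>S\<^esub>"
      have cx: "c x \<in> I" "g (c x) = x" using x inj by (auto simp: I_def g_def the_inv_into_f_f)
      have s: "supp ?u \<subseteq> {c x}" by (auto simp: supp_def)
      then have u: "?u \<in> carrier ?F" by (auto simp: F dest: finite_subset)
      have "h ?u = t {c x} ?u" by (rule h_eq[OF u _ s]) (use cx in auto)
      also have "\<dots> = x" using x cx unfolding t_def by (subst M.finsum_insert) auto
      finally show "x \<in> h ` carrier ?F" using u by force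
    qed
  qed
  ultimately show ?thesis by (auto simp: I_def)
qed

lemma free_module_code:
  "\<exists>c :: (('n, 's) gen \<Rightarrow> 's) \<Rightarrow> ('n, 's) gen. inj_on c (carrier (free_module S I))"
proof -
  define gr where "gr f = (\<lambda>i. (i, f i)) ` {i \<in> I. f i \<noteq> \<zero>\<^bsub>S\<^esub>}" for f :: "('n, 's) gen \<Rightarrow> 's"
  define c where "c f = Rel (SOME l. set l = gr f)" for f
  have "inj_on c (carrier (free_module S I))"
  proof (rule inj_onI)
    fix f f' assume a: "f \<in> carrier (free_module S I)" "f' \<in> carrier (free_module S I)" "c f = c f'"
    have fin: "finite (gr u)" if "u \<in> carrier (free_module S I)" for u
      using that by (auto simp: gr_def free_module_def dirsum_def regular_module_def)
    have "set (SOME l. set l = gr u) = gr u" if "u \<in> carrier (free_module S I)" for u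
      using finite_list[OF fin[OF that]] by (rule someI_ex)
    from this[OF a(1)] this[OF a(2)] a(3) have eq: "gr f = gr f'" unfolding c_def gen.inject by argo
    have ext: "f i = undefined" "f' i = undefined" if "i \<notin> I" for i
      using a(1,2) that by (auto simp: free_module_def dirsum_def)
    show "f = f'"
    proof
      fix i
      show "f i = f' i"
      proof (cases "i \<in> I")
        case True
        have "(i, v) \<in> gr u \<longleftrightarrow> v = u i \<and> u i \<noteq> \<zero>\<^bsub>S\<^esub>" for u v using True by (auto simp: gr_def)
        from this[of _ f] this[of _ f'] show ?thesis unfolding eq by metis
      qed (simp add: ext)
    qed
  qed
  then show ?thesis by blast
qed

lemma free_resolution_exists:
  fixes S :: "('s, 'x) ring_scheme" and N :: "('s, 'n, 'y) module_scheme"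
  assumes "lmodule S N"
  shows "\<exists>(I :: nat \<Rightarrow> ('n, 's) gen set) d e. free_resolution S N I d e"
proof -
  interpret lmodule S N by fact
  let ?F = "free_module S :: ('n, 's) gen set \<Rightarrow> _"
  have F: "lmodule S (?F I)" for I by (rule lmodule_free) unfold_locales
  have step: "\<exists>J. \<exists>d \<in> lhom S (?F J) (?F I). d ` carrier (?F J) = K"
    if K: "lmodule S ((?F I)\<lparr>carrier := K\<rparr>)" "K \<subseteq> carrier (?F I)" for I K
  proof -
    obtain c :: "(('n, 's) gen \<Rightarrow> 's) \<Rightarrow> ('n, 's) gen" where "inj_on c (carrier (?F I))"
      using free_module_code by blast
    from inj_on_subset[OF this K(2)] have "inj_on c (carrier ((?F I)\<lparr>carrier := K\<rparr>))" by simp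
    from free_cover[OF K(1) this] obtain J d
      where d: "d \<in> lhom S (?F J) ((?F I)\<lparr>carrier := K\<rparr>)" "d ` carrier (?F J) = K"
      by auto
    have "d \<in> lhom S (?F J) (?F I)" using d(1) K(2) by (auto simp: lhom_def PiE_iff)
    with d(2) show ?thesis by blast
  qed
  define P where "P = (\<lambda>(I, K). lmodule S ((?F I)\<lparr>carrier := K\<rparr>) \<and> K \<subseteq> carrier (?F I))"
  define Q where "Q = (\<lambda>(I, K) (J, L). \<exists>d \<in> lhom S (?F J) (?F I).
      d ` carrier (?F J) = K \<and> L = lker (?F J) (?F I) d)"
  define I0 where "I0 = (Elt :: 'n \<Rightarrow> ('n, 's) gen) ` carrier N"
  obtain e where e: "e \<in> lhom S (?F I0) N" "e ` carrier (?F I0) = carrier N"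
    using free_cover[OF assms inj_onI, of "Elt :: 'n \<Rightarrow> ('n, 's) gen"] unfolding I0_def by blast
  define K0 where "K0 = lker (?F I0) N e"
  have P0: "P (I0, K0)"
    using lmodule_lker[OF F assms e(1)] by (simp add: P_def K0_def) (simp add: lker_def)
  have "\<exists>f. \<forall>n. (P (f n) \<and> (n = 0 \<longrightarrow> f n = (I0, K0))) \<and> Q (f n) (f (Suc n))"
  proof (rule dependent_nat_choice)
    show "\<exists>x. P x \<and> (0 = (0::nat) \<longrightarrow> x = (I0, K0))" using P0 by blast
    fix x and n :: nat assume x: "P x \<and> (n = 0 \<longrightarrow> x = (I0, K0))"
    obtain I K where xe: "x = (I, K)" by force
    obtain J d where d: "d \<in> lhom S (?F J) (?F I)" "d ` carrier (?F J) = K"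
      using step[where I = I and K = K] x unfolding P_def xe by blast
    have "P (J, lker (?F J) (?F I) d)" using lmodule_lker[OF F F d(1)]
      by (simp add: P_def) (simp add: lker_def)
    moreover have "Q x (J, lker (?F J) (?F I) d)" using d unfolding Q_def xe by blast
    ultimately show "\<exists>y. (P y \<and> (Suc n = 0 \<longrightarrow> y = (I0, K0))) \<and> Q x y" by blast
  qed
  then obtain f where f: "f 0 = (I0, K0)" "\<And>n. Q (f n) (f (Suc n))" by blast
  define I where "I = (\<lambda>n. fst (f n))"
  define W where "W n d \<longleftrightarrow> d \<in> lhom S (?F (I (Suc n))) (?F (I n)) \<and>
      d ` carrier (?F (I (Suc n))) = snd (f n) \<and> snd (f (Suc n)) = lker (?F (I (Suc n))) (?F (I n)) d"
    for n d
  have "\<forall>n. \<exists>d. W n d"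
    using f(2) by (simp add: W_def Q_def I_def case_prod_unfold Bex_def)
  then have "\<exists>d. \<forall>n. W n (d n)" by (rule choice)
  then obtain d where W: "\<And>n. W n (d n)" by blast
  have d: "d n \<in> lhom S (?F (I (Suc n))) (?F (I n))"
    "d n ` carrier (?F (I (Suc n))) = snd (f n)"
    "snd (f (Suc n)) = lker (?F (I (Suc n))) (?F (I n)) (d n)" for n
    using W[of n] unfolding W_def by auto
  have I0: "I 0 = I0" by (simp add: I_def f)
  have "free_resolution S N I d e"
    unfolding free_resolution_def Let_def
  proof (intro conjI allI)
    show "e \<in> lhom S (?F (I 0)) N" "e ` carrier (?F (I 0)) = carrier N"
      using e by (simp_all add: I0)
    show "d 0 ` carrier (?F (I 1)) = lker (?F (I 0)) N e"
      using d(2)[of 0] by (simp add: I0 f K0_def)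
    show "d k \<in> lhom S (?F (I (Suc k))) (?F (I k))" for k by (rule d(1))
    show "d (Suc k) ` carrier (?F (I (Suc (Suc k)))) = lker (?F (I (Suc k))) (?F (I k)) (d k)" for k
      using d(2)[of "Suc k"] d(3)[of k] by (rule trans)
  qed
  then show ?thesis by blast
qed

end

theory Submission
  imports Defs
begin

text \<open>Write \<open>A\<close> for the opposite ring of \<open>\<Lambda>\<close>, so that right \<open>\<Lambda>\<close>-modules are left \<open>A\<close>-modules.

  The modules \<open>X\<close> in \<open>add C\<close> have homomorphisms \<open>\<pi> j : X \<rightarrow> C\<close> and \<open>\<iota> j : C \<rightarrow> X\<close>, finite in number,
  with \<open>\<Sum>j. \<iota> j \<circ> \<pi> j = id\<close>. Hence \<open>\<lambda>\<^sub>X\<close> is bijective and \<open>X\<^sup>\<dagger>\<close> is a projective \<open>\<Gamma>\<close>-module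
  (\<open>retract_separated\<close>, \<open>retract_reflexive\<close>, \<open>retract_dual_basis\<close>).

  Let \<open>M \<rightarrow> X 0 \<rightarrow> X 1 \<rightarrow> \<cdots> \<rightarrow> X (n - 1)\<close> be maps with all \<open>X k\<close> in \<open>add C\<close> whose dual, with
  \<open>0 \<leftarrow> M\<^sup>\<dagger>\<close> attached, is exact. The dual is then the beginning of a projective resolution of \<open>M\<^sup>\<dagger>\<close>,
  and applying \<open>Hom\<^sub>\<Gamma>(-,C)\<close> to this resolution gives back \<open>X 0 \<rightarrow> X 1 \<rightarrow> \<cdots>\<close> by reflexivity. So
  exactness of the sequence at \<open>M\<close> means that \<open>\<lambda>\<^sub>M\<close> is injective; exactness at \<open>X 0\<close> means
  that \<open>\<lambda>\<^sub>M\<close> is surjective; and exactness at \<open>X (k + 1)\<close> means that \<open>Ext\<close> of \<open>M\<^sup>\<dagger>\<close> and \<open>C\<close>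
  vanishes in degree \<open>k + 1\<close>. This is \<open>exact_copresentation_iff\<close>: for such a sequence, exactness and
  the condition defining the class TF are equivalent. The vanishing of \<open>Ext\<close> refers to one chosen
  free resolution; it is transferred to another projective resolution by comparison maps and a
  homotopy (\<open>cohomology_vanishes_transfer\<close>, \<open>trivial_Ext_iff\<close>).

  It follows at once that UP is contained in TF. For the converse, every finitely generated \<open>M\<close>
  needs a sequence with exact dual (\<open>dual_exact_complex_exists\<close>). Here the Noetherian hypothesis
  enters: \<open>C\<close> is finitely generated over \<open>R\<close>, which acts on \<open>C\<close> by endomorphisms, so every
  \<open>\<Gamma>\<close>-submodule \<open>K\<close> of \<open>W\<^sup>\<dagger>\<close>, for \<open>W = M\<close> or \<open>W = C\<^sup>r\<close>, has finitely many generators. These are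
  the components of a map \<open>g : W \<rightarrow> C\<^sup>s\<close> such that \<open>g\<^sup>\<dagger>\<close> has image \<open>K\<close> (\<open>approximation_exists\<close>). Taking
  for \<open>K\<close> first \<open>M\<^sup>\<dagger>\<close> and then the kernel of the dual of the preceding map yields the sequence.

  Finally, a module that embeds into a module in \<open>add C\<close> has injective \<open>\<lambda>\<^sub>M\<close>, which settles the
  comparison of Syz and UP for \<open>n = 1\<close>.\<close>

section \<open>Linear maps\<close>

text \<open>A linear map together with the modules between which it acts. Unlike the elements of
  \<open>lhom A M N\<close>, these maps are not required to be extensional, so that terms such as
  \<open>pullback M f\<close> and sums of composites are instances without restricting them to a carrier.\<close>

locale lmod_hom = M: lmodule A M + N: lmodule A N
  for A :: "('a, 'x) ring_scheme" and M :: "('a, 'm, 'y) module_scheme"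
    and N :: "('a, 'n, 'z) module_scheme" +
  fixes f :: "'m \<Rightarrow> 'n"
  assumes closed: "x \<in> carrier M \<Longrightarrow> f x \<in> carrier N"
    and add: "\<lbrakk>x \<in> carrier M; y \<in> carrier M\<rbrakk> \<Longrightarrow> f (x \<oplus>\<^bsub>M\<^esub> y) = f x \<oplus>\<^bsub>N\<^esub> f y"
    and smult: "\<lbrakk>a \<in> carrier A; x \<in> carrier M\<rbrakk> \<Longrightarrow> f (a \<odot>\<^bsub>M\<^esub> x) = a \<odot>\<^bsub>N\<^esub> f x"

lemma (in lmodule) smult_l_null: "x \<in> carrier M \<Longrightarrow> \<zero>\<^bsub>R\<^esub> \<odot>\<^bsub>M\<^esub> x = \<zero>\<^bsub>M\<^esub>"
  using smult_l_distr[of "\<zero>\<^bsub>R\<^esub>" "\<zero>\<^bsub>R\<^esub>" x]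
  by (metis M.add.l_cancel_one' smult_closed R.zero_closed R.l_zero)

lemma (in lmodule) smult_r_null: "a \<in> carrier R \<Longrightarrow> a \<odot>\<^bsub>M\<^esub> \<zero>\<^bsub>M\<^esub> = \<zero>\<^bsub>M\<^esub>"
  using smult_r_distr[of a "\<zero>\<^bsub>M\<^esub>" "\<zero>\<^bsub>M\<^esub>"]
  by (metis M.add.l_cancel_one' M.zero_closed smult_closed M.l_zero)

lemma (in lmodule) smult_r_minus:
  assumes "a \<in> carrier R" "x \<in> carrier M"
  shows "a \<odot>\<^bsub>M\<^esub> (\<ominus>\<^bsub>M\<^esub> x) = \<ominus>\<^bsub>M\<^esub> (a \<odot>\<^bsub>M\<^esub> x)"
proof -
  have "a \<odot>\<^bsub>M\<^esub> (\<ominus>\<^bsub>M\<^esub> x) \<oplus>\<^bsub>M\<^esub> a \<odot>\<^bsub>M\<^esub> x = \<zero>\<^bsub>M\<^esub>"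
    using assms smult_r_distr[of a "\<ominus>\<^bsub>M\<^esub> x" x] by (simp add: M.l_neg smult_r_null)
  then show ?thesis using assms by (simp add: M.minus_equality)
qed

lemma (in lmodule) smult_finsum:
  assumes "finite I" "a \<in> carrier R" "\<And>i. i \<in> I \<Longrightarrow> u i \<in> carrier M"
  shows "a \<odot>\<^bsub>M\<^esub> finsum M u I = finsum M (\<lambda>i. a \<odot>\<^bsub>M\<^esub> u i) I"
  using assms(1,3)
proof (induction I rule: finite_induct)
  case empty then show ?case by (simp add: assms(2) smult_r_null)
next
  case (insert i I)
  then show ?case
    by (subst (1 2) M.finsum_insert)
      (auto simp: assms(2) smult_r_distr intro!: M.finsum_closed)
qed

lemma (in abelian_group) diff_zero: "x \<in> carrier G \<Longrightarrow> x \<ominus> \<zero> = x"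
  using minus_equality[of \<zero> \<zero>] by (simp add: a_minus_def)

lemma (in abelian_group) eq_add_of_diff:
  assumes "x \<in> carrier G" "y \<in> carrier G" "z \<in> carrier G" "(x \<ominus> y) \<ominus> z = \<zero>"
  shows "x = y \<oplus> z"
proof -
  have "y \<oplus> z = y \<oplus> (((x \<ominus> y) \<ominus> z) \<oplus> z)" using assms(2,3) unfolding assms(4) by simp
  also have "\<dots> = x" using assms(1-3) by (simp add: a_minus_def a_assoc l_neg r_neg r_neg2 a_lcomm[of y x])
  finally show ?thesis by simp
qed

lemma (in abelian_group) eq_of_diff_zero:
  "\<lbrakk>x \<in> carrier G; y \<in> carrier G; x \<ominus> y = \<zero>\<rbrakk> \<Longrightarrow> x = y"
  using eq_add_of_diff[of x y \<zero>] by (simp add: diff_zero)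

lemma abelian_group_of_comm_group:
  assumes "comm_group G" "carrier M = carrier G" "add M = mult G" "zero M = one G"
  shows "abelian_group M"
proof -
  interpret comm_group G by fact
  show ?thesis
  proof (rule abelian_groupI)
    show "\<exists>y\<in>carrier M. y \<oplus>\<^bsub>M\<^esub> x = \<zero>\<^bsub>M\<^esub>" if "x \<in> carrier M" for x
      using that assms by (intro bexI[of _ "inv\<^bsub>G\<^esub> x"]) auto
  qed (auto simp: assms(2-4) m_assoc intro: m_comm)
qed

lemma (in abelian_monoid) finsum_mem:
  assumes "finite I" "\<zero> \<in> T" "T \<subseteq> carrier G" "\<And>x y. x \<in> T \<Longrightarrow> y \<in> T \<Longrightarrow> x \<oplus> y \<in> T" "\<And>i. i \<in> I \<Longrightarrow> f i \<in> T"
  shows "finsum G f I \<in> T"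
  using assms(1,5)
proof (induction I rule: finite_induct)
  case empty then show ?case using assms(2) by simp
next
  case (insert i I)
  then have "finsum G f (insert i I) = f i \<oplus> finsum G f I"
    using assms(3) by (intro finsum_insert) auto
  then show ?case using insert assms(4) by auto
qed

context lmod_hom begin

lemma zero: "f \<zero>\<^bsub>M\<^esub> = \<zero>\<^bsub>N\<^esub>"
  using add[of "\<zero>\<^bsub>M\<^esub>" "\<zero>\<^bsub>M\<^esub>"] closed[of "\<zero>\<^bsub>M\<^esub>"]
  by (metis M.M.l_zero M.M.zero_closed N.M.add.l_cancel_one')

lemma neg: "x \<in> carrier M \<Longrightarrow> f (\<ominus>\<^bsub>M\<^esub> x) = \<ominus>\<^bsub>N\<^esub> f x"
  using add[of "\<ominus>\<^bsub>M\<^esub> x" x] closed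
  by (metis M.M.a_inv_closed M.M.l_neg N.M.minus_equality zero)

lemma diff: "x \<in> carrier M \<Longrightarrow> y \<in> carrier M \<Longrightarrow> f (x \<ominus>\<^bsub>M\<^esub> y) = f x \<ominus>\<^bsub>N\<^esub> f y"
  by (simp add: a_minus_def add neg)

lemma finsum:
  assumes "finite I" "\<And>i. i \<in> I \<Longrightarrow> u i \<in> carrier M"
  shows "f (finsum M u I) = finsum N (\<lambda>i. f (u i)) I"
  using assms
proof (induction I rule: finite_induct)
  case empty then show ?case by (simp add: zero)
next
  case (insert i I)
  then show ?case
    by (subst M.M.finsum_insert N.M.finsum_insert; auto simp: add closed intro!: M.M.finsum_closed)
qed

end

lemma lmod_hom_of_lhom: "f \<in> lhom A M N \<Longrightarrow> lmodule A M \<Longrightarrow> lmodule A N \<Longrightarrow> lmod_hom A M N f"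
  by (auto simp: lhom_def lmod_hom_def lmod_hom_axioms_def)

lemma (in lmod_hom) restrict_in_lhom: "restrict f (carrier M) \<in> lhom A M N"
  by (auto simp: lhom_def closed add smult)

lemma lmod_hom_id: "lmodule A M \<Longrightarrow> lmod_hom A M M (\<lambda>x. x)"
  by (simp add: lmod_hom_def lmod_hom_axioms_def)

lemma lmod_hom_comp:
  assumes "lmod_hom A M N f" "lmod_hom A N L g"
  shows "lmod_hom A M L (\<lambda>x. g (f x))"
proof -
  interpret f: lmod_hom A M N f by fact
  interpret g: lmod_hom A N L g by fact
  show ?thesis by unfold_locales (auto simp: f.closed g.closed f.add g.add f.smult g.smult)
qed

lemma lmod_hom_add:
  assumes "lmod_hom A M N f" "lmod_hom A M N g"
  shows "lmod_hom A M N (\<lambda>x. f x \<oplus>\<^bsub>N\<^esub> g x)"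
proof -
  interpret f: lmod_hom A M N f by fact
  interpret g: lmod_hom A M N g by fact
  show ?thesis
    by unfold_locales (auto simp: f.closed g.closed f.add g.add f.smult g.smult
        f.N.smult_r_distr f.N.M.a_ac)
qed

lemma lmod_hom_neg:
  assumes "lmod_hom A M N f"
  shows "lmod_hom A M N (\<lambda>x. \<ominus>\<^bsub>N\<^esub> f x)"
proof -
  interpret f: lmod_hom A M N f by fact
  show ?thesis
    by unfold_locales (auto simp: f.closed f.add f.smult f.N.smult_r_minus f.N.M.minus_add)
qed

lemma lmod_hom_diff:
  assumes "lmod_hom A M N f" "lmod_hom A M N g"
  shows "lmod_hom A M N (\<lambda>x. f x \<ominus>\<^bsub>N\<^esub> g x)"
  using lmod_hom_add[OF assms(1) lmod_hom_neg[OF assms(2)]] by (simp add: a_minus_def)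

section \<open>Projective modules\<close>

text \<open>A dual basis of \<open>F\<close>: elements \<open>b j\<close> and linear forms \<open>\<kappa> j\<close> such that every \<open>x\<close> is the finite
  sum of the \<open>\<kappa> j x \<odot> b j\<close>. The existence of a dual basis is equivalent to projectivity.\<close>

definition dual_basis :: "('s, 'x) ring_scheme \<Rightarrow> ('s, 'f) module \<Rightarrow> 'j set \<Rightarrow> ('j \<Rightarrow> 'f) \<Rightarrow>
    ('j \<Rightarrow> 'f \<Rightarrow> 's) \<Rightarrow> bool" where
  "dual_basis S F J b \<kappa> \<longleftrightarrow> lmodule S F \<and>
     (\<forall>j\<in>J. b j \<in> carrier F \<and> lmod_hom S F (regular_module S) (\<kappa> j)) \<and>
     (\<forall>x\<in>carrier F. finite {j\<in>J. \<kappa> j x \<noteq> \<zero>\<^bsub>S\<^esub>} \<and>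
        x = (\<Oplus>\<^bsub>F\<^esub>j\<in>{j\<in>J. \<kappa> j x \<noteq> \<zero>\<^bsub>S\<^esub>}. \<kappa> j x \<odot>\<^bsub>F\<^esub> b j))"

lemma projective_lift:
  assumes F: "dual_basis S F J b \<kappa>" and p: "lmod_hom S P N p" and q: "lmod_hom S F N q"
    and im: "\<And>x. x \<in> carrier F \<Longrightarrow> q x \<in> p ` carrier P"
  shows "\<exists>r. lmod_hom S F P r \<and> (\<forall>x\<in>carrier F. p (r x) = q x)"
proof -
  interpret p: lmod_hom S P N p by fact
  interpret q: lmod_hom S F N q by fact
  have b: "b j \<in> carrier F" and \<kappa>: "lmod_hom S F (regular_module S) (\<kappa> j)" if "j \<in> J" for j
    using F that by (auto simp: dual_basis_def)
  have \<kappa>_closed: "\<kappa> j x \<in> carrier S" if "j \<in> J" "x \<in> carrier F" for j x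
    using lmod_hom.closed[OF \<kappa>[OF that(1)] that(2)] by (simp add: regular_module_def)
  have \<kappa>_add: "\<kappa> j (x \<oplus>\<^bsub>F\<^esub> y) = \<kappa> j x \<oplus>\<^bsub>S\<^esub> \<kappa> j y"
    if "j \<in> J" "x \<in> carrier F" "y \<in> carrier F" for j x y
    using lmod_hom.add[OF \<kappa>[OF that(1)] that(2,3)] by (simp add: regular_module_def)
  have \<kappa>_smult: "\<kappa> j (a \<odot>\<^bsub>F\<^esub> x) = a \<otimes>\<^bsub>S\<^esub> \<kappa> j x"
    if "j \<in> J" "a \<in> carrier S" "x \<in> carrier F" for j a x
    using lmod_hom.smult[OF \<kappa>[OF that(1)] that(2,3)] by (simp add: regular_module_def)
  define supp where "supp x = {j\<in>J. \<kappa> j x \<noteq> \<zero>\<^bsub>S\<^esub>}" for x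
  have fin: "finite (supp x)" and expand: "x = (\<Oplus>\<^bsub>F\<^esub>j\<in>supp x. \<kappa> j x \<odot>\<^bsub>F\<^esub> b j)" if "x \<in> carrier F" for x
    using F that unfolding dual_basis_def supp_def by blast+
  have sub: "supp x \<subseteq> J" for x by (auto simp: supp_def)
  have "\<exists>y. \<forall>j\<in>J. y j \<in> carrier P \<and> p (y j) = q (b j)"
    by (rule bchoice) (use im b in \<open>force simp: image_iff\<close>)
  then obtain y where y: "\<And>j. j \<in> J \<Longrightarrow> y j \<in> carrier P" "\<And>j. j \<in> J \<Longrightarrow> p (y j) = q (b j)"
    by blast
  define t where "t B x = (\<Oplus>\<^bsub>P\<^esub>j\<in>B. \<kappa> j x \<odot>\<^bsub>P\<^esub> y j)" for B x
  define r where "r x = t (supp x) x" for x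
  have tm: "\<kappa> j x \<odot>\<^bsub>P\<^esub> y j \<in> carrier P" if "x \<in> carrier F" "j \<in> J" for x j
    using that y \<kappa>_closed by simp
  have r_eq: "r x = t B x" if "x \<in> carrier F" "finite B" "supp x \<subseteq> B" "B \<subseteq> J" for x B
    unfolding r_def t_def
    by (rule p.M.M.add.finprod_mono_neutral_cong_left)
      (use that tm y in \<open>auto simp: supp_def p.M.smult_l_null subset_iff\<close>)
  have t_closed: "t B x \<in> carrier P" if "x \<in> carrier F" "B \<subseteq> J" for x B
    unfolding t_def using tm that by (intro p.M.M.finsum_closed) auto
  have "lmod_hom S F P r"
  proof unfold_locales
    show "r x \<in> carrier P" if "x \<in> carrier F" for x
      unfolding r_def by (rule t_closed[OF that sub])
    fix x y' assume xy: "x \<in> carrier F" "y' \<in> carrier F"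
    let ?B = "supp x \<union> supp y'"
    have B: "finite ?B" "?B \<subseteq> J" using xy fin sub by auto
    have "r (x \<oplus>\<^bsub>F\<^esub> y') = t ?B (x \<oplus>\<^bsub>F\<^esub> y')"
      by (rule r_eq) (use xy B in \<open>auto simp: supp_def \<kappa>_add\<close>)
    also have "\<dots> = (\<Oplus>\<^bsub>P\<^esub>j\<in>?B. \<kappa> j x \<odot>\<^bsub>P\<^esub> y j \<oplus>\<^bsub>P\<^esub> \<kappa> j y' \<odot>\<^bsub>P\<^esub> y j)"
      unfolding t_def
      by (rule p.M.M.finsum_cong')
        (use B xy y \<kappa>_closed in \<open>auto simp: \<kappa>_add subset_iff intro!: p.M.smult_l_distr\<close>)
    also have "\<dots> = t ?B x \<oplus>\<^bsub>P\<^esub> t ?B y'"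
      unfolding t_def by (rule p.M.M.finsum_addf) (use tm xy B in auto)
    also have "\<dots> = r x \<oplus>\<^bsub>P\<^esub> r y'"
      using r_eq[OF xy(1) B(1) _ B(2)] r_eq[OF xy(2) B(1) _ B(2)] by simp
    finally show "r (x \<oplus>\<^bsub>F\<^esub> y') = r x \<oplus>\<^bsub>P\<^esub> r y'" .
  next
    fix a x assume a: "a \<in> carrier S" and x: "x \<in> carrier F"
    have "r (a \<odot>\<^bsub>F\<^esub> x) = t (supp x) (a \<odot>\<^bsub>F\<^esub> x)"
      by (rule r_eq) (use a x fin sub in \<open>auto simp: supp_def \<kappa>_smult\<close>)
    also have "\<dots> = (\<Oplus>\<^bsub>P\<^esub>j\<in>supp x. a \<odot>\<^bsub>P\<^esub> (\<kappa> j x \<odot>\<^bsub>P\<^esub> y j))"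
      unfolding t_def
      by (rule p.M.M.finsum_cong')
        (use a x y \<kappa>_closed sub in \<open>auto simp: \<kappa>_smult subset_iff p.M.smult_assoc1\<close>)
    also have "\<dots> = a \<odot>\<^bsub>P\<^esub> t (supp x) x"
      unfolding t_def by (rule p.M.smult_finsum[symmetric]) (use fin[OF x] tm[OF x] a sub in \<open>auto simp: subset_iff\<close>)
    finally show "r (a \<odot>\<^bsub>F\<^esub> x) = a \<odot>\<^bsub>P\<^esub> r x" by (simp add: r_def)
  qed
  moreover have "p (r x) = q x" if x: "x \<in> carrier F" for x
  proof -
    have "p (r x) = (\<Oplus>\<^bsub>N\<^esub>j\<in>supp x. p (\<kappa> j x \<odot>\<^bsub>P\<^esub> y j))"
      unfolding r_def t_def by (rule p.finsum) (use fin x tm subsetD[OF sub] in auto)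
    also have "\<dots> = (\<Oplus>\<^bsub>N\<^esub>j\<in>supp x. q (\<kappa> j x \<odot>\<^bsub>F\<^esub> b j))"
      by (rule p.N.M.finsum_cong')
        (use x y b \<kappa>_closed sub q.closed in \<open>auto simp: p.smult q.smult subset_iff\<close>)
    also have "\<dots> = q (\<Oplus>\<^bsub>F\<^esub>j\<in>supp x. \<kappa> j x \<odot>\<^bsub>F\<^esub> b j)"
      by (rule q.finsum[symmetric]) (use fin x b \<kappa>_closed sub in \<open>auto simp: subset_iff\<close>)
    also have "\<dots> = q x" using expand[OF x] by simp
    finally show ?thesis .
  qed
  ultimately show ?thesis by blast
qed

section \<open>Direct sums and free modules\<close>

text \<open>The element of \<open>dirsum N I\<close> with entry \<open>c\<close> at \<open>i\<close> and zero elsewhere.\<close>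

definition single :: "('a, 'm, 'y) module_scheme \<Rightarrow> 'i set \<Rightarrow> 'i \<Rightarrow> 'm \<Rightarrow> 'i \<Rightarrow> 'm" where
  "single N I i c = (\<lambda>l\<in>I. if l = i then c else \<zero>\<^bsub>N\<^esub>)"

lemma lmod_hom_coord:
  assumes "lmodule S N" "l \<in> I"
  shows "lmod_hom S (dirsum N I) N (\<lambda>f. f l)"
proof -
  interpret lmodule S N by fact
  interpret D: lmodule S "dirsum N I" by (rule lmodule_dirsum) fact
  show ?thesis by unfold_locales (use assms(2) in \<open>auto simp: dirsum_def\<close>)
qed

lemma lmod_hom_single:
  assumes "lmodule S N" "i \<in> I"
  shows "lmod_hom S N (dirsum N I) (single N I i)"
proof -
  interpret lmodule S N by fact
  interpret D: lmodule S "dirsum N I" by (rule lmodule_dirsum) fact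
  have fin: "finite {l \<in> I. single N I i c l \<noteq> \<zero>\<^bsub>N\<^esub>}" for c
    by (rule finite_subset[of _ "{i}"]) (auto simp: single_def)
  show ?thesis
    by unfold_locales (use assms(2) fin in \<open>auto simp: dirsum_def single_def smult_r_null\<close>)
qed

lemma dirsum_expand:
  assumes N: "lmodule S N" and f: "f \<in> carrier (dirsum N I)"
    and B: "finite B" "{i \<in> I. f i \<noteq> \<zero>\<^bsub>N\<^esub>} \<subseteq> B" "B \<subseteq> I"
  shows "f = (\<Oplus>\<^bsub>dirsum N I\<^esub>i\<in>B. single N I i (f i))"
proof -
  interpret lmodule S N by fact
  interpret D: lmodule S "dirsum N I" by (rule lmodule_dirsum) fact
  let ?s = "\<Oplus>\<^bsub>dirsum N I\<^esub>i\<in>B. single N I i (f i)"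
  have fi: "f i \<in> carrier N" if "i \<in> I" for i using f that by (auto simp: dirsum_def)
  have sc: "single N I i (f i) \<in> carrier (dirsum N I)" if "i \<in> I" for i
    using lmod_hom.closed[OF lmod_hom_single[OF N that] fi[OF that]] .
  have s: "?s \<in> carrier (dirsum N I)"
    by (rule D.M.finsum_closed) (use sc B in auto)
  show ?thesis
  proof
    fix l
    show "f l = ?s l"
    proof (cases "l \<in> I")
      case True
      interpret c: lmod_hom S "dirsum N I" N "\<lambda>f. f l" by (rule lmod_hom_coord[OF N True])
      have "?s l = (\<Oplus>\<^bsub>N\<^esub>i\<in>B. single N I i (f i) l)"
        by (rule c.finsum) (use sc B in auto)
      also have "\<dots> = (\<Oplus>\<^bsub>N\<^esub>i\<in>B. if l = i then f i else \<zero>\<^bsub>N\<^esub>)"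
        by (rule M.finsum_cong') (use fi B True in \<open>auto simp: single_def\<close>)
      also have "\<dots> = f l"
      proof (cases "l \<in> B")
        case True
        then show ?thesis by (rule M.finsum_singleton) (use fi B in auto)
      next
        case False
        then have "(\<Oplus>\<^bsub>N\<^esub>i\<in>B. if l = i then f i else \<zero>\<^bsub>N\<^esub>) = (\<Oplus>\<^bsub>N\<^esub>i\<in>B. \<zero>\<^bsub>N\<^esub>)"
          by (intro M.finsum_cong') auto
        then show ?thesis using False True B by auto
      qed
      finally show ?thesis by simp
    next
      case False
      then show ?thesis using f s by (auto simp: dirsum_def PiE_def extensional_def)
    qed
  qed
qed

lemma dual_basis_free_module:
  assumes "ring S"
  shows "dual_basis S (free_module S I) I (\<lambda>i. single (regular_module S) I i \<one>\<^bsub>S\<^esub>) (\<lambda>i f. f i)"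
proof -
  interpret ring S by fact
  have reg: "lmodule S (regular_module S)" by (rule lmodule_regular) fact
  have z: "\<zero>\<^bsub>regular_module S\<^esub> = \<zero>\<^bsub>S\<^esub>" by (simp add: regular_module_def)
  have one: "\<one>\<^bsub>S\<^esub> \<in> carrier (regular_module S)" by (simp add: regular_module_def)
  have eq: "f i \<odot>\<^bsub>dirsum (regular_module S) I\<^esub> single (regular_module S) I i \<one>\<^bsub>S\<^esub>
      = single (regular_module S) I i (f i)"
    if "f \<in> carrier (dirsum (regular_module S) I)" "i \<in> I" for f i
  proof -
    have "f i \<in> carrier S" using that by (auto simp: dirsum_def regular_module_def)
    then show ?thesis
      by (auto simp: dirsum_def single_def regular_module_def fun_eq_iff)
  qed
  show ?thesis
    unfolding dual_basis_def free_module_def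
  proof (intro conjI ballI)
    show "lmodule S (dirsum (regular_module S) I)" by (rule lmodule_dirsum[OF reg])
    show "single (regular_module S) I j \<one>\<^bsub>S\<^esub> \<in> carrier (dirsum (regular_module S) I)" if "j \<in> I" for j
      using lmod_hom.closed[OF lmod_hom_single[OF reg that] one] .
    show "lmod_hom S (dirsum (regular_module S) I) (regular_module S) (\<lambda>f. f j)" if "j \<in> I" for j
      by (rule lmod_hom_coord[OF reg that])
    fix x assume x: "x \<in> carrier (dirsum (regular_module S) I)"
    let ?B = "{j \<in> I. x j \<noteq> \<zero>\<^bsub>S\<^esub>}"
    show fin: "finite ?B" using x by (simp add: dirsum_def z)
    have "x = (\<Oplus>\<^bsub>dirsum (regular_module S) I\<^esub>i\<in>?B. single (regular_module S) I i (x i))"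
      by (rule dirsum_expand[OF reg x fin]) (auto simp: z)
    also have "\<dots> = (\<Oplus>\<^bsub>dirsum (regular_module S) I\<^esub>j\<in>?B.
        x j \<odot>\<^bsub>dirsum (regular_module S) I\<^esub> single (regular_module S) I j \<one>\<^bsub>S\<^esub>)"
    proof -
      interpret D: lmodule S "dirsum (regular_module S) I" by (rule lmodule_dirsum[OF reg])
      show ?thesis
      proof (rule D.M.finsum_cong')
        show "(\<lambda>j. x j \<odot>\<^bsub>dirsum (regular_module S) I\<^esub> single (regular_module S) I j \<one>\<^bsub>S\<^esub>)
            \<in> ?B \<rightarrow> carrier (dirsum (regular_module S) I)"
          using lmod_hom.closed[OF lmod_hom_single[OF reg]] lmod_hom.closed[OF lmod_hom_coord[OF reg] x]
          by (fastforce simp: eq[OF x])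
      qed (auto simp: eq[OF x])
    qed
    finally show "x = \<dots>" .
  qed
qed

section \<open>Comparison of projective resolutions\<close>

text \<open>An initial segment \<open>P m \<rightarrow> \<cdots> \<rightarrow> P 0 \<rightarrow> N \<rightarrow> 0\<close> of a resolution, exact at \<open>N\<close> and at
  \<open>P 0, \<dots>, P (m - 1)\<close>. Projectivity of the terms is expressed separately by dual bases.\<close>

definition partial_resolution :: "('s, 'x) ring_scheme \<Rightarrow> ('s, 'n) module \<Rightarrow> nat \<Rightarrow>
    (nat \<Rightarrow> ('s, 'p) module) \<Rightarrow> (nat \<Rightarrow> 'p \<Rightarrow> 'p) \<Rightarrow> ('p \<Rightarrow> 'n) \<Rightarrow> bool" where
  "partial_resolution S N m P d e \<longleftrightarrow>
     lmod_hom S (P 0) N e \<and> e ` carrier (P 0) = carrier N \<and>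
     (\<forall>k<m. lmod_hom S (P (Suc k)) (P k) (d k)) \<and>
     (0 < m \<longrightarrow> d 0 ` carrier (P 1) = lker (P 0) N e) \<and>
     (\<forall>k. Suc k < m \<longrightarrow>
        d (Suc k) ` carrier (P (Suc (Suc k))) = lker (P (Suc k)) (P k) (d k))"

text \<open>Vanishing of the cohomology of \<open>Hom\<^sub>S(P 0,Y) \<rightarrow> Hom\<^sub>S(P 1,Y) \<rightarrow> \<cdots>\<close> in degree \<open>j + 1\<close>.\<close>

definition cohomology_vanishes :: "('s, 'x) ring_scheme \<Rightarrow> (nat \<Rightarrow> ('s, 'p) module) \<Rightarrow>
    (nat \<Rightarrow> 'p \<Rightarrow> 'p) \<Rightarrow> ('s, 'm) module \<Rightarrow> nat \<Rightarrow> bool" where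
  "cohomology_vanishes S P d Y j \<longleftrightarrow>
     (\<forall>\<phi>. lmod_hom S (P (Suc j)) Y \<phi> \<longrightarrow>
        (\<forall>x\<in>carrier (P (Suc (Suc j))). \<phi> (d (Suc j) x) = \<zero>\<^bsub>Y\<^esub>) \<longrightarrow>
        (\<exists>\<psi>. lmod_hom S (P j) Y \<psi> \<and> (\<forall>x\<in>carrier (P (Suc j)). \<phi> x = \<psi> (d j x))))"

lemma partial_resolution_complex:
  assumes "partial_resolution S N m P d e"
  shows "\<lbrakk>0 < m; x \<in> carrier (P 1)\<rbrakk> \<Longrightarrow> e (d 0 x) = \<zero>\<^bsub>N\<^esub>"
    and "\<lbrakk>Suc k < m; y \<in> carrier (P (Suc (Suc k)))\<rbrakk> \<Longrightarrow> d k (d (Suc k) y) = \<zero>\<^bsub>P k\<^esub>"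
proof -
  assume "0 < m" "x \<in> carrier (P 1)"
  then have "d 0 x \<in> lker (P 0) N e" using assms unfolding partial_resolution_def by blast
  then show "e (d 0 x) = \<zero>\<^bsub>N\<^esub>" by (simp add: lker_def)
next
  assume "Suc k < m" "y \<in> carrier (P (Suc (Suc k)))"
  then have "d (Suc k) y \<in> lker (P (Suc k)) (P k) (d k)"
    using assms unfolding partial_resolution_def by blast
  then show "d k (d (Suc k) y) = \<zero>\<^bsub>P k\<^esub>" by (simp add: lker_def)
qed

lemma partial_resolution_exact:
  assumes "partial_resolution S N m P d e"
  shows "\<lbrakk>0 < m; x \<in> carrier (P 0); e x = \<zero>\<^bsub>N\<^esub>\<rbrakk> \<Longrightarrow> x \<in> d 0 ` carrier (P 1)"
    and "\<lbrakk>Suc k < m; y \<in> carrier (P (Suc k)); d k y = \<zero>\<^bsub>P k\<^esub>\<rbrakk> \<Longrightarrow>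
      y \<in> d (Suc k) ` carrier (P (Suc (Suc k)))"
  using assms by (auto simp: partial_resolution_def lker_def)

lemma chain_map_exists:
  assumes P: "partial_resolution S N m P dP eP" and Q: "partial_resolution S N m Q dQ eQ"
    and proj: "\<And>k. k \<le> m \<Longrightarrow> dual_basis S (P k) (J k) (b k) (\<kappa> k)"
  shows "\<exists>f. (\<forall>k\<le>m. lmod_hom S (P k) (Q k) (f k)) \<and> (\<forall>x\<in>carrier (P 0). eQ (f 0 x) = eP x) \<and>
    (\<forall>k<m. \<forall>x\<in>carrier (P (Suc k)). dQ k (f (Suc k) x) = f k (dP k x))"
proof -
  have dP: "lmod_hom S (P (Suc k)) (P k) (dP k)" and dQ: "lmod_hom S (Q (Suc k)) (Q k) (dQ k)"
    if "k < m" for k using P Q that by (auto simp: partial_resolution_def)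
  have "\<exists>f. (\<forall>k\<le>n. lmod_hom S (P k) (Q k) (f k)) \<and> (\<forall>x\<in>carrier (P 0). eQ (f 0 x) = eP x) \<and>
    (\<forall>k<n. \<forall>x\<in>carrier (P (Suc k)). dQ k (f (Suc k) x) = f k (dP k x))" if "n \<le> m" for n
    using that
  proof (induction n)
    case 0
    have eP: "lmod_hom S (P 0) N eP" and eQ: "lmod_hom S (Q 0) N eQ"
      using P Q by (auto simp: partial_resolution_def)
    have "eP x \<in> eQ ` carrier (Q 0)" if "x \<in> carrier (P 0)" for x
      using lmod_hom.closed[OF eP that] Q by (simp add: partial_resolution_def)
    from projective_lift[OF proj[OF le0] eQ eP this] obtain r
      where "lmod_hom S (P 0) (Q 0) r" "\<forall>x\<in>carrier (P 0). eQ (r x) = eP x" by blast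
    then show ?case by (intro exI[of _ "\<lambda>_. r"]) simp
  next
    case (Suc n)
    then have n: "n < m" by simp
    from Suc obtain f where f: "\<And>k. k \<le> n \<Longrightarrow> lmod_hom S (P k) (Q k) (f k)"
      "\<And>x. x \<in> carrier (P 0) \<Longrightarrow> eQ (f 0 x) = eP x"
      "\<And>k x. \<lbrakk>k < n; x \<in> carrier (P (Suc k))\<rbrakk> \<Longrightarrow> dQ k (f (Suc k) x) = f k (dP k x)" using Suc_leD by blast
    have fn: "lmod_hom S (P n) (Q n) (f n)" by (simp add: f)
    have q: "lmod_hom S (P (Suc n)) (Q n) (\<lambda>x. f n (dP n x))"
      by (rule lmod_hom_comp[OF dP[OF n] fn])
    have "f n (dP n x) \<in> dQ n ` carrier (Q (Suc n))" if x: "x \<in> carrier (P (Suc n))" for x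
    proof (cases n)
      case 0
      have "eQ (f 0 (dP 0 x)) = \<zero>\<^bsub>N\<^esub>"
        using partial_resolution_complex(1)[OF P, of x] lmod_hom.closed[OF dP[OF n] x] n x 0
        by (simp add: f(2))
      then show ?thesis
        using partial_resolution_exact(1)[OF Q] lmod_hom.closed[OF q x] n 0 by simp
    next
      case (Suc k)
      have "dQ k (f (Suc k) (dP (Suc k) x)) = f k (dP k (dP (Suc k) x))"
        by (rule f(3)) (use Suc lmod_hom.closed[OF dP[OF n] x] in auto)
      also have "\<dots> = \<zero>\<^bsub>Q k\<^esub>"
        using partial_resolution_complex(2)[OF P, of k x] n x Suc lmod_hom.zero[OF f(1)[of k]] by simp
      finally show ?thesis
        using partial_resolution_exact(2)[OF Q, of k] lmod_hom.closed[OF q x] n Suc by simp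
    qed
    from projective_lift[OF proj[of "Suc n"] dQ[OF n] q this] n obtain r
      where r: "lmod_hom S (P (Suc n)) (Q (Suc n)) r"
        "\<And>x. x \<in> carrier (P (Suc n)) \<Longrightarrow> dQ n (r x) = f n (dP n x)" by auto
    show ?case
      by (intro exI[of _ "f(Suc n := r)"]) (use f r in \<open>auto simp: le_Suc_eq less_Suc_eq\<close>)
  qed
  then show ?thesis by blast
qed

text \<open>A chain endomorphism \<open>w\<close> of a projective resolution over the identity of \<open>N\<close> is homotopic to
  the identity. In degrees up to \<open>m\<close> the homotopy takes values in degrees up to \<open>m + 1\<close>, so the
  resolution has to be longer by one.\<close>

lemma chain_homotopy_exists:
  assumes P: "partial_resolution S N (Suc m) P d e"
    and proj: "\<And>k. k \<le> m \<Longrightarrow> dual_basis S (P k) (J k) (b k) (\<kappa> k)"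
    and w: "\<And>k. k \<le> m \<Longrightarrow> lmod_hom S (P k) (P k) (w k)"
    and w0: "\<And>x. x \<in> carrier (P 0) \<Longrightarrow> e (w 0 x) = e x"
    and wd: "\<And>k x. \<lbrakk>k < m; x \<in> carrier (P (Suc k))\<rbrakk> \<Longrightarrow> d k (w (Suc k) x) = w k (d k x)"
  shows "\<exists>h. (\<forall>k\<le>m. lmod_hom S (P k) (P (Suc k)) (h k)) \<and>
    (\<forall>x\<in>carrier (P 0). d 0 (h 0 x) = x \<ominus>\<^bsub>P 0\<^esub> w 0 x) \<and>
    (\<forall>k<m. \<forall>x\<in>carrier (P (Suc k)).
       d (Suc k) (h (Suc k) x) = (x \<ominus>\<^bsub>P (Suc k)\<^esub> w (Suc k) x) \<ominus>\<^bsub>P (Suc k)\<^esub> h k (d k x))"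
proof -
  have d: "lmod_hom S (P (Suc k)) (P k) (d k)" if "k \<le> m" for k
    using P that by (auto simp: partial_resolution_def)
  have Pm: "lmodule S (P k)" if "k \<le> m" for k using w[OF that] by (rule lmod_hom.axioms)
  have e: "lmod_hom S (P 0) N e" using P by (simp add: partial_resolution_def)
  have idw: "lmod_hom S (P k) (P k) (\<lambda>x. x \<ominus>\<^bsub>P k\<^esub> w k x)" if "k \<le> m" for k
    using lmod_hom_diff[OF lmod_hom_id[OF Pm[OF that]] w[OF that]] .
  have "\<exists>h. (\<forall>k\<le>n. lmod_hom S (P k) (P (Suc k)) (h k)) \<and>
    (\<forall>x\<in>carrier (P 0). d 0 (h 0 x) = x \<ominus>\<^bsub>P 0\<^esub> w 0 x) \<and>
    (\<forall>k<n. \<forall>x\<in>carrier (P (Suc k)).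
       d (Suc k) (h (Suc k) x) = (x \<ominus>\<^bsub>P (Suc k)\<^esub> w (Suc k) x) \<ominus>\<^bsub>P (Suc k)\<^esub> h k (d k x))"
    if "n \<le> m" for n
    using that
  proof (induction n)
    case 0
    interpret e: lmod_hom S "P 0" N e by fact
    have im: "x \<ominus>\<^bsub>P 0\<^esub> w 0 x \<in> d 0 ` carrier (P (Suc 0))" if x: "x \<in> carrier (P 0)" for x
    proof -
      have "e (x \<ominus>\<^bsub>P 0\<^esub> w 0 x) = \<zero>\<^bsub>N\<^esub>"
        using x lmod_hom.closed[OF w[OF le0] x] e.closed
        by (simp add: e.diff w0) (simp add: a_minus_def e.N.M.r_neg)
      then show ?thesis
        using partial_resolution_exact(1)[OF P] lmod_hom.closed[OF idw[OF le0] x] by simp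
    qed
    from projective_lift[OF proj[OF le0] d[OF le0] idw[OF le0] im] obtain r
      where "lmod_hom S (P 0) (P (Suc 0)) r" "\<forall>x\<in>carrier (P 0). d 0 (r x) = x \<ominus>\<^bsub>P 0\<^esub> w 0 x"
      by blast
    then show ?case by (intro exI[of _ "\<lambda>_. r"]) simp
  next
    case (Suc n)
    then have n: "n < m" "n \<le> m" "Suc n \<le> m" by simp_all
    from Suc obtain h where h: "\<And>k. k \<le> n \<Longrightarrow> lmod_hom S (P k) (P (Suc k)) (h k)"
      "\<And>x. x \<in> carrier (P 0) \<Longrightarrow> d 0 (h 0 x) = x \<ominus>\<^bsub>P 0\<^esub> w 0 x"
      "\<And>k x. \<lbrakk>k < n; x \<in> carrier (P (Suc k))\<rbrakk> \<Longrightarrow>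
        d (Suc k) (h (Suc k) x) = (x \<ominus>\<^bsub>P (Suc k)\<^esub> w (Suc k) x) \<ominus>\<^bsub>P (Suc k)\<^esub> h k (d k x)" using Suc_leD by blast
    interpret dn: lmod_hom S "P (Suc n)" "P n" "d n" by (rule d) (rule n)
    interpret wn: lmod_hom S "P n" "P n" "w n" by (rule w) (rule n)
    interpret ws: lmod_hom S "P (Suc n)" "P (Suc n)" "w (Suc n)" by (rule w) (rule n)
    interpret hn: lmod_hom S "P n" "P (Suc n)" "h n" by (rule h) simp
    let ?q = "\<lambda>x. (x \<ominus>\<^bsub>P (Suc n)\<^esub> w (Suc n) x) \<ominus>\<^bsub>P (Suc n)\<^esub> h n (d n x)"
    have q: "lmod_hom S (P (Suc n)) (P (Suc n)) ?q"
      by (rule lmod_hom_diff[OF idw[OF n(3)] lmod_hom_comp[OF d[OF n(2)] h(1)[OF order_refl]]])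
    have im: "?q x \<in> d (Suc n) ` carrier (P (Suc (Suc n)))" if x: "x \<in> carrier (P (Suc n))" for x
    proof -
      have dx: "d n x \<in> carrier (P n)" by (rule dn.closed[OF x])
      \<comment> \<open>The correction term of the homotopy identity in degree \<open>n\<close> vanishes on boundaries.\<close>
      have "d n (h n (d n x)) = d n x \<ominus>\<^bsub>P n\<^esub> w n (d n x)"
      proof (cases n)
        case 0
        then show ?thesis using h(2) dx by simp
      next
        case (Suc k)
        have c: "d k (d (Suc k) x) = \<zero>\<^bsub>P k\<^esub>"
          by (rule partial_resolution_complex(2)[OF P]) (use x n Suc in auto)
        have "h k \<zero>\<^bsub>P k\<^esub> = \<zero>\<^bsub>P (Suc k)\<^esub>" by (rule lmod_hom.zero[OF h(1)]) (simp add: Suc)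
        then show ?thesis using h(3)[of k "d n x"] dx c lmod_hom.closed[OF idw[OF n(2)] dx]
            dn.N.M.diff_zero[of "d n x \<ominus>\<^bsub>P n\<^esub> w n (d n x)"]
          unfolding Suc by simp
      qed
      then have "d n (?q x) = (d n x \<ominus>\<^bsub>P n\<^esub> w n (d n x)) \<ominus>\<^bsub>P n\<^esub> (d n x \<ominus>\<^bsub>P n\<^esub> w n (d n x))"
        using x dx by (simp add: dn.diff ws.closed hn.closed wd[OF n(1)])
      also have "\<dots> = \<zero>\<^bsub>P n\<^esub>" using dx wn.closed[OF dx] by (simp add: a_minus_def dn.N.M.r_neg)
      finally have "d n (?q x) = \<zero>\<^bsub>P n\<^esub>" .
      then show ?thesis
        using partial_resolution_exact(2)[OF P, of n "?q x"] lmod_hom.closed[OF q x] n by simp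
    qed
    from projective_lift[OF proj[OF n(3)] d[OF n(3)] q im] obtain r
      where r: "lmod_hom S (P (Suc n)) (P (Suc (Suc n))) r"
        "\<And>x. x \<in> carrier (P (Suc n)) \<Longrightarrow> d (Suc n) (r x) = ?q x" by blast
    show ?case
      by (intro exI[of _ "h(Suc n := r)"]) (use h r in \<open>auto simp: le_Suc_eq less_Suc_eq\<close>)
  qed
  then show ?thesis by blast
qed

text \<open>If \<open>f\<close> and \<open>g\<close> are comparison maps and \<open>h\<close> is a homotopy from \<open>g f\<close> to the identity, then a
  cocycle \<open>\<phi>\<close> satisfies \<open>\<phi> = \<phi> g f + \<phi> h d\<close>; here \<open>\<phi> g\<close> is a coboundary \<open>\<psi> d\<close> by assumption,
  and so \<open>\<phi> = (\<psi> f + \<phi> h) d\<close>.\<close>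

lemma cohomology_vanishes_transfer:
  assumes P: "partial_resolution S N (Suc (Suc j)) P dP eP"
    and Q: "partial_resolution S N (Suc (Suc j)) Q dQ eQ"
    and projP: "\<And>k. k \<le> Suc (Suc j) \<Longrightarrow> dual_basis S (P k) (J k) (b k) (\<kappa> k)"
    and projQ: "\<And>k. k \<le> Suc (Suc j) \<Longrightarrow> dual_basis S (Q k) (J' k) (b' k) (\<kappa>' k)"
    and van: "cohomology_vanishes S Q dQ Y j"
  shows "cohomology_vanishes S P dP Y j"
proof -
  obtain f where f: "\<And>k. k \<le> Suc (Suc j) \<Longrightarrow> lmod_hom S (P k) (Q k) (f k)"
    "\<And>x. x \<in> carrier (P 0) \<Longrightarrow> eQ (f 0 x) = eP x"
    "\<And>k x. \<lbrakk>k < Suc (Suc j); x \<in> carrier (P (Suc k))\<rbrakk> \<Longrightarrow> dQ k (f (Suc k) x) = f k (dP k x)"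
    using chain_map_exists[OF P Q projP] by blast
  obtain g where g: "\<And>k. k \<le> Suc (Suc j) \<Longrightarrow> lmod_hom S (Q k) (P k) (g k)"
    "\<And>x. x \<in> carrier (Q 0) \<Longrightarrow> eP (g 0 x) = eQ x"
    "\<And>k x. \<lbrakk>k < Suc (Suc j); x \<in> carrier (Q (Suc k))\<rbrakk> \<Longrightarrow> dP k (g (Suc k) x) = g k (dQ k x)"
    using chain_map_exists[OF Q P projQ] by blast
  have dP: "lmod_hom S (P (Suc k)) (P k) (dP k)" if "k < Suc (Suc j)" for k
    using P that by (auto simp: partial_resolution_def)
  have dQ: "lmod_hom S (Q (Suc k)) (Q k) (dQ k)" if "k < Suc (Suc j)" for k
    using Q that by (auto simp: partial_resolution_def)
  have fc: "f k x \<in> carrier (Q k)" if "k \<le> Suc (Suc j)" "x \<in> carrier (P k)" for k x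
    using lmod_hom.closed[OF f(1)[OF that(1)] that(2)] .
  have gc: "g k x \<in> carrier (P k)" if "k \<le> Suc (Suc j)" "x \<in> carrier (Q k)" for k x
    using lmod_hom.closed[OF g(1)[OF that(1)] that(2)] .
  have "\<exists>h. (\<forall>k\<le>Suc j. lmod_hom S (P k) (P (Suc k)) (h k)) \<and>
    (\<forall>x\<in>carrier (P 0). dP 0 (h 0 x) = x \<ominus>\<^bsub>P 0\<^esub> g 0 (f 0 x)) \<and>
    (\<forall>k<Suc j. \<forall>x\<in>carrier (P (Suc k)). dP (Suc k) (h (Suc k) x) =
       (x \<ominus>\<^bsub>P (Suc k)\<^esub> g (Suc k) (f (Suc k) x)) \<ominus>\<^bsub>P (Suc k)\<^esub> h k (dP k x))"
  proof (rule chain_homotopy_exists[OF P projP, where w = "\<lambda>k x. g k (f k x)"])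
    show "lmod_hom S (P k) (P k) (\<lambda>x. g k (f k x))" if "k \<le> Suc j" for k
      by (rule lmod_hom_comp[OF f(1) g(1)]) (use that in auto)
    show "eP (g 0 (f 0 x)) = eP x" if "x \<in> carrier (P 0)" for x
      using fc[OF _ that] that by (simp add: f(2) g(2))
    show "dP k (g (Suc k) (f (Suc k) x)) = g k (f k (dP k x))"
      if "k < Suc j" "x \<in> carrier (P (Suc k))" for k x
      using fc[OF _ that(2)] that by (simp add: f(3) g(3))
  qed simp
  then obtain h where h: "\<And>k. k \<le> Suc j \<Longrightarrow> lmod_hom S (P k) (P (Suc k)) (h k)"
    "\<And>x. x \<in> carrier (P (Suc j)) \<Longrightarrow> dP (Suc j) (h (Suc j) x) =
       (x \<ominus>\<^bsub>P (Suc j)\<^esub> g (Suc j) (f (Suc j) x)) \<ominus>\<^bsub>P (Suc j)\<^esub> h j (dP j x)"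
    by blast
  show ?thesis
    unfolding cohomology_vanishes_def
  proof (intro allI impI)
    fix \<phi> assume \<phi>: "lmod_hom S (P (Suc j)) Y \<phi>"
      and cocycle: "\<forall>x\<in>carrier (P (Suc (Suc j))). \<phi> (dP (Suc j) x) = \<zero>\<^bsub>Y\<^esub>"
    interpret \<phi>: lmod_hom S "P (Suc j)" Y \<phi> by fact
    have "\<forall>x\<in>carrier (Q (Suc (Suc j))). \<phi> (g (Suc j) (dQ (Suc j) x)) = \<zero>\<^bsub>Y\<^esub>"
      using gc cocycle by (simp add: g(3)[of "Suc j", symmetric])
    then obtain \<psi> where \<psi>: "lmod_hom S (Q j) Y \<psi>"
      "\<And>x. x \<in> carrier (Q (Suc j)) \<Longrightarrow> \<phi> (g (Suc j) x) = \<psi> (dQ j x)"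
      using van lmod_hom_comp[OF g(1)[of "Suc j"] \<phi>] unfolding cohomology_vanishes_def by auto
    have hom: "lmod_hom S (P j) Y (\<lambda>x. \<psi> (f j x) \<oplus>\<^bsub>Y\<^esub> \<phi> (h j x))"
      by (intro lmod_hom_add lmod_hom_comp[OF f(1) \<psi>(1)] lmod_hom_comp[OF h(1) \<phi>]) auto
    moreover have "\<phi> x = \<psi> (f j (dP j x)) \<oplus>\<^bsub>Y\<^esub> \<phi> (h j (dP j x))" if x: "x \<in> carrier (P (Suc j))" for x
    proof -
      have fx: "f (Suc j) x \<in> carrier (Q (Suc j))" by (rule fc) (use x in auto)
      have gf: "g (Suc j) (f (Suc j) x) \<in> carrier (P (Suc j))" by (rule gc) (use fx in auto)
      have dx: "dP j x \<in> carrier (P j)" using lmod_hom.closed[OF dP x] by simp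
      have hd: "h j (dP j x) \<in> carrier (P (Suc j))" using lmod_hom.closed[OF h(1) dx] by simp
      have hx: "h (Suc j) x \<in> carrier (P (Suc (Suc j)))" using lmod_hom.closed[OF h(1) x] by simp
      have "\<phi> (dP (Suc j) (h (Suc j) x)) = \<zero>\<^bsub>Y\<^esub>" using cocycle hx by blast
      then have z: "(\<phi> x \<ominus>\<^bsub>Y\<^esub> \<phi> (g (Suc j) (f (Suc j) x))) \<ominus>\<^bsub>Y\<^esub> \<phi> (h j (dP j x)) = \<zero>\<^bsub>Y\<^esub>"
        using x gf hd by (simp add: h(2) \<phi>.diff)
      have "\<phi> (g (Suc j) (f (Suc j) x)) = \<psi> (f j (dP j x))"
        using \<psi>(2)[OF fx] f(3)[OF _ x] by simp
      with z have "(\<phi> x \<ominus>\<^bsub>Y\<^esub> \<psi> (f j (dP j x))) \<ominus>\<^bsub>Y\<^esub> \<phi> (h j (dP j x)) = \<zero>\<^bsub>Y\<^esub>" by simp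
      moreover have "\<phi> x \<in> carrier Y" "\<phi> (h j (dP j x)) \<in> carrier Y" "\<psi> (f j (dP j x)) \<in> carrier Y"
        using x hd lmod_hom.closed[OF \<psi>(1) fc[OF _ dx]] by (auto intro: \<phi>.closed)
      ultimately show ?thesis
        by (intro \<phi>.N.M.eq_add_of_diff)
    qed
    ultimately show "\<exists>\<psi>. lmod_hom S (P j) Y \<psi> \<and> (\<forall>x\<in>carrier (P (Suc j)). \<phi> x = \<psi> (dP j x))"
      by blast
  qed
qed

section \<open>Vanishing of Ext\<close>

lemma comm_group_hom_group:
  assumes "lmodule A M" "lmodule A N"
  shows "comm_group (hom_group A M N)"
proof -
  interpret M: lmodule A M by fact
  interpret N: lmodule A N by fact
  have hom: "lmod_hom A M N f" if "f \<in> lhom A M N" for f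
    by (rule lmod_hom_of_lhom) fact+
  have c: "f x \<in> carrier N" if "f \<in> lhom A M N" "x \<in> carrier M" for f x
    using lmod_hom.closed[OF hom] that .
  have ext: "f \<in> extensional (carrier M)" if "f \<in> lhom A M N" for f
    using that by (auto simp: lhom_def PiE_def)
  show ?thesis
  proof (rule comm_groupI, simp_all add: hom_group_def)
    show "(\<lambda>x\<in>carrier M. f x \<oplus>\<^bsub>N\<^esub> g x) \<in> lhom A M N" if "f \<in> lhom A M N" "g \<in> lhom A M N" for f g
      using lmod_hom.restrict_in_lhom[OF lmod_hom_add[OF hom[OF that(1)] hom[OF that(2)]]] by simp
    show "(\<lambda>x\<in>carrier M. \<zero>\<^bsub>N\<^esub>) \<in> lhom A M N" by (auto simp: lhom_def N.smult_r_null)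
    show "(\<lambda>x\<in>carrier M. (if x \<in> carrier M then f x \<oplus>\<^bsub>N\<^esub> g x else undefined) \<oplus>\<^bsub>N\<^esub> h x) =
        (\<lambda>x\<in>carrier M. f x \<oplus>\<^bsub>N\<^esub> (if x \<in> carrier M then g x \<oplus>\<^bsub>N\<^esub> h x else undefined))"
      if "f \<in> lhom A M N" "g \<in> lhom A M N" "h \<in> lhom A M N" for f g h
      using that c by (intro restrict_ext) (simp add: N.M.a_assoc)
    show "(\<lambda>x\<in>carrier M. f x \<oplus>\<^bsub>N\<^esub> g x) = (\<lambda>x\<in>carrier M. g x \<oplus>\<^bsub>N\<^esub> f x)"
      if "f \<in> lhom A M N" "g \<in> lhom A M N" for f g
      using that c by (intro restrict_ext) (simp add: N.M.a_comm)
    show "(\<lambda>x\<in>carrier M. (if x \<in> carrier M then \<zero>\<^bsub>N\<^esub> else undefined) \<oplus>\<^bsub>N\<^esub> f x) = f"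
      if "f \<in> lhom A M N" for f
      by (rule extensionalityI[where A = "carrier M"]) (use that ext c in auto)
    show "\<exists>g\<in>lhom A M N. (\<lambda>x\<in>carrier M. g x \<oplus>\<^bsub>N\<^esub> f x) = (\<lambda>x\<in>carrier M. \<zero>\<^bsub>N\<^esub>)"
      if "f \<in> lhom A M N" for f
      by (rule bexI[OF _ lmod_hom.restrict_in_lhom[OF lmod_hom_neg[OF hom[OF that]]]])
        (use c[OF that] in \<open>auto simp: N.M.l_neg intro!: restrict_ext\<close>)
  qed
qed

lemma (in comm_group) trivial_group_Mod_iff:
  assumes "subgroup H G"
  shows "trivial_group (G Mod H) \<longleftrightarrow> carrier G \<subseteq> H"
proof -
  have n: "H \<lhd> G" using assms by (rule subgroup_imp_normal)
  have *: "H #> g = H \<longleftrightarrow> g \<in> H" if "g \<in> carrier G" for g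
    using assms that by (meson coset_join1 coset_join2 subgroup.subset)
  have "trivial_group (G Mod H) \<longleftrightarrow> rcosets H = {H}"
    using normal.factorgroup_is_group[OF n] by (simp add: trivial_group_def FactGroup_def)
  also have "\<dots> \<longleftrightarrow> (\<forall>g\<in>carrier G. H #> g = H)" by (auto simp: RCOSETS_def)
  also have "\<dots> \<longleftrightarrow> carrier G \<subseteq> H" using * by auto
  finally show ?thesis .
qed

lemma group_hom_pullback:
  assumes g: "lmod_hom S W X g" and Y: "lmodule S Y"
  shows "group_hom (hom_group S X Y) (hom_group S W Y) (pullback W g)"
proof -
  interpret g: lmod_hom S W X g by fact
  have mem: "pullback W g \<phi> \<in> lhom S W Y" if "\<phi> \<in> lhom S X Y" for \<phi>
    using lmod_hom.restrict_in_lhom[OF lmod_hom_comp[OF g lmod_hom_of_lhom[OF that g.N.lmodule_axioms Y]]]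
    by (simp add: pullback_def compose_def)
  show ?thesis
    using comm_group_hom_group[OF g.M.lmodule_axioms Y] comm_group_hom_group[OF g.N.lmodule_axioms Y]
    by (auto simp: group_hom_def group_hom_axioms_def comm_group_def hom_def hom_group_def mem[unfolded pullback_def compose_def]
        pullback_def[abs_def] compose_def g.closed)
qed

lemma trivial_hom_cohomology_iff:
  assumes F: "\<And>k. lmodule S (F k)" and Y: "lmodule S Y"
    and d: "\<And>k. lmod_hom S (F (Suc k)) (F k) (d k)"
    and dd: "\<And>x. x \<in> carrier (F (Suc (Suc j))) \<Longrightarrow> d j (d (Suc j) x) = \<zero>\<^bsub>F j\<^esub>"
  shows "trivial_group (hom_cohomology S F d Y (Suc j)) \<longleftrightarrow> cohomology_vanishes S F d Y j"
proof -
  interpret Y: lmodule S Y by fact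
  let ?G = "hom_group S (F (Suc j)) Y"
  let ?Z = "hom_cocycles S F d Y (Suc j)"
  let ?B = "hom_coboundaries S F d Y (Suc j)"
  have hom: "lmod_hom S (F k) Y f" if "f \<in> lhom S (F k) Y" for f k
    by (rule lmod_hom_of_lhom[OF that F Y])
  interpret D: group_hom "hom_group S (F j) Y" ?G "pullback (F (Suc j)) (d j)"
    by (rule group_hom_pullback[OF d Y])
  interpret E: group_hom ?G "hom_group S (F (Suc (Suc j))) Y" "pullback (F (Suc (Suc j))) (d (Suc j))"
    by (rule group_hom_pullback[OF d Y])
  interpret G: comm_group ?G by (rule comm_group_hom_group[OF F Y])
  have B: "?B = pullback (F (Suc j)) (d j) ` lhom S (F j) Y"
    by (simp add: hom_coboundaries_def)
  have Z: "\<phi> \<in> ?Z \<longleftrightarrow> \<phi> \<in> lhom S (F (Suc j)) Y \<and>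
      (\<forall>x\<in>carrier (F (Suc (Suc j))). \<phi> (d (Suc j) x) = \<zero>\<^bsub>Y\<^esub>)" for \<phi>
    by (auto simp: hom_cocycles_def pullback_def compose_def hom_group_def
        intro!: restrict_ext dest: fun_cong)
      (metis restrict_apply')
  have "subgroup ?Z ?G" using E.subgroup_kernel by (simp add: kernel_def hom_cocycles_def hom_group_def)
  moreover have "subgroup ?B ?G" using D.img_is_subgroup by (simp add: B hom_group_def)
  moreover have BZ: "?B \<subseteq> ?Z"
  proof
    fix \<phi> assume "\<phi> \<in> ?B"
    then obtain \<psi> where \<psi>: "\<psi> \<in> lhom S (F j) Y" "\<phi> = pullback (F (Suc j)) (d j) \<psi>" using B by auto
    have "\<phi> (d (Suc j) x) = \<zero>\<^bsub>Y\<^esub>" if x: "x \<in> carrier (F (Suc (Suc j)))" for x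
      using lmod_hom.closed[OF d x] lmod_hom.zero[OF hom[OF \<psi>(1)]] dd[OF x]
      by (simp add: \<psi>(2) pullback_def compose_def)
    then show "\<phi> \<in> ?Z" using D.hom_closed[of \<psi>] \<psi> by (simp add: Z hom_group_def)
  qed
  ultimately have sub: "subgroup ?B (?G\<lparr>carrier := ?Z\<rparr>)" by (intro D.H.subgroup_incl)
  interpret Z: comm_group "?G\<lparr>carrier := ?Z\<rparr>"
  proof (rule group.group_comm_groupI)
    show "group (?G\<lparr>carrier := ?Z\<rparr>)"
      by (rule subgroup.subgroup_is_group) (fact, unfold_locales)
    show "x \<otimes>\<^bsub>?G\<lparr>carrier := ?Z\<rparr>\<^esub> y = y \<otimes>\<^bsub>?G\<lparr>carrier := ?Z\<rparr>\<^esub> x"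
      if "x \<in> carrier (?G\<lparr>carrier := ?Z\<rparr>)" "y \<in> carrier (?G\<lparr>carrier := ?Z\<rparr>)" for x y
      using that G.m_comm[of x y] by (simp add: Z) (simp add: hom_group_def)
  qed
  have "trivial_group (hom_cohomology S F d Y (Suc j)) \<longleftrightarrow> ?Z \<subseteq> ?B"
    unfolding hom_cohomology_def using Z.trivial_group_Mod_iff[OF sub] by simp
  also have "\<dots> \<longleftrightarrow> cohomology_vanishes S F d Y j"
  proof
    assume ZB: "?Z \<subseteq> ?B"
    show "cohomology_vanishes S F d Y j"
      unfolding cohomology_vanishes_def
    proof (intro allI impI)
      fix \<phi> assume \<phi>: "lmod_hom S (F (Suc j)) Y \<phi>"
        and cocycle: "\<forall>x\<in>carrier (F (Suc (Suc j))). \<phi> (d (Suc j) x) = \<zero>\<^bsub>Y\<^esub>"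
      have "restrict \<phi> (carrier (F (Suc j))) \<in> ?Z"
        using lmod_hom.restrict_in_lhom[OF \<phi>] cocycle lmod_hom.closed[OF d] by (simp add: Z)
      then obtain \<psi> where \<psi>: "\<psi> \<in> lhom S (F j) Y"
        "restrict \<phi> (carrier (F (Suc j))) = pullback (F (Suc j)) (d j) \<psi>"
        using ZB B by auto
      have "\<phi> x = \<psi> (d j x)" if "x \<in> carrier (F (Suc j))" for x
        using fun_cong[OF \<psi>(2), of x] that by (simp add: pullback_def compose_def)
      then show "\<exists>\<psi>. lmod_hom S (F j) Y \<psi> \<and> (\<forall>x\<in>carrier (F (Suc j)). \<phi> x = \<psi> (d j x))"
        using hom[OF \<psi>(1)] by blast
    qed
  next
    assume van: "cohomology_vanishes S F d Y j"
    show "?Z \<subseteq> ?B"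
    proof
      fix \<phi> assume \<phi>: "\<phi> \<in> ?Z"
      then obtain \<psi> where \<psi>: "lmod_hom S (F j) Y \<psi>" "\<And>x. x \<in> carrier (F (Suc j)) \<Longrightarrow> \<phi> x = \<psi> (d j x)"
        using van hom[of \<phi>] unfolding cohomology_vanishes_def Z by blast
      have "\<phi> = pullback (F (Suc j)) (d j) (restrict \<psi> (carrier (F j)))"
      proof (rule extensionalityI)
        show "\<phi> \<in> extensional (carrier (F (Suc j)))" using \<phi> by (auto simp: Z lhom_def PiE_def)
      qed (use \<psi>(2) lmod_hom.closed[OF d] in \<open>auto simp: pullback_def compose_def\<close>)
      then show "\<phi> \<in> ?B" using lmod_hom.restrict_in_lhom[OF \<psi>(1)] B by blast
    qed
  qed
  finally show ?thesis .
qed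

text \<open>\<open>Ext\<close> is defined by a chosen free resolution, of possibly infinite rank; its vanishing in degree
  \<open>j + 1\<close> can be tested on any projective resolution that reaches degree \<open>j + 2\<close>.\<close>

proposition trivial_Ext_iff:
  fixes S :: "('s, 'x) ring_scheme" and N :: "('s, 'n) module"
  assumes P: "partial_resolution S N (Suc (Suc j)) P dP eP"
    and proj: "\<And>k. k \<le> Suc (Suc j) \<Longrightarrow> dual_basis S (P k) (J k) (b k) (\<kappa> k)"
    and N: "lmodule S N" and Y: "lmodule S Y"
  shows "trivial_group (Ext (Suc j) S N Y) \<longleftrightarrow> cohomology_vanishes S P dP Y j"
proof -
  interpret N: lmodule S N by fact
  have ring: "ring S" by unfold_locales
  obtain I :: "nat \<Rightarrow> ('n, 's) gen set" and d e where Ide: "(SOME (I, d, e). free_resolution S N I d e) = (I, d, e)"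
    using prod_cases3 by blast
  have "\<exists>z :: (nat \<Rightarrow> ('n, 's) gen set) \<times> _ \<times> _. case z of (I, d, e) \<Rightarrow> free_resolution S N I d e"
    using free_resolution_exists[OF N] by auto
  from someI_ex[OF this] have res: "free_resolution S N I d e" by (simp add: Ide)
  let ?F = "\<lambda>k. free_module S (I k)"
  have F: "lmodule S (?F k)" for k by (rule lmodule_free[OF ring])
  have d: "lmod_hom S (?F (Suc k)) (?F k) (d k)" for k
    using res by (intro lmod_hom_of_lhom F) (simp add: free_resolution_def Let_def)
  have pres: "partial_resolution S N m ?F d e" for m
    using res d lmod_hom_of_lhom[OF _ F N]
    by (auto simp: free_resolution_def Let_def partial_resolution_def)
  have "trivial_group (Ext (Suc j) S N Y) \<longleftrightarrow>
      trivial_group (hom_cohomology S ?F d Y (Suc j))"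
    by (simp add: Ext_def Ide)
  also have "\<dots> \<longleftrightarrow> cohomology_vanishes S ?F d Y j"
    using partial_resolution_complex(2)[OF pres lessI]
    by (intro trivial_hom_cohomology_iff F Y d)
  also have "\<dots> \<longleftrightarrow> cohomology_vanishes S P dP Y j"
    using cohomology_vanishes_transfer[OF P pres proj dual_basis_free_module[OF ring]]
      cohomology_vanishes_transfer[OF pres P dual_basis_free_module[OF ring] proj] by blast
  finally show ?thesis .
qed

section \<open>Duality with respect to \<open>C\<close>\<close>

text \<open>A fixed \<open>A\<close>-module \<open>C\<close>. \<open>C\<Gamma>\<close> is \<open>C\<close> as a module over \<open>\<Gamma> = End\<^sub>A(C)\<close>, and \<open>dg M\<close> is \<open>M\<^sup>\<dagger>\<close>.\<close>

locale duality = C: lmodule A C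
  for A :: "('a, 'x) ring_scheme" and C :: "('a, 'c) module"
begin

abbreviation \<Gamma> :: "('c \<Rightarrow> 'c) ring" where "\<Gamma> \<equiv> End_ring A C"
abbreviation dg :: "('a, 'm) module \<Rightarrow> ('c \<Rightarrow> 'c, 'm \<Rightarrow> 'c) module" where "dg \<equiv> dagger A C"
abbreviation C\<Gamma> :: "('c \<Rightarrow> 'c, 'c) module" where "C\<Gamma> \<equiv> End_module C"

lemma dg_simps [simp]:
  "carrier (dg M) = lhom A M C"
  "\<phi> \<oplus>\<^bsub>dg M\<^esub> \<psi> = (\<lambda>x\<in>carrier M. \<phi> x \<oplus>\<^bsub>C\<^esub> \<psi> x)"
  "\<zero>\<^bsub>dg M\<^esub> = (\<lambda>x\<in>carrier M. \<zero>\<^bsub>C\<^esub>)"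
  "\<gamma> \<odot>\<^bsub>dg M\<^esub> \<phi> = (\<lambda>x\<in>carrier M. \<gamma> (\<phi> x))"
  by (simp_all add: dagger_def hom_module_def hom_group_def)

lemma End_simps [simp]:
  "carrier \<Gamma> = lhom A C C"
  "\<gamma> \<oplus>\<^bsub>\<Gamma>\<^esub> \<delta> = (\<lambda>c\<in>carrier C. \<gamma> c \<oplus>\<^bsub>C\<^esub> \<delta> c)"
  "\<gamma> \<otimes>\<^bsub>\<Gamma>\<^esub> \<delta> = (\<lambda>c\<in>carrier C. \<gamma> (\<delta> c))"
  "\<zero>\<^bsub>\<Gamma>\<^esub> = (\<lambda>c\<in>carrier C. \<zero>\<^bsub>C\<^esub>)"
  "\<one>\<^bsub>\<Gamma>\<^esub> = (\<lambda>c\<in>carrier C. c)"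
  by (simp_all add: End_ring_def hom_group_def compose_def)

lemma C\<Gamma>_simps [simp]:
  "carrier C\<Gamma> = carrier C" "c \<oplus>\<^bsub>C\<Gamma>\<^esub> c' = c \<oplus>\<^bsub>C\<^esub> c'" "\<zero>\<^bsub>C\<Gamma>\<^esub> = \<zero>\<^bsub>C\<^esub>" "\<gamma> \<odot>\<^bsub>C\<Gamma>\<^esub> c = \<gamma> c"
  by (simp_all add: End_module_def)

lemma hom: "\<lbrakk>lmodule A M; \<phi> \<in> lhom A M C\<rbrakk> \<Longrightarrow> lmod_hom A M C \<phi>"
  by (rule lmod_hom_of_lhom) (auto simp: C.lmodule_axioms)

lemma lhomD [simp]:
  assumes "\<phi> \<in> lhom A M C"
  shows "x \<in> carrier M \<Longrightarrow> \<phi> x \<in> carrier C" "\<phi> \<in> extensional (carrier M)"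
  using assms by (auto simp: lhom_def PiE_def)

lemma lhom_add:
  assumes "\<phi> \<in> lhom A M C" shows "\<lbrakk>x \<in> carrier M; y \<in> carrier M\<rbrakk> \<Longrightarrow> \<phi> (x \<oplus>\<^bsub>M\<^esub> y) = \<phi> x \<oplus>\<^bsub>C\<^esub> \<phi> y"
  using assms by (auto simp: lhom_def)

lemma lhom_ext:
  "\<lbrakk>\<phi> \<in> lhom A M C; \<psi> \<in> lhom A M C; \<And>x. x \<in> carrier M \<Longrightarrow> \<phi> x = \<psi> x\<rbrakk> \<Longrightarrow> \<phi> = \<psi>"
  using extensionalityI[of \<phi> "carrier M" \<psi>] by simp

lemma End_closed:
  "(\<lambda>c\<in>carrier C. c) \<in> lhom A C C"
  "\<lbrakk>lmodule A M; \<phi> \<in> lhom A M C; \<gamma> \<in> lhom A C C\<rbrakk> \<Longrightarrow> (\<lambda>x\<in>carrier M. \<gamma> (\<phi> x)) \<in> lhom A M C"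
  using lmod_hom.restrict_in_lhom[OF lmod_hom_id[OF C.lmodule_axioms]]
    lmod_hom.restrict_in_lhom[OF lmod_hom_comp[OF hom hom[OF C.lmodule_axioms]]]
  by auto

lemma abelian_group_dagger:
  assumes M: "lmodule A M" shows "abelian_group (dg M)"
  by (rule abelian_group_of_comm_group[OF comm_group_hom_group[OF M C.lmodule_axioms]])
    (simp_all add: dagger_def hom_module_def hom_group_def[of A M C])

lemma ring_End: "ring \<Gamma>"
proof (rule ringI)
  show "abelian_group \<Gamma>"
    by (rule abelian_group_of_comm_group[OF comm_group_hom_group[OF C.lmodule_axioms C.lmodule_axioms]])
      (simp_all add: End_ring_def hom_group_def[of A C C])
  show "monoid \<Gamma>"
    by (rule monoidI) (auto simp: End_closed C.lmodule_axioms intro!: restrict_ext extensionalityI[of _ "carrier C"])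
qed (auto intro!: restrict_ext simp: lhom_add)

lemma lmodule_dagger:
  assumes M: "lmodule A M" shows "lmodule \<Gamma> (dg M)"
  using ring_End abelian_group_dagger[OF M]
  by (intro lmodule.intro lmodule_axioms.intro)
    (auto simp: End_closed M lhom_add intro!: restrict_ext extensionalityI[of _ "carrier M"])

lemma lmodule_End_module: "lmodule \<Gamma> C\<Gamma>"
proof (intro lmodule.intro lmodule_axioms.intro ring_End)
  show "abelian_group C\<Gamma>"
  proof (rule abelian_groupI)
    show "\<exists>y\<in>carrier C\<Gamma>. y \<oplus>\<^bsub>C\<Gamma>\<^esub> x = \<zero>\<^bsub>C\<Gamma>\<^esub>" if "x \<in> carrier C\<Gamma>" for x
      using that by (intro bexI[of _ "\<ominus>\<^bsub>C\<^esub> x"]) (auto simp: C.M.l_neg)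
  qed (auto simp: C.M.a_assoc intro: C.M.a_comm)
qed (auto simp: lhom_add)

lemma finsum_End_module:
  assumes "finite I" "\<And>i. i \<in> I \<Longrightarrow> u i \<in> carrier C"
  shows "finsum C\<Gamma> u I = finsum C u I"
proof -
  interpret E: lmodule \<Gamma> C\<Gamma> by (rule lmodule_End_module)
  show ?thesis
    using assms
  proof (induction I rule: finite_induct)
    case (insert i I)
    then show ?case by (subst C.M.finsum_insert E.M.finsum_insert; force)+
  qed simp
qed

text \<open>Evaluation at an element of \<open>M\<close> is a \<open>\<Gamma>\<close>-linear map from \<open>M\<^sup>\<dagger>\<close> to \<open>C\<close>.\<close>

lemma lmod_hom_eval: "\<lbrakk>lmodule A M; x \<in> carrier M\<rbrakk> \<Longrightarrow> lmod_hom \<Gamma> (dg M) C\<Gamma> (\<lambda>\<phi>. \<phi> x)"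
  by (simp add: lmod_hom_def lmod_hom_axioms_def lmodule_dagger lmodule_End_module)

lemma pullback_apply: "x \<in> carrier W \<Longrightarrow> pullback W g \<phi> x = \<phi> (g x)"
  by (simp add: pullback_def compose_def)

lemma lmod_hom_pullback:
  assumes g: "lmod_hom A W X g"
  shows "lmod_hom \<Gamma> (dg X) (dg W) (pullback W g)"
proof -
  interpret g: lmod_hom A W X g by fact
  have mem: "pullback W g \<phi> \<in> lhom A W C" if "\<phi> \<in> lhom A X C" for \<phi>
    using lmod_hom.restrict_in_lhom[OF lmod_hom_comp[OF g hom[OF g.N.lmodule_axioms that]]]
    by (simp add: pullback_def compose_def)
  show ?thesis
    by (simp add: lmod_hom_def lmod_hom_axioms_def lmodule_dagger g.N.lmodule_axioms g.M.lmodule_axioms mem)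
      (auto simp: pullback_def compose_def g.closed intro!: restrict_ext)
qed

section \<open>Modules in \<open>add C\<close>\<close>

text \<open>Maps \<open>\<pi> j : X \<rightarrow> C\<close> and \<open>\<iota> j : C \<rightarrow> X\<close> for \<open>j < k\<close> with \<open>\<Sum>j. \<iota> j \<circ> \<pi> j = id\<close>: they present \<open>X\<close> as
  a direct summand of \<open>C\<^sup>k\<close>.\<close>

definition retract_data :: "('a, 'p) module \<Rightarrow> nat \<Rightarrow> (nat \<Rightarrow> 'p \<Rightarrow> 'c) \<Rightarrow> (nat \<Rightarrow> 'c \<Rightarrow> 'p) \<Rightarrow> bool" where
  "retract_data X k \<pi> \<iota> \<longleftrightarrow> lmodule A X \<and>
     (\<forall>j<k. \<pi> j \<in> lhom A X C \<and> lmod_hom A C X (\<iota> j)) \<and>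
     (\<forall>x\<in>carrier X. x = (\<Oplus>\<^bsub>X\<^esub>j\<in>{..<k}. \<iota> j (\<pi> j x)))"

text \<open>The components \<open>\<phi> \<circ> \<iota> j\<close> of a linear form \<open>\<phi>\<close> on \<open>X\<close>.\<close>

definition component :: "('c \<Rightarrow> 'p) \<Rightarrow> ('p \<Rightarrow> 'c) \<Rightarrow> 'c \<Rightarrow> 'c" where
  "component i \<phi> = (\<lambda>c\<in>carrier C. \<phi> (i c))"

lemma add_class_retract_data:
  assumes "X \<in> add_class A C"
  shows "\<exists>k \<pi> \<iota>. retract_data X k \<pi> \<iota>"
proof -
  obtain k :: nat and U where X: "lmodule A X" and U: "direct_summand A U (dirsum C {..<k})"
    and iso: "lmod_iso A X ((dirsum C {..<k})\<lparr>carrier := U\<rparr>)"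
    using assms by (auto simp: add_class_def)
  let ?D = "dirsum C {..<k}"
  interpret X: lmodule A X by fact
  interpret D: lmodule A ?D by (rule lmodule_dirsum[OF C.lmodule_axioms])
  obtain V where U': "submodule U A ?D" and V: "submodule V A ?D" and UV: "U \<inter> V = {\<zero>\<^bsub>?D\<^esub>}"
    and sum: "U <+>\<^bsub>?D\<^esub> V = carrier ?D"
    using U by (auto simp: direct_summand_def)
  obtain h where h: "h \<in> lhom A X (?D\<lparr>carrier := U\<rparr>)" and bij: "bij_betw h (carrier X) U"
    using iso by (auto simp: lmod_iso_def)
  have Usub: "U \<subseteq> carrier ?D" and Vsub: "V \<subseteq> carrier ?D"
    using subgroup.subset[OF submodule.axioms(1)[OF U']] subgroup.subset[OF submodule.axioms(1)[OF V]]
    by simp_all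
  have Uadd: "x \<oplus>\<^bsub>?D\<^esub> y \<in> U" if "x \<in> U" "y \<in> U" for x y
    using subgroup.m_closed[OF submodule.axioms(1)[OF U'] that] by simp
  have Vadd: "x \<oplus>\<^bsub>?D\<^esub> y \<in> V" if "x \<in> V" "y \<in> V" for x y
    using subgroup.m_closed[OF submodule.axioms(1)[OF V] that] by simp
  have Uminus: "\<ominus>\<^bsub>?D\<^esub> x \<in> U" if "x \<in> U" for x
    using subgroup.m_inv_closed[OF submodule.axioms(1)[OF U'] that] by (simp add: a_inv_def)
  have Vminus: "\<ominus>\<^bsub>?D\<^esub> x \<in> V" if "x \<in> V" for x
    using subgroup.m_inv_closed[OF submodule.axioms(1)[OF V] that] by (simp add: a_inv_def)
  have Usm: "a \<odot>\<^bsub>?D\<^esub> x \<in> U" if "a \<in> carrier A" "x \<in> U" for a x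
    using submodule.smult_closed[OF U'] that by simp
  have Vsm: "a \<odot>\<^bsub>?D\<^esub> x \<in> V" if "a \<in> carrier A" "x \<in> V" for a x
    using submodule.smult_closed[OF V] that by simp
  \<comment> \<open>The projection onto \<open>U\<close> along \<open>V\<close>.\<close>
  define p where "p x = (THE u. u \<in> U \<and> (\<exists>v\<in>V. x = u \<oplus>\<^bsub>?D\<^esub> v))" for x
  have uniq: "u = u'" if uv: "u \<in> U" "u' \<in> U" "v \<in> V" "v' \<in> V" "u \<oplus>\<^bsub>?D\<^esub> v = u' \<oplus>\<^bsub>?D\<^esub> v'" for u u' v v'
  proof -
    have c: "u \<in> carrier ?D" "u' \<in> carrier ?D" "v \<in> carrier ?D" "v' \<in> carrier ?D"
      using uv Usub Vsub by auto
    have "u \<ominus>\<^bsub>?D\<^esub> u' = (u \<oplus>\<^bsub>?D\<^esub> v) \<oplus>\<^bsub>?D\<^esub> (\<ominus>\<^bsub>?D\<^esub> v \<ominus>\<^bsub>?D\<^esub> u')"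
      using c by (simp add: a_minus_def D.M.a_assoc D.M.r_neg2)
    also have "\<dots> = v' \<ominus>\<^bsub>?D\<^esub> v"
      unfolding uv(5) using c by (simp add: a_minus_def D.M.a_assoc D.M.r_neg2
          D.M.a_comm[of "\<ominus>\<^bsub>?D\<^esub> v" "\<ominus>\<^bsub>?D\<^esub> u'"] D.M.a_lcomm[of v' "\<ominus>\<^bsub>?D\<^esub> u'"])
    finally have e: "u \<ominus>\<^bsub>?D\<^esub> u' = v' \<ominus>\<^bsub>?D\<^esub> v" .
    have "u \<ominus>\<^bsub>?D\<^esub> u' \<in> U" "v' \<ominus>\<^bsub>?D\<^esub> v \<in> V"
      using uv by (auto simp: a_minus_def intro!: Uadd Uminus Vadd Vminus)
    with e UV have "u \<ominus>\<^bsub>?D\<^esub> u' = \<zero>\<^bsub>?D\<^esub>" by auto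
    then show ?thesis by (rule D.M.eq_of_diff_zero[OF c(1,2)])
  qed
  have p_eq: "p (u \<oplus>\<^bsub>?D\<^esub> v) = u" if "u \<in> U" "v \<in> V" for u v
    unfolding p_def by (rule the_equality) (use that uniq in blast)+
  have decomp: "\<exists>u\<in>U. \<exists>v\<in>V. x = u \<oplus>\<^bsub>?D\<^esub> v" if "x \<in> carrier ?D" for x
  proof -
    have "x \<in> U <+>\<^bsub>?D\<^esub> V" using that sum by blast
    then show ?thesis unfolding set_add_def set_mult_def by auto
  qed
  have z: "\<zero>\<^bsub>?D\<^esub> \<in> U" "\<zero>\<^bsub>?D\<^esub> \<in> V" using UV by auto
  have pU: "p x \<in> U" if "x \<in> carrier ?D" for x
    using decomp[OF that] p_eq by auto
  have p_id: "p u = u" if "u \<in> U" for u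
    using p_eq[OF that z(2)] that Usub by (simp add: subset_iff)
  have p_add: "p (x \<oplus>\<^bsub>?D\<^esub> y) = p x \<oplus>\<^bsub>?D\<^esub> p y" if xy: "x \<in> carrier ?D" "y \<in> carrier ?D" for x y
  proof -
    obtain u v u' v' where uv: "u \<in> U" "v \<in> V" "x = u \<oplus>\<^bsub>?D\<^esub> v" "u' \<in> U" "v' \<in> V" "y = u' \<oplus>\<^bsub>?D\<^esub> v'"
      using decomp xy by metis
    then have c: "u \<in> carrier ?D" "u' \<in> carrier ?D" "v \<in> carrier ?D" "v' \<in> carrier ?D"
      using Usub Vsub by auto
    have "x \<oplus>\<^bsub>?D\<^esub> y = (u \<oplus>\<^bsub>?D\<^esub> u') \<oplus>\<^bsub>?D\<^esub> (v \<oplus>\<^bsub>?D\<^esub> v')" using c by (simp add: uv D.M.a_ac)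
    then show ?thesis using uv p_eq Uadd Vadd by simp
  qed
  have p_smult: "p (a \<odot>\<^bsub>?D\<^esub> x) = a \<odot>\<^bsub>?D\<^esub> p x" if a: "a \<in> carrier A" and x: "x \<in> carrier ?D" for a x
  proof -
    obtain u v where uv: "u \<in> U" "v \<in> V" "x = u \<oplus>\<^bsub>?D\<^esub> v" using decomp x by metis
    then have "a \<odot>\<^bsub>?D\<^esub> x = a \<odot>\<^bsub>?D\<^esub> u \<oplus>\<^bsub>?D\<^esub> a \<odot>\<^bsub>?D\<^esub> v" using a Usub Vsub D.smult_r_distr by blast
    then show ?thesis using uv p_eq Usm Vsm a by simp
  qed
  have hc: "h x \<in> U" if "x \<in> carrier X" for x using h that by (auto simp: lhom_def)
  have h_add: "h (x \<oplus>\<^bsub>X\<^esub> y) = h x \<oplus>\<^bsub>?D\<^esub> h y" if "x \<in> carrier X" "y \<in> carrier X" for x y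
    using h that by (auto simp: lhom_def)
  have h_smult: "h (a \<odot>\<^bsub>X\<^esub> x) = a \<odot>\<^bsub>?D\<^esub> h x" if "a \<in> carrier A" "x \<in> carrier X" for a x
    using h that by (auto simp: lhom_def)
  define g where "g = the_inv_into (carrier X) h"
  have gc: "g u \<in> carrier X" "h (g u) = u" if "u \<in> U" for u
    using bij that unfolding g_def
    by (metis bij_betw_def the_inv_into_into order_refl, metis bij_betw_def f_the_inv_into_f)
  have gh: "g (h x) = x" if "x \<in> carrier X" for x
    using bij that unfolding g_def by (metis bij_betw_def the_inv_into_f_f)
  have hh: "lmod_hom A X ?D h"
    by unfold_locales (use hc Usub h_add h_smult in auto)
  have gp: "lmod_hom A ?D X (\<lambda>x. g (p x))"
  proof unfold_locales
    show "g (p x) \<in> carrier X" if "x \<in> carrier ?D" for x using gc pU that by blast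
    show "g (p (x \<oplus>\<^bsub>?D\<^esub> y)) = g (p x) \<oplus>\<^bsub>X\<^esub> g (p y)" if "x \<in> carrier ?D" "y \<in> carrier ?D" for x y
    proof -
      have "h (g (p x) \<oplus>\<^bsub>X\<^esub> g (p y)) = p (x \<oplus>\<^bsub>?D\<^esub> y)" using that gc pU by (simp add: h_add p_add)
      then show ?thesis using gh[of "g (p x) \<oplus>\<^bsub>X\<^esub> g (p y)"] that gc pU by simp
    qed
    show "g (p (a \<odot>\<^bsub>?D\<^esub> x)) = a \<odot>\<^bsub>X\<^esub> g (p x)" if "a \<in> carrier A" "x \<in> carrier ?D" for a x
    proof -
      have "h (a \<odot>\<^bsub>X\<^esub> g (p x)) = p (a \<odot>\<^bsub>?D\<^esub> x)" using that gc pU by (simp add: h_smult p_smult)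
      then show ?thesis using gh[of "a \<odot>\<^bsub>X\<^esub> g (p x)"] that gc pU by simp
    qed
  qed
  define \<pi> where "\<pi> j = (\<lambda>x\<in>carrier X. h x j)" for j
  define \<iota> where "\<iota> j c = g (p (single C {..<k} j c))" for j c
  have "retract_data X k \<pi> \<iota>"
    unfolding retract_data_def
  proof (intro conjI allI impI ballI)
    show "lmodule A X" by fact
    show "\<pi> j \<in> lhom A X C" if "j < k" for j
      unfolding \<pi>_def
      by (rule lmod_hom.restrict_in_lhom[OF lmod_hom_comp[OF hh lmod_hom_coord[OF C.lmodule_axioms]]])
        (use that in simp)
    show "lmod_hom A C X (\<iota> j)" if "j < k" for j
      unfolding \<iota>_def
      by (rule lmod_hom_comp[OF lmod_hom_single[OF C.lmodule_axioms] gp]) (use that in simp)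
    fix x assume x: "x \<in> carrier X"
    interpret gp: lmod_hom A ?D X "\<lambda>x. g (p x)" by fact
    have hx: "h x \<in> carrier ?D" using hc[OF x] Usub by blast
    have hs: "single C {..<k} j (h x j) \<in> carrier ?D" if "j < k" for j
    proof -
      have j: "j \<in> {..<k}" using that by simp
      show ?thesis
        by (rule lmod_hom.closed[OF lmod_hom_single[OF C.lmodule_axioms j]
            lmod_hom.closed[OF lmod_hom_coord[OF C.lmodule_axioms j] hx]])
    qed
    have "x = g (p (h x))" using x by (simp add: p_id hc gh)
    also have "h x = (\<Oplus>\<^bsub>?D\<^esub>j\<in>{..<k}. single C {..<k} j (h x j))"
      by (rule dirsum_expand[OF C.lmodule_axioms hx]) auto
    also have "g (p \<dots>) = (\<Oplus>\<^bsub>X\<^esub>j\<in>{..<k}. \<iota> j (h x j))"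
      unfolding \<iota>_def
      by (rule gp.finsum) (use hs in auto)
    finally show "x = (\<Oplus>\<^bsub>X\<^esub>j\<in>{..<k}. \<iota> j (\<pi> j x))" using x by (simp add: \<pi>_def)
  qed
  then show ?thesis by blast
qed

lemma dirsum_in_add_class: "dirsum C {..<k::nat} \<in> add_class A C"
proof -
  let ?D = "dirsum C {..<k}"
  interpret D: lmodule A ?D by (rule lmodule_dirsum[OF C.lmodule_axioms])
  have "subgroup (carrier ?D) (add_monoid ?D)"
    using group.subgroup_self[OF D.M.a_group] by simp
  then have "submodule (carrier ?D) A ?D" by (simp add: submodule_def submodule_axioms_def)
  moreover have "subgroup {\<zero>\<^bsub>?D\<^esub>} (add_monoid ?D)"
    using group.triv_subgroup[OF D.M.a_group] by simp
  then have "submodule {\<zero>\<^bsub>?D\<^esub>} A ?D" by (simp add: submodule_def submodule_axioms_def D.smult_r_null)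
  moreover have "carrier ?D <+>\<^bsub>?D\<^esub> {\<zero>\<^bsub>?D\<^esub>} = carrier ?D"
    by (auto simp: set_add_def set_mult_def)
  moreover have "(\<lambda>x\<in>carrier ?D. x) \<in> lhom A ?D ?D" by (auto simp: lhom_def)
  moreover have "carrier ?D \<inter> {\<zero>\<^bsub>?D\<^esub>} = {\<zero>\<^bsub>?D\<^esub>}" by simp
  moreover have "bij_betw (\<lambda>x\<in>carrier ?D. x) (carrier ?D) (carrier ?D)"
    by (simp add: bij_betw_def inj_on_def)
  ultimately have "direct_summand A (carrier ?D) ?D" and iso: "lmod_iso A ?D ?D"
    unfolding direct_summand_def lmod_iso_def by blast+
  moreover have "?D\<lparr>carrier := carrier ?D\<rparr> = ?D" by simp
  ultimately have "direct_summand A (carrier ?D) ?D \<and> lmod_iso A ?D (?D\<lparr>carrier := carrier ?D\<rparr>)"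
    by simp
  then show ?thesis
    unfolding add_class_def using D.lmodule_axioms
    by (intro CollectI conjI exI[of _ k] exI[of _ "carrier ?D"]) auto
qed

context
  fixes X :: "('a, 'p) module" and k \<pi> \<iota>
  assumes data: "retract_data X k \<pi> \<iota>"
begin

lemma retract_lmodule: "lmodule A X" using data by (simp add: retract_data_def)

lemma retract_expand: "x \<in> carrier X \<Longrightarrow> x = (\<Oplus>\<^bsub>X\<^esub>j\<in>{..<k}. \<iota> j (\<pi> j x))"
  using data by (simp add: retract_data_def)

lemma retract_pi: "j < k \<Longrightarrow> \<pi> j \<in> lhom A X C" and retract_iota: "j < k \<Longrightarrow> lmod_hom A C X (\<iota> j)"
  using data by (simp_all add: retract_data_def)

lemma component_in_End: "\<lbrakk>j < k; \<phi> \<in> lhom A X C\<rbrakk> \<Longrightarrow> component (\<iota> j) \<phi> \<in> lhom A C C"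
  unfolding component_def
  by (rule lmod_hom.restrict_in_lhom[OF lmod_hom_comp[OF retract_iota hom[OF retract_lmodule]]])

lemma retract_form_expand:
  assumes \<phi>: "\<phi> \<in> lhom A X C"
  shows "\<phi> = (\<Oplus>\<^bsub>dg X\<^esub>j\<in>{..<k}. component (\<iota> j) \<phi> \<odot>\<^bsub>dg X\<^esub> \<pi> j)"
proof (rule lhom_ext[OF \<phi>])
  interpret D: lmodule \<Gamma> "dg X" by (rule lmodule_dagger[OF retract_lmodule])
  interpret X: lmodule A X by (rule retract_lmodule)
  have t: "component (\<iota> j) \<phi> \<odot>\<^bsub>dg X\<^esub> \<pi> j \<in> carrier (dg X)" if "j < k" for j
    using that component_in_End[OF that \<phi>] retract_pi by (intro D.smult_closed) auto
  show "(\<Oplus>\<^bsub>dg X\<^esub>j\<in>{..<k}. component (\<iota> j) \<phi> \<odot>\<^bsub>dg X\<^esub> \<pi> j) \<in> lhom A X C"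
  proof -
    have "(\<Oplus>\<^bsub>dg X\<^esub>j\<in>{..<k}. component (\<iota> j) \<phi> \<odot>\<^bsub>dg X\<^esub> \<pi> j) \<in> carrier (dg X)"
      by (rule D.M.finsum_closed) (use t in blast)
    then show ?thesis by simp
  qed
  fix x assume x: "x \<in> carrier X"
  interpret ev: lmod_hom \<Gamma> "dg X" C\<Gamma> "\<lambda>\<phi>. \<phi> x" by (rule lmod_hom_eval[OF retract_lmodule x])
  interpret \<phi>: lmod_hom A X C \<phi> by (rule hom[OF retract_lmodule \<phi>])
  have pc: "\<pi> j x \<in> carrier C" if "j < k" for j using retract_pi[OF that] x by simp
  have "\<phi> x = \<phi> (\<Oplus>\<^bsub>X\<^esub>j\<in>{..<k}. \<iota> j (\<pi> j x))" using retract_expand[OF x] by simp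
  also have "\<dots> = (\<Oplus>\<^bsub>C\<^esub>j\<in>{..<k}. \<phi> (\<iota> j (\<pi> j x)))"
    by (rule \<phi>.finsum) (use lmod_hom.closed[OF retract_iota] pc in auto)
  also have "\<dots> = (\<Oplus>\<^bsub>C\<Gamma>\<^esub>j\<in>{..<k}. \<phi> (\<iota> j (\<pi> j x)))"
    using pc by (intro finsum_End_module[symmetric]) (auto intro!: \<phi>.closed lmod_hom.closed[OF retract_iota])
  also have "\<dots> = (\<Oplus>\<^bsub>C\<Gamma>\<^esub>j\<in>{..<k}. (component (\<iota> j) \<phi> \<odot>\<^bsub>dg X\<^esub> \<pi> j) x)"
    by (rule ev.N.M.finsum_cong') (use ev.closed[OF t] pc x in \<open>auto simp: component_def\<close>)
  also have "\<dots> = (\<Oplus>\<^bsub>dg X\<^esub>j\<in>{..<k}. component (\<iota> j) \<phi> \<odot>\<^bsub>dg X\<^esub> \<pi> j) x"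
    by (rule ev.finsum[symmetric]) (simp, use t in blast)
  finally show "\<phi> x = (\<Oplus>\<^bsub>dg X\<^esub>j\<in>{..<k}. component (\<iota> j) \<phi> \<odot>\<^bsub>dg X\<^esub> \<pi> j) x" .
qed

text \<open>The homomorphisms to \<open>C\<close> separate the elements of a module in \<open>add C\<close>, that is, \<open>\<lambda>\<^sub>X\<close> is
  injective.\<close>

lemma retract_separated:
  assumes "x \<in> carrier X" "y \<in> carrier X" "\<And>\<phi>. \<phi> \<in> lhom A X C \<Longrightarrow> \<phi> x = \<phi> y"
  shows "x = y"
proof -
  interpret X: lmodule A X by (rule retract_lmodule)
  have "(\<Oplus>\<^bsub>X\<^esub>j\<in>{..<k}. \<iota> j (\<pi> j x)) = (\<Oplus>\<^bsub>X\<^esub>j\<in>{..<k}. \<iota> j (\<pi> j y))"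
  proof (rule X.M.finsum_cong')
    show "(\<lambda>j. \<iota> j (\<pi> j y)) \<in> {..<k} \<rightarrow> carrier X"
      using lmod_hom.closed[OF retract_iota] lhomD(1)[OF retract_pi assms(2)] by simp
    show "\<iota> j (\<pi> j x) = \<iota> j (\<pi> j y)" if "j \<in> {..<k}" for j
      using assms(3)[OF retract_pi] that by simp
  qed simp
  then show ?thesis using retract_expand assms(1,2) by metis
qed

text \<open>Modules in \<open>add C\<close> are reflexive: \<open>\<lambda>\<^sub>X\<close> is surjective.\<close>

lemma retract_reflexive:
  assumes \<theta>: "lmod_hom \<Gamma> (dg X) C\<Gamma> \<theta>"
  shows "\<exists>x\<in>carrier X. \<forall>\<phi>\<in>lhom A X C. \<theta> \<phi> = \<phi> x"
proof -
  interpret \<theta>: lmod_hom \<Gamma> "dg X" C\<Gamma> \<theta> by fact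
  interpret X: lmodule A X by (rule retract_lmodule)
  have tp: "\<theta> (\<pi> j) \<in> carrier C" if "j < k" for j using \<theta>.closed retract_pi[OF that] by simp
  have itp: "\<iota> j (\<theta> (\<pi> j)) \<in> carrier X" if "j < k" for j
    using lmod_hom.closed[OF retract_iota[OF that] tp[OF that]] .
  let ?x = "\<Oplus>\<^bsub>X\<^esub>j\<in>{..<k}. \<iota> j (\<theta> (\<pi> j))"
  have "\<theta> \<phi> = \<phi> ?x" if \<phi>: "\<phi> \<in> lhom A X C" for \<phi>
  proof -
    interpret \<phi>: lmod_hom A X C \<phi> by (rule hom[OF retract_lmodule \<phi>])
    have m: "component (\<iota> j) \<phi> \<in> carrier \<Gamma>" "\<pi> j \<in> carrier (dg X)" if "j < k" for j
      using component_in_End[OF that \<phi>] retract_pi[OF that] by simp_all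
    have "\<theta> \<phi> = \<theta> (\<Oplus>\<^bsub>dg X\<^esub>j\<in>{..<k}. component (\<iota> j) \<phi> \<odot>\<^bsub>dg X\<^esub> \<pi> j)"
      using retract_form_expand[OF \<phi>] by simp
    also have "\<dots> = (\<Oplus>\<^bsub>C\<Gamma>\<^esub>j\<in>{..<k}. \<theta> (component (\<iota> j) \<phi> \<odot>\<^bsub>dg X\<^esub> \<pi> j))"
      by (rule \<theta>.finsum) (use m \<theta>.M.smult_closed in blast)+
    also have "\<dots> = (\<Oplus>\<^bsub>C\<Gamma>\<^esub>j\<in>{..<k}. \<phi> (\<iota> j (\<theta> (\<pi> j))))"
    proof (rule \<theta>.N.M.finsum_cong')
      show "\<theta> (component (\<iota> j) \<phi> \<odot>\<^bsub>dg X\<^esub> \<pi> j) = \<phi> (\<iota> j (\<theta> (\<pi> j)))" if "j \<in> {..<k}" for j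
        using that \<theta>.smult[OF m] tp by (simp add: component_def)
    qed (use itp \<phi>.closed in auto)
    also have "\<dots> = (\<Oplus>\<^bsub>C\<^esub>j\<in>{..<k}. \<phi> (\<iota> j (\<theta> (\<pi> j))))"
      using itp \<phi>.closed by (intro finsum_End_module) auto
    also have "\<dots> = \<phi> ?x" by (rule \<phi>.finsum[symmetric]) (use itp in auto)
    finally show ?thesis .
  qed
  moreover have "?x \<in> carrier X" by (rule X.M.finsum_closed) (use itp in auto)
  ultimately show ?thesis by blast
qed

text \<open>\<open>X\<^sup>\<dagger>\<close> is a projective \<open>\<Gamma>\<close>-module.\<close>

lemma retract_dual_basis: "dual_basis \<Gamma> (dg X) {..<k} \<pi> (\<lambda>j. component (\<iota> j))"
  unfolding dual_basis_def
proof (intro conjI ballI)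
  show D: "lmodule \<Gamma> (dg X)" by (rule lmodule_dagger[OF retract_lmodule])
  interpret D: lmodule \<Gamma> "dg X" by fact
  show "\<pi> j \<in> carrier (dg X)" if "j \<in> {..<k}" for j using retract_pi that by simp
  show "lmod_hom \<Gamma> (dg X) (regular_module \<Gamma>) (component (\<iota> j))" if "j \<in> {..<k}" for j
    using that component_in_End lmod_hom.closed[OF retract_iota]
    by (simp add: lmod_hom_def lmod_hom_axioms_def D lmodule_regular ring_End)
      (auto simp: regular_module_def component_def intro!: restrict_ext)
  fix \<phi> assume "\<phi> \<in> carrier (dg X)"
  then have \<phi>: "\<phi> \<in> lhom A X C" by simp
  let ?B = "{j \<in> {..<k}. component (\<iota> j) \<phi> \<noteq> \<zero>\<^bsub>\<Gamma>\<^esub>}"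
  show "finite ?B" by simp
  have m: "component (\<iota> j) \<phi> \<in> carrier \<Gamma>" "\<pi> j \<in> carrier (dg X)" if "j < k" for j
    using component_in_End[OF that \<phi>] retract_pi[OF that] by simp_all
  have "(\<Oplus>\<^bsub>dg X\<^esub>j\<in>?B. component (\<iota> j) \<phi> \<odot>\<^bsub>dg X\<^esub> \<pi> j)
      = (\<Oplus>\<^bsub>dg X\<^esub>j\<in>{..<k}. component (\<iota> j) \<phi> \<odot>\<^bsub>dg X\<^esub> \<pi> j)"
  proof (rule D.M.add.finprod_mono_neutral_cong_left)
    show "component (\<iota> j) \<phi> \<odot>\<^bsub>dg X\<^esub> \<pi> j = \<zero>\<^bsub>dg X\<^esub>" if "j \<in> {..<k} - ?B" for j
      using that D.smult_l_null[OF m(2)] by auto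
    show "(\<lambda>j. component (\<iota> j) \<phi> \<odot>\<^bsub>dg X\<^esub> \<pi> j) \<in> {..<k} \<rightarrow> carrier (dg X)"
      using D.smult_closed[OF m] by blast
  qed auto
  then show "\<phi> = (\<Oplus>\<^bsub>dg X\<^esub>j\<in>?B. component (\<iota> j) \<phi> \<odot>\<^bsub>dg X\<^esub> \<pi> j)"
    using retract_form_expand[OF \<phi>] by simp
qed

end

section \<open>Exactness of a complex with exact dual\<close>

lemma ddagger_carrier: "carrier (ddagger A C (dg M)) = lhom \<Gamma> (dg M) C\<Gamma>"
  by (simp add: ddagger_def hom_module_def)

lemma eval_map_apply:
  "\<lbrakk>m \<in> carrier M; \<psi> \<in> lhom A M C\<rbrakk> \<Longrightarrow> eval_map A C M m \<psi> = \<psi> m"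
  by (simp add: eval_map_def)

lemma eval_map_in_ddagger:
  assumes "lmodule A M" "m \<in> carrier M"
  shows "eval_map A C M m \<in> carrier (ddagger A C (dg M))"
  using lmod_hom.restrict_in_lhom[OF lmod_hom_eval[OF assms]] assms
  by (simp add: ddagger_carrier eval_map_def)

lemma eval_map_eqI:
  assumes "m \<in> carrier M" "\<theta> \<in> carrier (ddagger A C (dg M))"
    and "\<And>\<psi>. \<psi> \<in> lhom A M C \<Longrightarrow> \<theta> \<psi> = \<psi> m"
  shows "eval_map A C M m = \<theta>"
proof (rule extensionalityI)
  show "eval_map A C M m \<in> extensional (lhom A M C)" using assms(1) by (simp add: eval_map_def)
  show "\<theta> \<in> extensional (lhom A M C)" using assms(2) by (auto simp: ddagger_carrier lhom_def[of \<Gamma>] PiE_def)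
  show "eval_map A C M m \<psi> = \<theta> \<psi>" if "\<psi> \<in> lhom A M C" for \<psi>
    using that assms by (simp add: eval_map_apply)
qed

lemma inj_eval_map_iff:
  assumes M: "lmodule A M"
  shows "inj_on (eval_map A C M) (carrier M) \<longleftrightarrow>
    (\<forall>m\<in>carrier M. (\<forall>\<psi>\<in>lhom A M C. \<psi> m = \<zero>\<^bsub>C\<^esub>) \<longrightarrow> m = \<zero>\<^bsub>M\<^esub>)"
proof
  interpret M: lmodule A M by fact
  have z: "\<psi> \<zero>\<^bsub>M\<^esub> = \<zero>\<^bsub>C\<^esub>" if "\<psi> \<in> lhom A M C" for \<psi> by (rule lmod_hom.zero[OF hom[OF M that]])
  assume inj: "inj_on (eval_map A C M) (carrier M)"
  show "\<forall>m\<in>carrier M. (\<forall>\<psi>\<in>lhom A M C. \<psi> m = \<zero>\<^bsub>C\<^esub>) \<longrightarrow> m = \<zero>\<^bsub>M\<^esub>"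
  proof (intro ballI impI)
    fix m assume m: "m \<in> carrier M" and "\<forall>\<psi>\<in>lhom A M C. \<psi> m = \<zero>\<^bsub>C\<^esub>"
    then have "eval_map A C M m = eval_map A C M \<zero>\<^bsub>M\<^esub>"
      by (intro eval_map_eqI eval_map_in_ddagger M) (auto simp: eval_map_apply z)
    then show "m = \<zero>\<^bsub>M\<^esub>" using inj m by (auto dest: inj_onD)
  qed
next
  interpret M: lmodule A M by fact
  assume *: "\<forall>m\<in>carrier M. (\<forall>\<psi>\<in>lhom A M C. \<psi> m = \<zero>\<^bsub>C\<^esub>) \<longrightarrow> m = \<zero>\<^bsub>M\<^esub>"
  show "inj_on (eval_map A C M) (carrier M)"
  proof (rule inj_onI)
    fix x y assume xy: "x \<in> carrier M" "y \<in> carrier M" "eval_map A C M x = eval_map A C M y"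
    have "\<psi> (x \<ominus>\<^bsub>M\<^esub> y) = \<zero>\<^bsub>C\<^esub>" if \<psi>: "\<psi> \<in> lhom A M C" for \<psi>
    proof -
      have "\<psi> x = \<psi> y" using fun_cong[OF xy(3), of \<psi>] xy(1,2) \<psi> by (simp add: eval_map_apply)
      then show ?thesis
        using lmod_hom.diff[OF hom[OF M \<psi>] xy(1,2)] xy \<psi> by (simp add: a_minus_def C.M.r_neg)
    qed
    with * xy have "x \<ominus>\<^bsub>M\<^esub> y = \<zero>\<^bsub>M\<^esub>" by simp
    then show "x = y" by (rule M.M.eq_of_diff_zero[OF xy(1,2)])
  qed
qed

text \<open>If \<open>M\<close> embeds into a module in \<open>add C\<close>, then \<open>\<lambda>\<^sub>M\<close> is injective.\<close>

lemma inj_eval_map_if_embeds: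
  assumes M: "lmodule A M" and X: "X \<in> add_class A C"
    and f: "f \<in> lhom A M X" and ker: "lker M X f = {\<zero>\<^bsub>M\<^esub>}"
  shows "inj_on (eval_map A C M) (carrier M)"
  unfolding inj_eval_map_iff[OF M]
proof (intro ballI impI)
  fix m assume m: "m \<in> carrier M" and van: "\<forall>\<psi>\<in>lhom A M C. \<psi> m = \<zero>\<^bsub>C\<^esub>"
  obtain k \<pi> \<iota> where data: "retract_data X k \<pi> \<iota>" using add_class_retract_data[OF X] by blast
  interpret f: lmod_hom A M X f by (rule lmod_hom_of_lhom[OF f M retract_lmodule[OF data]])
  have "\<phi> (f m) = \<phi> \<zero>\<^bsub>X\<^esub>" if \<phi>: "\<phi> \<in> lhom A X C" for \<phi>
  proof -
    have "pullback M f \<phi> \<in> lhom A M C"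
      using lmod_hom.closed[OF lmod_hom_pullback[OF f.lmod_hom_axioms]] \<phi> by simp
    with van have "pullback M f \<phi> m = \<zero>\<^bsub>C\<^esub>" by blast
    then have "\<phi> (f m) = \<zero>\<^bsub>C\<^esub>" by (simp only: pullback_apply[OF m])
    then show ?thesis using lmod_hom.zero[OF hom[OF retract_lmodule[OF data] \<phi>]] by simp
  qed
  then have "f m = \<zero>\<^bsub>X\<^esub>" by (rule retract_separated[OF data f.closed[OF m] f.N.M.zero_closed])
  then show "m = \<zero>\<^bsub>M\<^esub>" using ker m by (auto simp: lker_def)
qed

context
  fixes M :: "('a, 'm) module" and X :: "nat \<Rightarrow> ('a, 'k) module" and f d and n :: nat
  assumes M: "lmodule A M" and n: "0 < n" and X: "\<And>k. k < n \<Longrightarrow> X k \<in> add_class A C"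
    and f: "f \<in> lhom A M (X 0)" and d: "\<And>k. Suc k < n \<Longrightarrow> d k \<in> lhom A (X k) (X (Suc k))"
    and exact: "exact_dual A C n M X f d"
begin

lemma X_lmodule: "k < n \<Longrightarrow> lmodule A (X k)"
  using X by (simp add: add_class_def)

lemma f_hom: "lmod_hom A M (X 0) f" by (rule lmod_hom_of_lhom[OF f M X_lmodule[OF n]])

lemma d_hom: "Suc k < n \<Longrightarrow> lmod_hom A (X k) (X (Suc k)) (d k)"
  by (rule lmod_hom_of_lhom[OF d X_lmodule X_lmodule]) auto

lemma dual_surj: "pullback M f ` lhom A (X 0) C = lhom A M C"
  using exact by (simp add: exact_dual_def Let_def)

lemma dual_lift: "\<psi> \<in> lhom A M C \<Longrightarrow> \<exists>\<phi>\<in>lhom A (X 0) C. \<psi> = pullback M f \<phi>"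
  using equalityD2[OF dual_surj] by (auto simp: image_iff dest!: subsetD)

lemma dual_exact_0: "1 < n \<Longrightarrow>
    pullback (X 0) (d 0) ` lhom A (X 1) C = lker (dg (X 0)) (dg M) (pullback M f)"
  using exact by (simp add: exact_dual_def Let_def)

lemma dual_exact_Suc: "Suc (Suc k) < n \<Longrightarrow>
    pullback (X (Suc k)) (d (Suc k)) ` lhom A (X (Suc (Suc k))) C =
      lker (dg (X (Suc k))) (dg (X k)) (pullback (X k) (d k))"
  using exact by (simp add: exact_dual_def Let_def)

lemma X_separated:
  assumes "k < n" "x \<in> carrier (X k)" "y \<in> carrier (X k)" "\<And>\<phi>. \<phi> \<in> lhom A (X k) C \<Longrightarrow> \<phi> x = \<phi> y"
  shows "x = y"
proof -
  obtain K \<pi> \<iota> where "retract_data (X k) K \<pi> \<iota>"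
    using add_class_retract_data[OF X[OF assms(1)]] by blast
  then show ?thesis using assms(2-4) by (rule retract_separated)
qed

lemma X_reflexive:
  assumes "k < n" "lmod_hom \<Gamma> (dg (X k)) C\<Gamma> \<theta>"
  shows "\<exists>x\<in>carrier (X k). \<forall>\<phi>\<in>lhom A (X k) C. \<theta> \<phi> = \<phi> x"
proof -
  obtain K \<pi> \<iota> where "retract_data (X k) K \<pi> \<iota>"
    using add_class_retract_data[OF X[OF assms(1)]] by blast
  then show ?thesis using assms(2) by (rule retract_reflexive)
qed

text \<open>Exactness of the dual alone makes the maps \<open>f\<close>, \<open>d 0\<close>, \<open>d 1\<close>, \<dots> a complex, because the
  homomorphisms to \<open>C\<close> separate the elements of each \<open>X k\<close>.\<close>

lemma complex_0:
  assumes "1 < n" "m \<in> carrier M" shows "d 0 (f m) = \<zero>\<^bsub>X 1\<^esub>"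
proof (rule X_separated[of 1])
  interpret f: lmod_hom A M "X 0" f by (rule f_hom)
  interpret d: lmod_hom A "X 0" "X (Suc 0)" "d 0" by (rule d_hom) (use assms in simp)
  show "d 0 (f m) \<in> carrier (X 1)" using d.closed[OF f.closed[OF assms(2)]] by simp
  show "\<zero>\<^bsub>X 1\<^esub> \<in> carrier (X 1)" by simp
  fix \<phi> assume \<phi>: "\<phi> \<in> lhom A (X 1) C"
  then have "pullback (X 0) (d 0) \<phi> \<in> lker (dg (X 0)) (dg M) (pullback M f)"
    using dual_exact_0[OF assms(1)] by blast
  then have "pullback M f (pullback (X 0) (d 0) \<phi>) m = \<zero>\<^bsub>C\<^esub>" using assms by (simp add: lker_def)
  then show "\<phi> (d 0 (f m)) = \<phi> \<zero>\<^bsub>X 1\<^esub>"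
    using assms f.closed lmod_hom.zero[OF hom[OF _ \<phi>]] d.N.lmodule_axioms by (simp add: pullback_apply)
qed (use assms in simp)

lemma complex_Suc:
  assumes "Suc (Suc k) < n" "x \<in> carrier (X k)" shows "d (Suc k) (d k x) = \<zero>\<^bsub>X (Suc (Suc k))\<^esub>"
proof (rule X_separated[OF assms(1)])
  interpret d: lmod_hom A "X k" "X (Suc k)" "d k" by (rule d_hom) (use assms in simp)
  interpret d': lmod_hom A "X (Suc k)" "X (Suc (Suc k))" "d (Suc k)" by (rule d_hom) (use assms in simp)
  show "d (Suc k) (d k x) \<in> carrier (X (Suc (Suc k)))" using d'.closed[OF d.closed[OF assms(2)]] .
  show "\<zero>\<^bsub>X (Suc (Suc k))\<^esub> \<in> carrier (X (Suc (Suc k)))" by simp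
  fix \<phi> assume \<phi>: "\<phi> \<in> lhom A (X (Suc (Suc k))) C"
  then have "pullback (X (Suc k)) (d (Suc k)) \<phi> \<in> lker (dg (X (Suc k))) (dg (X k)) (pullback (X k) (d k))"
    using dual_exact_Suc[OF assms(1)] by blast
  then have "pullback (X k) (d k) (pullback (X (Suc k)) (d (Suc k)) \<phi>) x = \<zero>\<^bsub>C\<^esub>"
    using assms by (simp add: lker_def)
  then show "\<phi> (d (Suc k) (d k x)) = \<phi> \<zero>\<^bsub>X (Suc (Suc k))\<^esub>"
    using assms d.closed lmod_hom.zero[OF hom[OF _ \<phi>]] d'.N.lmodule_axioms by (simp add: pullback_apply)
qed

text \<open>The dual complex is a resolution of \<open>M\<^sup>\<dagger>\<close>; its terms are projective by
  \<open>retract_dual_basis\<close>.\<close>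

lemma dual_resolution:
  "m < n \<Longrightarrow> partial_resolution \<Gamma> (dg M) m (\<lambda>k. dg (X k)) (\<lambda>k. pullback (X k) (d k)) (pullback M f)"
  unfolding partial_resolution_def
  using lmod_hom_pullback[OF f_hom] lmod_hom_pullback[OF d_hom] dual_surj dual_exact_0 dual_exact_Suc
  by simp

text \<open>Since \<open>f\<^sup>\<dagger>\<close> is surjective, \<open>f\<close> and \<open>\<lambda>\<^sub>M\<close> have the same kernel.\<close>

lemma exact_at_M_iff: "lker M (X 0) f = {\<zero>\<^bsub>M\<^esub>} \<longleftrightarrow> inj_on (eval_map A C M) (carrier M)"
proof
  show "inj_on (eval_map A C M) (carrier M)" if "lker M (X 0) f = {\<zero>\<^bsub>M\<^esub>}"
    by (rule inj_eval_map_if_embeds[OF M X[OF n] f that])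
next
  interpret f: lmod_hom A M "X 0" f by (rule f_hom)
  assume inj: "inj_on (eval_map A C M) (carrier M)"
  have "m = \<zero>\<^bsub>M\<^esub>" if m: "m \<in> carrier M" "f m = \<zero>\<^bsub>X 0\<^esub>" for m
  proof -
    have "\<psi> m = \<zero>\<^bsub>C\<^esub>" if \<psi>: "\<psi> \<in> lhom A M C" for \<psi>
    proof -
      obtain \<phi> where \<phi>: "\<phi> \<in> lhom A (X 0) C" "\<psi> = pullback M f \<phi>" using dual_lift[OF \<psi>] by blast
      then show ?thesis
        using m lmod_hom.zero[OF hom[OF f.N.lmodule_axioms \<phi>(1)]] by (simp add: pullback_apply)
    qed
    then have "\<forall>\<psi>\<in>lhom A M C. \<psi> m = \<zero>\<^bsub>C\<^esub>" by (rule ballI)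
    then show ?thesis by (rule inj[unfolded inj_eval_map_iff[OF M], THEN bspec, OF m(1), THEN mp])
  qed
  then show "lker M (X 0) f = {\<zero>\<^bsub>M\<^esub>}" unfolding lker_def using f.zero f.M.M.zero_closed by blast
qed

text \<open>Under \<open>\<lambda>\<close>, the map \<open>f\<close> becomes \<open>M\<^sup>\<dagger>\<^sup>\<ddagger> \<rightarrow> (X 0)\<^sup>\<dagger>\<^sup>\<ddagger> \<cong> X 0\<close>, which is a kernel of \<open>d 0\<close> because
  \<open>Hom\<^sub>\<Gamma>(-,C)\<close> is left exact.\<close>

lemma exact_at_X0_iff:
  assumes n1: "1 < n"
  shows "f ` carrier M = lker (X 0) (X 1) (d 0) \<longleftrightarrow>
    eval_map A C M ` carrier M = carrier (ddagger A C (dg M))"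
proof -
  interpret f: lmod_hom A M "X 0" f by (rule f_hom)
  interpret f': lmod_hom \<Gamma> "dg (X 0)" "dg M" "pullback M f" by (rule lmod_hom_pullback[OF f_hom])
  have d0: "lmod_hom A (X 0) (X 1) (d 0)" using d_hom[of 0] n1 by simp
  interpret d: lmod_hom A "X 0" "X 1" "d 0" by (rule d0)
  have dz: "\<chi> \<zero>\<^bsub>X 1\<^esub> = \<zero>\<^bsub>C\<^esub>" if "\<chi> \<in> lhom A (X 1) C" for \<chi>
    by (rule lmod_hom.zero[OF hom[OF d.N.lmodule_axioms that]])
  have fc: "\<chi> (f m) \<in> carrier C" if "\<chi> \<in> lhom A (X 0) C" "m \<in> carrier M" for \<chi> m
    using that f.closed by simp
  show ?thesis
  proof
    assume ex: "f ` carrier M = lker (X 0) (X 1) (d 0)"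
    show "eval_map A C M ` carrier M = carrier (ddagger A C (dg M))"
    proof
      show "eval_map A C M ` carrier M \<subseteq> carrier (ddagger A C (dg M))"
        using eval_map_in_ddagger[OF M] by blast
      show "carrier (ddagger A C (dg M)) \<subseteq> eval_map A C M ` carrier M"
      proof
        fix \<theta> assume \<theta>: "\<theta> \<in> carrier (ddagger A C (dg M))"
        have \<theta>h: "lmod_hom \<Gamma> (dg M) C\<Gamma> \<theta>"
          using \<theta> by (intro lmod_hom_of_lhom lmodule_dagger[OF M] lmodule_End_module) (simp add: ddagger_carrier)
        obtain x where x: "x \<in> carrier (X 0)" "\<And>\<phi>. \<phi> \<in> lhom A (X 0) C \<Longrightarrow> \<theta> (pullback M f \<phi>) = \<phi> x"
          using X_reflexive[OF n lmod_hom_comp[OF f'.lmod_hom_axioms \<theta>h]] by blast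
        have "d 0 x = \<zero>\<^bsub>X 1\<^esub>"
        proof (rule X_separated[OF n1])
          fix \<chi> assume \<chi>: "\<chi> \<in> lhom A (X 1) C"
          have "pullback (X 0) (d 0) \<chi> \<in> lker (dg (X 0)) (dg M) (pullback M f)"
            using dual_exact_0[OF n1] \<chi> by blast
          then have "pullback (X 0) (d 0) \<chi> \<in> lhom A (X 0) C"
            "pullback M f (pullback (X 0) (d 0) \<chi>) = \<zero>\<^bsub>dg M\<^esub>" by (simp_all add: lker_def)
          then have "pullback (X 0) (d 0) \<chi> x = \<theta> \<zero>\<^bsub>dg M\<^esub>"
            using x(2)[of "pullback (X 0) (d 0) \<chi>"] by simp
          then show "\<chi> (d 0 x) = \<chi> \<zero>\<^bsub>X 1\<^esub>"
            using x(1) lmod_hom.zero[OF \<theta>h] dz[OF \<chi>] by (simp add: pullback_apply)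
        qed (rule d.closed[OF x(1)], rule d.N.M.zero_closed)
        then have "x \<in> f ` carrier M" unfolding ex using x(1) by (simp add: lker_def)
        then obtain m where m: "m \<in> carrier M" "x = f m" by blast
        have "eval_map A C M m = \<theta>"
        proof (rule eval_map_eqI[OF m(1) \<theta>])
          fix \<psi> assume "\<psi> \<in> lhom A M C"
          then obtain \<phi> where "\<phi> \<in> lhom A (X 0) C" "\<psi> = pullback M f \<phi>" using dual_lift by blast
          then show "\<theta> \<psi> = \<psi> m" using x(2) m by (simp add: pullback_apply)
        qed
        then show "\<theta> \<in> eval_map A C M ` carrier M" using m(1) by blast
      qed
    qed
  next
    assume surj: "eval_map A C M ` carrier M = carrier (ddagger A C (dg M))"
    show "f ` carrier M = lker (X 0) (X 1) (d 0)"
    proof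
      show "f ` carrier M \<subseteq> lker (X 0) (X 1) (d 0)"
        using complex_0[OF n1] f.closed by (auto simp: lker_def)
      show "lker (X 0) (X 1) (d 0) \<subseteq> f ` carrier M"
      proof
        fix x assume "x \<in> lker (X 0) (X 1) (d 0)"
        then have x: "x \<in> carrier (X 0)" "d 0 x = \<zero>\<^bsub>X 1\<^esub>" by (auto simp: lker_def)
        interpret ev: lmod_hom \<Gamma> "dg (X 0)" C\<Gamma> "\<lambda>\<phi>. \<phi> x"
          by (rule lmod_hom_eval[OF f.N.lmodule_axioms x(1)])
        \<comment> \<open>Evaluation at \<open>x\<close> vanishes on the kernel of \<open>f\<^sup>\<dagger>\<close> and so descends to \<open>M\<^sup>\<dagger>\<close>.\<close>
        have null: "\<phi> x = \<zero>\<^bsub>C\<^esub>" if \<phi>ker: "\<phi> \<in> lker (dg (X 0)) (dg M) (pullback M f)" for \<phi>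
        proof -
          obtain \<chi> where \<chi>: "\<chi> \<in> lhom A (X 1) C" "\<phi> = pullback (X 0) (d 0) \<chi>"
            using \<phi>ker unfolding dual_exact_0[OF n1, symmetric] by blast
          then show ?thesis using x dz[OF \<chi>(1)] by (simp add: pullback_apply)
        qed
        have wd: "\<phi> x = \<phi>' x" if e: "pullback M f \<phi> = pullback M f \<phi>'"
          and \<phi>: "\<phi> \<in> carrier (dg (X 0))" "\<phi>' \<in> carrier (dg (X 0))" for \<phi> \<phi>'
        proof -
          have "pullback M f (\<phi> \<ominus>\<^bsub>dg (X 0)\<^esub> \<phi>') = \<zero>\<^bsub>dg M\<^esub>"
            unfolding f'.diff[OF \<phi>] e
            unfolding a_minus_def by (rule f'.N.M.r_neg[OF f'.closed[OF \<phi>(2)]])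
          then have "\<phi> \<ominus>\<^bsub>dg (X 0)\<^esub> \<phi>' \<in> lker (dg (X 0)) (dg M) (pullback M f)"
            using \<phi> f'.M.M.minus_closed[OF \<phi>] by (simp add: lker_def)
          from null[OF this] have "\<phi> x \<ominus>\<^bsub>C\<Gamma>\<^esub> \<phi>' x = \<zero>\<^bsub>C\<Gamma>\<^esub>" using ev.diff[OF \<phi>] by simp
          then show ?thesis
            using ev.N.M.eq_of_diff_zero[OF ev.closed[OF \<phi>(1)] ev.closed[OF \<phi>(2)]] by blast
        qed
        \<comment> \<open>A preimage under the surjection \<open>f\<^sup>\<dagger>\<close>; by \<open>wd\<close> its choice does not matter.\<close>
        define pre where "pre \<psi> = (SOME \<phi>. \<phi> \<in> lhom A (X 0) C \<and> pullback M f \<phi> = \<psi>)" for \<psi>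
        have pre: "pre \<psi> \<in> lhom A (X 0) C \<and> pullback M f (pre \<psi>) = \<psi>" if "\<psi> \<in> lhom A M C" for \<psi>
        proof -
          have "\<exists>\<phi>. \<phi> \<in> lhom A (X 0) C \<and> pullback M f \<phi> = \<psi>" using dual_lift[OF that] by blast
          from someI_ex[OF this] show ?thesis unfolding pre_def .
        qed
        define \<theta> where "\<theta> = (\<lambda>\<psi>\<in>lhom A M C. pre \<psi> x)"
        have \<theta>_eq: "\<theta> (pullback M f \<phi>) = \<phi> x" if \<phi>: "\<phi> \<in> lhom A (X 0) C" for \<phi>
        proof -
          have m: "pullback M f \<phi> \<in> lhom A M C" using f'.closed \<phi> by simp
          show ?thesis using wd[of "pre (pullback M f \<phi>)" \<phi>] pre[OF m] \<phi> m by (simp add: \<theta>_def)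
        qed
        have "\<theta> \<in> lhom \<Gamma> (dg M) C\<Gamma>"
        proof -
          have "\<theta> \<in> carrier (dg M) \<rightarrow>\<^sub>E carrier C\<Gamma>" using lhomD(1)[OF conjunct1[OF pre] x(1)] by (auto simp: \<theta>_def)
          moreover have "\<theta> (\<psi> \<oplus>\<^bsub>dg M\<^esub> \<psi>') = \<theta> \<psi> \<oplus>\<^bsub>C\<Gamma>\<^esub> \<theta> \<psi>'"
            if \<psi>: "\<psi> \<in> carrier (dg M)" "\<psi>' \<in> carrier (dg M)" for \<psi> \<psi>'
          proof -
            have p: "pre \<psi> \<in> carrier (dg (X 0))" "pre \<psi>' \<in> carrier (dg (X 0))" using pre \<psi> by auto
            have "\<psi> \<oplus>\<^bsub>dg M\<^esub> \<psi>' = pullback M f (pre \<psi> \<oplus>\<^bsub>dg (X 0)\<^esub> pre \<psi>')"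
              using f'.add[OF p] pre \<psi> by simp
            then have "\<theta> (\<psi> \<oplus>\<^bsub>dg M\<^esub> \<psi>') = (pre \<psi> \<oplus>\<^bsub>dg (X 0)\<^esub> pre \<psi>') x"
              using \<theta>_eq f'.M.M.a_closed[OF p] by simp
            then show ?thesis using \<psi> x(1) by (simp add: \<theta>_def)
          qed
          moreover have "\<theta> (\<gamma> \<odot>\<^bsub>dg M\<^esub> \<psi>) = \<gamma> \<odot>\<^bsub>C\<Gamma>\<^esub> \<theta> \<psi>"
            if \<gamma>: "\<gamma> \<in> carrier \<Gamma>" and \<psi>: "\<psi> \<in> carrier (dg M)" for \<gamma> \<psi>
          proof -
            have p: "pre \<psi> \<in> carrier (dg (X 0))" using pre \<psi> by auto
            have "\<gamma> \<odot>\<^bsub>dg M\<^esub> \<psi> = pullback M f (\<gamma> \<odot>\<^bsub>dg (X 0)\<^esub> pre \<psi>)"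
              using f'.smult[OF \<gamma> p] pre \<psi> by simp
            then have "\<theta> (\<gamma> \<odot>\<^bsub>dg M\<^esub> \<psi>) = (\<gamma> \<odot>\<^bsub>dg (X 0)\<^esub> pre \<psi>) x"
              using \<theta>_eq f'.M.smult_closed[OF \<gamma> p] by simp
            then show ?thesis using \<psi> x(1) by (simp add: \<theta>_def)
          qed
          ultimately show ?thesis unfolding lhom_def[of \<Gamma>] by blast
        qed
        then have "\<theta> \<in> eval_map A C M ` carrier M" by (simp add: surj ddagger_carrier)
        then obtain m where m: "m \<in> carrier M" "\<theta> = eval_map A C M m" by blast
        have "x = f m"
        proof (rule X_separated[OF n x(1) f.closed[OF m(1)]])
          fix \<phi> assume \<phi>: "\<phi> \<in> lhom A (X 0) C"
          have "pullback M f \<phi> \<in> lhom A M C" using f'.closed \<phi> by simp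
          then show "\<phi> x = \<phi> (f m)"
            using \<theta>_eq[OF \<phi>] m by (simp add: eval_map_apply pullback_apply)
        qed
        then show "x \<in> f ` carrier M" using m(1) by blast
      qed
    qed
  qed
qed

text \<open>By reflexivity of the \<open>X k\<close>, applying \<open>Hom\<^sub>\<Gamma>(-,C)\<close> to the resolution of \<open>M\<^sup>\<dagger>\<close> gives back the
  complex of the \<open>X k\<close>.\<close>

lemma exact_at_X_Suc_iff:
  assumes k: "Suc (Suc k) < n"
  shows "d k ` carrier (X k) = lker (X (Suc k)) (X (Suc (Suc k))) (d (Suc k)) \<longleftrightarrow>
    trivial_group (Ext (Suc k) \<Gamma> (dg M) C\<Gamma>)"
proof -
  have k': "k < n" "Suc k < n" using k by simp_all
  let ?e = "\<lambda>k. pullback (X k) (d k)"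
  interpret d: lmod_hom A "X k" "X (Suc k)" "d k" by (rule d_hom[OF k'(2)])
  interpret d': lmod_hom A "X (Suc k)" "X (Suc (Suc k))" "d (Suc k)" by (rule d_hom[OF k])
  have zero: "\<chi> \<zero>\<^bsub>X (Suc (Suc k))\<^esub> = \<zero>\<^bsub>C\<^esub>" if "\<chi> \<in> lhom A (X (Suc (Suc k))) C" for \<chi>
    by (rule lmod_hom.zero[OF hom[OF d'.N.lmodule_axioms that]])
  obtain K \<pi> \<iota> where data: "\<And>l. l < n \<Longrightarrow> retract_data (X l) (K l) (\<pi> l) (\<iota> l)"
    using add_class_retract_data[OF X] by metis
  have "trivial_group (Ext (Suc k) \<Gamma> (dg M) C\<Gamma>) \<longleftrightarrow>
      cohomology_vanishes \<Gamma> (\<lambda>k. dg (X k)) ?e C\<Gamma> k"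
    by (rule trivial_Ext_iff[OF dual_resolution[OF k] retract_dual_basis[OF data]
          lmodule_dagger[OF M] lmodule_End_module]) (use k in simp)
  also have "\<dots> \<longleftrightarrow> d k ` carrier (X k) = lker (X (Suc k)) (X (Suc (Suc k))) (d (Suc k))"
  proof
    assume van: "cohomology_vanishes \<Gamma> (\<lambda>k. dg (X k)) ?e C\<Gamma> k"
    show "d k ` carrier (X k) = lker (X (Suc k)) (X (Suc (Suc k))) (d (Suc k))"
    proof
      show "d k ` carrier (X k) \<subseteq> lker (X (Suc k)) (X (Suc (Suc k))) (d (Suc k))"
        using complex_Suc[OF k] d.closed by (auto simp: lker_def)
      show "lker (X (Suc k)) (X (Suc (Suc k))) (d (Suc k)) \<subseteq> d k ` carrier (X k)"
      proof
        fix x assume "x \<in> lker (X (Suc k)) (X (Suc (Suc k))) (d (Suc k))"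
        then have x: "x \<in> carrier (X (Suc k))" "d (Suc k) x = \<zero>\<^bsub>X (Suc (Suc k))\<^esub>"
          by (auto simp: lker_def)
        have "\<forall>\<chi>\<in>carrier (dg (X (Suc (Suc k)))). ?e (Suc k) \<chi> x = \<zero>\<^bsub>C\<Gamma>\<^esub>"
          using x by (auto simp: pullback_apply intro: zero)
        with van lmod_hom_eval[OF d.N.lmodule_axioms x(1)]
        obtain \<psi> where \<psi>: "lmod_hom \<Gamma> (dg (X k)) C\<Gamma> \<psi>"
          "\<And>\<phi>. \<phi> \<in> lhom A (X (Suc k)) C \<Longrightarrow> \<phi> x = \<psi> (?e k \<phi>)"
          unfolding cohomology_vanishes_def dg_simps(1) by blast
        obtain y where y: "y \<in> carrier (X k)" "\<And>\<phi>. \<phi> \<in> lhom A (X k) C \<Longrightarrow> \<psi> \<phi> = \<phi> y"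
          using X_reflexive[OF k'(1) \<psi>(1)] by blast
        have "x = d k y"
        proof (rule X_separated[OF k'(2) x(1) d.closed[OF y(1)]])
          fix \<phi> assume \<phi>: "\<phi> \<in> lhom A (X (Suc k)) C"
          have "?e k \<phi> \<in> lhom A (X k) C"
            using lmod_hom.closed[OF lmod_hom_pullback[OF d.lmod_hom_axioms]] \<phi> by simp
          then show "\<phi> x = \<phi> (d k y)" using \<psi>(2)[OF \<phi>] y by (simp add: pullback_apply)
        qed
        then show "x \<in> d k ` carrier (X k)" using y(1) by blast
      qed
    qed
  next
    assume ex: "d k ` carrier (X k) = lker (X (Suc k)) (X (Suc (Suc k))) (d (Suc k))"
    show "cohomology_vanishes \<Gamma> (\<lambda>k. dg (X k)) ?e C\<Gamma> k"
      unfolding cohomology_vanishes_def dg_simps(1)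
    proof (intro allI impI)
      fix \<phi> assume \<phi>: "lmod_hom \<Gamma> (dg (X (Suc k))) C\<Gamma> \<phi>"
        and cocycle: "\<forall>\<chi>\<in>lhom A (X (Suc (Suc k))) C. \<phi> (?e (Suc k) \<chi>) = \<zero>\<^bsub>C\<Gamma>\<^esub>"
      obtain x where x: "x \<in> carrier (X (Suc k))" "\<And>\<chi>. \<chi> \<in> lhom A (X (Suc k)) C \<Longrightarrow> \<phi> \<chi> = \<chi> x"
        using X_reflexive[OF k'(2) \<phi>] by blast
      have "d (Suc k) x = \<zero>\<^bsub>X (Suc (Suc k))\<^esub>"
      proof (rule X_separated[OF k])
        fix \<chi> assume \<chi>: "\<chi> \<in> lhom A (X (Suc (Suc k))) C"
        have "?e (Suc k) \<chi> \<in> lhom A (X (Suc k)) C"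
          using lmod_hom.closed[OF lmod_hom_pullback[OF d'.lmod_hom_axioms]] \<chi> by simp
        then show "\<chi> (d (Suc k) x) = \<chi> \<zero>\<^bsub>X (Suc (Suc k))\<^esub>"
          using x(2)[of "?e (Suc k) \<chi>"] cocycle \<chi> zero[OF \<chi>] by (simp add: pullback_apply[OF x(1)])
      qed (rule d'.closed[OF x(1)], rule d'.N.M.zero_closed)
      then have "x \<in> d k ` carrier (X k)" unfolding ex using x(1) by (simp add: lker_def)
      then obtain y where y: "y \<in> carrier (X k)" "x = d k y" by blast
      have "\<phi> \<chi> = ?e k \<chi> y" if "\<chi> \<in> lhom A (X (Suc k)) C" for \<chi>
        using x(2)[OF that] y by (simp add: pullback_apply)
      then show "\<exists>\<psi>. lmod_hom \<Gamma> (dg (X k)) C\<Gamma> \<psi> \<and> (\<forall>\<chi>\<in>lhom A (X (Suc k)) C. \<phi> \<chi> = \<psi> (?e k \<chi>))"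
        using lmod_hom_eval[OF d.M.lmodule_axioms y(1)] by blast
    qed
  qed
  finally show ?thesis by blast
qed

text \<open>The right-hand side is the condition that defines \<open>TF_class A n C\<close>.\<close>

proposition exact_copresentation_iff:
  "exact_copresentation A n M X f d \<longleftrightarrow>
     (n = 1 \<longrightarrow> inj_on (eval_map A C M) (carrier M)) \<and>
     (n \<ge> 2 \<longrightarrow> bij_betw (eval_map A C M) (carrier M) (carrier (ddagger A C (dg M)))) \<and>
     (n \<ge> 3 \<longrightarrow> (\<forall>i\<in>{1..n - 2}. trivial_group (Ext i \<Gamma> (dg M) C\<Gamma>)))"
proof -
  let ?inj = "inj_on (eval_map A C M) (carrier M)"
  let ?surj = "eval_map A C M ` carrier M = carrier (ddagger A C (dg M))"
  let ?ext = "\<forall>k. Suc (Suc k) < n \<longrightarrow> trivial_group (Ext (Suc k) \<Gamma> (dg M) C\<Gamma>)"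
  have "exact_copresentation A n M X f d \<longleftrightarrow> ?inj \<and> (1 < n \<longrightarrow> ?surj) \<and> ?ext"
    unfolding exact_copresentation_def
    using f d exact_at_M_iff exact_at_X0_iff exact_at_X_Suc_iff by auto
  moreover have "?ext \<longleftrightarrow> (n \<ge> 3 \<longrightarrow> (\<forall>i\<in>{1..n - 2}. trivial_group (Ext i \<Gamma> (dg M) C\<Gamma>)))"
  proof -
    have "Suc (Suc k) < n \<longleftrightarrow> n \<ge> 3 \<and> Suc k \<in> {1..n - 2}" for k by auto
    moreover have "\<exists>k. i = Suc k" if "i \<in> {1..n - 2}" for i
      using that by (cases i) auto
    ultimately show ?thesis by metis
  qed
  ultimately show ?thesis using n by (auto simp: bij_betw_def)
qed

end

end

section \<open>Noetherian finiteness\<close>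

text \<open>Sets of vectors over \<open>R\<close> that are closed under linear combinations. A finite subset
  \<open>B\<close> generates such a set \<open>S\<close> if every closed set containing \<open>B\<close> contains \<open>S\<close>.\<close>

definition vector_closed :: "('r, 'x) ring_scheme \<Rightarrow> ('i \<Rightarrow> 'r) set \<Rightarrow> bool" where
  "vector_closed R S \<longleftrightarrow> (\<lambda>_. \<zero>\<^bsub>R\<^esub>) \<in> S \<and> (\<forall>s\<in>S. \<forall>t\<in>S. (\<lambda>i. s i \<oplus>\<^bsub>R\<^esub> t i) \<in> S) \<and>
     (\<forall>r\<in>carrier R. \<forall>s\<in>S. (\<lambda>i. r \<otimes>\<^bsub>R\<^esub> s i) \<in> S)"

lemma vector_closed_add: "\<lbrakk>vector_closed R S; s \<in> S; t \<in> S\<rbrakk> \<Longrightarrow> (\<lambda>i. s i \<oplus>\<^bsub>R\<^esub> t i) \<in> S"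
  and vector_closed_mult: "\<lbrakk>vector_closed R S; r \<in> carrier R; s \<in> S\<rbrakk> \<Longrightarrow> (\<lambda>i. r \<otimes>\<^bsub>R\<^esub> s i) \<in> S"
  and vector_closed_zero: "vector_closed R S \<Longrightarrow> (\<lambda>_. \<zero>\<^bsub>R\<^esub>) \<in> S"
  by (simp_all add: vector_closed_def)

lemma vector_closed_Int:
  "\<lbrakk>vector_closed R S; vector_closed R T\<rbrakk> \<Longrightarrow> vector_closed R (S \<inter> T)"
  by (simp add: vector_closed_def)

text \<open>Submodules of \<open>R\<^sup>I\<close>, for finite \<open>I\<close>, are finitely generated. The elements of \<open>R\<^sup>I\<close> are the
  functions that vanish outside \<open>I\<close>; the induction on \<open>I\<close> combines generators of the ideal of
  \<open>j\<close>-th coordinates with generators of the vectors whose \<open>j\<close>-th coordinate is zero.\<close>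

lemma noetherian_vectors:
  fixes R :: "('r, 'x) ring_scheme" (structure) and S :: "('i \<Rightarrow> 'r) set"
  assumes R: "cring R" "noetherian_ring R" and I: "finite I" and S: "vector_closed R S"
    and supp: "\<And>s i. s \<in> S \<Longrightarrow> s i \<in> carrier R" "\<And>s i. \<lbrakk>s \<in> S; i \<notin> I\<rbrakk> \<Longrightarrow> s i = \<zero>\<^bsub>R\<^esub>"
  shows "\<exists>B. finite B \<and> B \<subseteq> S \<and> (\<forall>T. vector_closed R T \<longrightarrow> B \<subseteq> T \<longrightarrow> S \<subseteq> T)"
  using I S supp
proof (induction I arbitrary: S rule: finite_induct)
  case empty
  have "S \<subseteq> {\<lambda>_. \<zero>\<^bsub>R\<^esub>}" using empty.prems(3) by (intro subsetI) (simp add: fun_eq_iff)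
  then have "S \<subseteq> T" if "vector_closed R T" for T using that unfolding vector_closed_def by blast
  then show ?case by (intro exI[of _ "{}"]) simp
next
  case (insert j I S)
  interpret cring R by fact
  interpret N: noetherian_ring R by fact
  have closed: "(\<lambda>_. \<zero>) \<in> S" "\<And>s t. \<lbrakk>s \<in> S; t \<in> S\<rbrakk> \<Longrightarrow> (\<lambda>i. s i \<oplus> t i) \<in> S"
    "\<And>r s. \<lbrakk>r \<in> carrier R; s \<in> S\<rbrakk> \<Longrightarrow> (\<lambda>i. r \<otimes> s i) \<in> S"
    using insert.prems(1) by (simp_all add: vector_closed_def)
  have coords: "ideal ((\<lambda>s. s j) ` T) R" if T: "vector_closed R T" "T \<subseteq> S" for T
  proof -
    have c: "t j \<in> carrier R" if "t \<in> T" for t using that T(2) insert.prems(2) by blast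
    have z: "\<zero> \<in> (\<lambda>s. s j) ` T" using vector_closed_zero[OF T(1)] by force
    have m: "r \<otimes> t j \<in> (\<lambda>s. s j) ` T" if "r \<in> carrier R" "t \<in> T" for r t
    proof -
      have "(\<lambda>i. r \<otimes> t i) \<in> T" by (rule vector_closed_mult[OF T(1) that])
      then show ?thesis by force
    qed
    have a: "s j \<oplus> t j \<in> (\<lambda>s. s j) ` T" if "s \<in> T" "t \<in> T" for s t
    proof -
      have "(\<lambda>i. s i \<oplus> t i) \<in> T" by (rule vector_closed_add[OF T(1) that])
      then show ?thesis by force
    qed
    have n: "\<ominus> t j \<in> (\<lambda>s. s j) ` T" if "t \<in> T" for t
      using m[of "\<ominus> \<one>" t] c[OF that] that by (simp add: l_minus)
    show ?thesis
    proof (rule idealI)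
      show "ring R" by unfold_locales
      show "subgroup ((\<lambda>s. s j) ` T) (add_monoid R)"
      proof (rule subgroup.intro)
        show "(\<lambda>s. s j) ` T \<subseteq> carrier (add_monoid R)" using c by (simp add: image_subset_iff)
        show "\<one>\<^bsub>add_monoid R\<^esub> \<in> (\<lambda>s. s j) ` T" using z by simp
        show "x \<otimes>\<^bsub>add_monoid R\<^esub> y \<in> (\<lambda>s. s j) ` T" if "x \<in> (\<lambda>s. s j) ` T" "y \<in> (\<lambda>s. s j) ` T" for x y
          using that a by (elim imageE) simp
        show "inv\<^bsub>add_monoid R\<^esub> x \<in> (\<lambda>s. s j) ` T" if "x \<in> (\<lambda>s. s j) ` T" for x
          using that n by (elim imageE) (simp add: a_inv_def[symmetric])
      qed
      show "x \<otimes> a \<in> (\<lambda>s. s j) ` T" if "a \<in> (\<lambda>s. s j) ` T" "x \<in> carrier R" for a x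
        using that m by (elim imageE) simp
      show "a \<otimes> x \<in> (\<lambda>s. s j) ` T" if a: "a \<in> (\<lambda>s. s j) ` T" and x: "x \<in> carrier R" for a x
      proof -
        obtain t where "t \<in> T" "a = t j" using a by blast
        then show ?thesis using m[of x t] x c[of t] by (simp add: m_comm)
      qed
    qed
  qed
  obtain B0 where B0: "B0 \<subseteq> carrier R" "finite B0" "(\<lambda>s. s j) ` S = Idl B0"
    using N.finetely_gen[OF coords[OF insert.prems(1) order_refl]] by (elim exE conjE)
  have "B0 \<subseteq> (\<lambda>s. s j) ` S" unfolding B0(3) using genideal_self[OF B0(1)] .
  from finite_subset_image[OF B0(2) this] obtain B1 where
    B1: "finite B1" "B1 \<subseteq> S" "B0 = (\<lambda>s. s j) ` B1" by (elim exE conjE)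
  define S' where "S' = {s \<in> S. s j = \<zero>}"
  have "vector_closed R S'"
    unfolding vector_closed_def
  proof (intro conjI ballI)
    show "(\<lambda>_. \<zero>) \<in> S'" using closed(1) by (simp add: S'_def)
    show "(\<lambda>i. s i \<oplus> t i) \<in> S'" if "s \<in> S'" "t \<in> S'" for s t
      using closed(2)[of s t] that by (simp add: S'_def)
    show "(\<lambda>i. r \<otimes> s i) \<in> S'" if "r \<in> carrier R" "s \<in> S'" for r s
      using closed(3)[of r s] that by (simp add: S'_def)
  qed
  moreover have "s i \<in> carrier R" if "s \<in> S'" for s i
    by (rule insert.prems(2)) (use that in \<open>simp add: S'_def\<close>)
  moreover have "s i = \<zero>" if "s \<in> S'" "i \<notin> I" for s i
    using that insert.prems(3)[of s i] by (cases "i = j") (simp_all add: S'_def)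
  ultimately have "\<exists>B. finite B \<and> B \<subseteq> S' \<and> (\<forall>T. vector_closed R T \<longrightarrow> B \<subseteq> T \<longrightarrow> S' \<subseteq> T)"
    by (rule insert.IH)
  then obtain B2 where B2: "finite B2" "B2 \<subseteq> S'"
    "\<And>T. \<lbrakk>vector_closed R T; B2 \<subseteq> T\<rbrakk> \<Longrightarrow> S' \<subseteq> T" by blast
  have "S \<subseteq> T" if T: "vector_closed R T" "B1 \<union> B2 \<subseteq> T" for T
  proof
    fix s assume s: "s \<in> S"
    have TS: "vector_closed R (T \<inter> S)" using T(1) insert.prems(1) by (rule vector_closed_Int)
    have "B0 \<subseteq> (\<lambda>s. s j) ` (T \<inter> S)" using B1 T(2) by auto
    then have "Idl B0 \<subseteq> (\<lambda>s. s j) ` (T \<inter> S)" by (intro genideal_minimal coords TS) auto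
    then have "s j \<in> (\<lambda>s. s j) ` (T \<inter> S)" using B0(3) s by blast
    then obtain t where t: "t \<in> T" "t \<in> S" "s j = t j" by blast
    \<comment> \<open>Subtracting \<open>t\<close> clears the \<open>j\<close>-th coordinate of \<open>s\<close>.\<close>
    define u where "u = (\<lambda>i. s i \<oplus> \<ominus> \<one> \<otimes> t i)"
    have "u \<in> S" unfolding u_def by (rule closed(2)[OF s closed(3)[OF _ t(2)]]) simp
    moreover have "u j = \<zero>" using insert.prems(2)[OF t(2)] t(3) by (simp add: u_def l_minus r_neg)
    ultimately have "u \<in> S'" by (simp add: S'_def)
    then have "u \<in> T" using B2(3)[OF T(1)] T(2) by auto
    then have "(\<lambda>i. t i \<oplus> u i) \<in> T" by (rule vector_closed_add[OF T(1) t(1)])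
    moreover have "(\<lambda>i. t i \<oplus> u i) = s"
    proof
      show "t i \<oplus> u i = s i" for i
        using insert.prems(2)[OF t(2), of i] insert.prems(2)[OF s, of i]
        by (simp add: u_def l_minus a_lcomm r_neg)
    qed
    ultimately show "s \<in> T" by simp
  qed
  moreover have "finite (B1 \<union> B2)" "B1 \<union> B2 \<subseteq> S" using B1 B2 by (auto simp: S'_def)
  ultimately show ?case by blast
qed

text \<open>A duality together with an action of a Noetherian ring \<open>R\<close> on \<open>C\<close> by \<open>A\<close>-endomorphisms, such
  that \<open>C\<close> is finitely generated over \<open>R\<close>.\<close>

locale noetherian_duality = duality A C
  for A :: "('a, 'x) ring_scheme" and C :: "('a, 'c) module" +
  fixes R :: "('r, 'y) ring_scheme" and act :: "'r \<Rightarrow> 'c \<Rightarrow> 'c" and E :: "'c set"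
  assumes cring: "cring R" and noetherian: "noetherian_ring R"
    and act_hom: "r \<in> carrier R \<Longrightarrow> lmod_hom A C C (act r)"
    and act_add: "\<lbrakk>r \<in> carrier R; s \<in> carrier R; c \<in> carrier C\<rbrakk> \<Longrightarrow> act (r \<oplus>\<^bsub>R\<^esub> s) c = act r c \<oplus>\<^bsub>C\<^esub> act s c"
    and act_mult: "\<lbrakk>r \<in> carrier R; s \<in> carrier R; c \<in> carrier C\<rbrakk> \<Longrightarrow> act (r \<otimes>\<^bsub>R\<^esub> s) c = act r (act s c)"
    and E: "finite E" "E \<subseteq> carrier C"
    and E_gen: "c \<in> carrier C \<Longrightarrow> \<exists>t\<in>E \<rightarrow> carrier R. c = (\<Oplus>\<^bsub>C\<^esub>e\<in>E. act (t e) e)"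

text \<open>Finite subsets that determine the homomorphisms to \<open>C\<close>.\<close>

definition (in duality) determining :: "('a, 'm) module \<Rightarrow> 'm set \<Rightarrow> bool" where
  "determining W G \<longleftrightarrow> finite G \<and> G \<subseteq> carrier W \<and>
     (\<forall>\<phi>\<in>lhom A W C. \<forall>\<psi>\<in>lhom A W C. (\<forall>g\<in>G. \<phi> g = \<psi> g) \<longrightarrow> \<phi> = \<psi>)"

text \<open>The \<open>\<Gamma>\<close>-submodules of \<open>W\<^sup>\<dagger>\<close>, as subsets. Closure under negation follows from the action of
  \<open>\<Gamma>\<close>. Generation by a subset \<open>B\<close> of such a set \<open>K\<close> is expressed, without linear combinations, by the
  condition that every closed set containing \<open>B\<close> contains \<open>K\<close>.\<close>

definition (in duality) dual_closed :: "('a, 'm) module \<Rightarrow> ('m \<Rightarrow> 'c) set \<Rightarrow> bool" where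
  "dual_closed W T \<longleftrightarrow> \<zero>\<^bsub>dg W\<^esub> \<in> T \<and> (\<forall>\<phi>\<in>T. \<forall>\<psi>\<in>T. \<phi> \<oplus>\<^bsub>dg W\<^esub> \<psi> \<in> T) \<and>
     (\<forall>\<gamma>\<in>lhom A C C. \<forall>\<phi>\<in>T. \<gamma> \<odot>\<^bsub>dg W\<^esub> \<phi> \<in> T)"

lemma (in duality) determining_if_fg:
  assumes "M \<in> fg_modules A"
  shows "\<exists>G. determining M G"
proof -
  have M: "lmodule A M" using assms by (simp add: fg_modules_def)
  obtain G where G: "finite G" "G \<subseteq> carrier M"
    "carrier M = {(\<Oplus>\<^bsub>M\<^esub>g\<in>G. c g \<odot>\<^bsub>M\<^esub> g) | c. c \<in> G \<rightarrow> carrier A}"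
    using assms by (auto simp: fg_modules_def finitely_generated_def)
  interpret M: lmodule A M by fact
  have "\<phi> = \<psi>" if \<phi>: "\<phi> \<in> lhom A M C" and \<psi>: "\<psi> \<in> lhom A M C" and eq: "\<forall>g\<in>G. \<phi> g = \<psi> g" for \<phi> \<psi>
  proof (rule lhom_ext[OF \<phi> \<psi>])
    interpret \<phi>: lmod_hom A M C \<phi> by (rule hom[OF M \<phi>])
    interpret \<psi>: lmod_hom A M C \<psi> by (rule hom[OF M \<psi>])
    fix x assume "x \<in> carrier M"
    then obtain c where c: "c \<in> G \<rightarrow> carrier A" "x = (\<Oplus>\<^bsub>M\<^esub>g\<in>G. c g \<odot>\<^bsub>M\<^esub> g)"
      using G(3) by blast
    have m: "c g \<in> carrier A" "g \<in> carrier M" if "g \<in> G" for g using that c(1) G(2) by auto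
    have "\<phi> x = (\<Oplus>\<^bsub>C\<^esub>g\<in>G. \<phi> (c g \<odot>\<^bsub>M\<^esub> g))"
      unfolding c(2) by (rule \<phi>.finsum[OF G(1)]) (use m in auto)
    also have "\<dots> = (\<Oplus>\<^bsub>C\<^esub>g\<in>G. \<psi> (c g \<odot>\<^bsub>M\<^esub> g))"
      by (rule C.M.finsum_cong') (use m eq \<psi>.closed in \<open>auto simp: \<phi>.smult \<psi>.smult\<close>)
    also have "\<dots> = \<psi> x"
      unfolding c(2) by (rule \<psi>.finsum[OF G(1), symmetric]) (use m in auto)
    finally show "\<phi> x = \<psi> x" .
  qed
  then show ?thesis using G by (auto simp: determining_def)
qed

lemma (in duality) determining_retract:
  assumes data: "retract_data X k \<pi> \<iota>" and G: "determining C G"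
  shows "determining X (\<Union>j<k. \<iota> j ` G)"
  unfolding determining_def
proof (intro conjI ballI impI)
  have Gc: "finite G" "G \<subseteq> carrier C" using G by (auto simp: determining_def)
  show "finite (\<Union>j<k. \<iota> j ` G)" using Gc by simp
  show "(\<Union>j<k. \<iota> j ` G) \<subseteq> carrier X"
    using Gc lmod_hom.closed[OF retract_iota[OF data]] by blast
  fix \<phi> \<psi> assume \<phi>: "\<phi> \<in> lhom A X C" and \<psi>: "\<psi> \<in> lhom A X C"
    and eq: "\<forall>g\<in>\<Union>j<k. \<iota> j ` G. \<phi> g = \<psi> g"
  interpret D: lmodule \<Gamma> "dg X" by (rule lmodule_dagger[OF retract_lmodule[OF data]])
  have comp: "component (\<iota> j) \<phi> = component (\<iota> j) \<psi>" if j: "j < k" for j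
  proof -
    have "\<forall>g\<in>G. component (\<iota> j) \<phi> g = component (\<iota> j) \<psi> g"
      using eq j Gc(2) by (auto simp: component_def)
    then show ?thesis
      using G component_in_End[OF data j \<phi>] component_in_End[OF data j \<psi>]
      unfolding determining_def by blast
  qed
  have m: "component (\<iota> j) \<psi> \<in> carrier \<Gamma>" "\<pi> j \<in> carrier (dg X)" if "j < k" for j
    using component_in_End[OF data that \<psi>] retract_pi[OF data that] by simp_all
  have "\<phi> = (\<Oplus>\<^bsub>dg X\<^esub>j\<in>{..<k}. component (\<iota> j) \<phi> \<odot>\<^bsub>dg X\<^esub> \<pi> j)"
    by (rule retract_form_expand[OF data \<phi>])
  also have "\<dots> = (\<Oplus>\<^bsub>dg X\<^esub>j\<in>{..<k}. component (\<iota> j) \<psi> \<odot>\<^bsub>dg X\<^esub> \<pi> j)"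
  proof (rule D.M.finsum_cong')
    show "(\<lambda>j. component (\<iota> j) \<psi> \<odot>\<^bsub>dg X\<^esub> \<pi> j) \<in> {..<k} \<rightarrow> carrier (dg X)"
      using D.smult_closed[OF m] by blast
  qed (use comp in auto)
  also have "\<dots> = \<psi>" by (rule retract_form_expand[OF data \<psi>, symmetric])
  finally show "\<phi> = \<psi>" .
qed

lemma (in duality) dirsum_retract_data:
  "retract_data (dirsum C {..<k}) k (\<lambda>j. \<lambda>x\<in>carrier (dirsum C {..<k}). x j) (single C {..<k})"
  unfolding retract_data_def
proof (intro conjI allI impI ballI)
  show "lmodule A (dirsum C {..<k})" by (rule lmodule_dirsum[OF C.lmodule_axioms])
  show "(\<lambda>x\<in>carrier (dirsum C {..<k}). x j) \<in> lhom A (dirsum C {..<k}) C" if "j < k" for j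
    by (rule lmod_hom.restrict_in_lhom[OF lmod_hom_coord[OF C.lmodule_axioms]]) (use that in simp)
  show "lmod_hom A C (dirsum C {..<k}) (single C {..<k} j)" if "j < k" for j
    by (rule lmod_hom_single[OF C.lmodule_axioms]) (use that in simp)
  fix x assume x: "x \<in> carrier (dirsum C {..<k})"
  show "x = (\<Oplus>\<^bsub>dirsum C {..<k}\<^esub>j\<in>{..<k}.
      single C {..<k} j ((\<lambda>x\<in>carrier (dirsum C {..<k}). x j) x))"
    unfolding restrict_apply'[OF x] by (rule dirsum_expand[OF C.lmodule_axioms x]) auto
qed

lemma (in duality) dual_closed_lker:
  assumes "lmod_hom A W X g"
  shows "dual_closed X (lker (dg X) (dg W) (pullback W g))"
proof -
  interpret p: lmod_hom \<Gamma> "dg X" "dg W" "pullback W g" by (rule lmod_hom_pullback[OF assms])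
  show ?thesis
    unfolding dual_closed_def
  proof (intro conjI ballI)
    show "\<zero>\<^bsub>dg X\<^esub> \<in> lker (dg X) (dg W) (pullback W g)"
      using p.zero p.M.M.zero_closed unfolding lker_def by blast
    show "\<phi> \<oplus>\<^bsub>dg X\<^esub> \<psi> \<in> lker (dg X) (dg W) (pullback W g)"
      if "\<phi> \<in> lker (dg X) (dg W) (pullback W g)" "\<psi> \<in> lker (dg X) (dg W) (pullback W g)" for \<phi> \<psi>
    proof -
      have m: "\<phi> \<in> carrier (dg X)" "\<psi> \<in> carrier (dg X)" "pullback W g \<phi> = \<zero>\<^bsub>dg W\<^esub>"
        "pullback W g \<psi> = \<zero>\<^bsub>dg W\<^esub>"
        using that by (auto simp: lker_def simp del: dg_simps)
      then have "pullback W g (\<phi> \<oplus>\<^bsub>dg X\<^esub> \<psi>) = \<zero>\<^bsub>dg W\<^esub>"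
        using p.add[OF m(1,2)] by (simp del: dg_simps)
      then show ?thesis using p.M.M.a_closed[OF m(1,2)] unfolding lker_def by blast
    qed
    show "\<gamma> \<odot>\<^bsub>dg X\<^esub> \<phi> \<in> lker (dg X) (dg W) (pullback W g)"
      if \<gamma>: "\<gamma> \<in> lhom A C C" and \<phi>: "\<phi> \<in> lker (dg X) (dg W) (pullback W g)" for \<gamma> \<phi>
    proof -
      have m: "\<gamma> \<in> carrier \<Gamma>" "\<phi> \<in> carrier (dg X)" "pullback W g \<phi> = \<zero>\<^bsub>dg W\<^esub>"
        using \<gamma> \<phi> by (auto simp: lker_def simp del: dg_simps)
      then have "pullback W g (\<gamma> \<odot>\<^bsub>dg X\<^esub> \<phi>) = \<zero>\<^bsub>dg W\<^esub>"
        using p.smult[OF m(1,2)] p.N.smult_r_null[OF m(1)] by (simp del: dg_simps)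
      then show ?thesis using p.M.smult_closed[OF m(1,2)] unfolding lker_def by blast
    qed
  qed
qed

context noetherian_duality begin

interpretation R: cring R by (rule cring)

text \<open>\<open>\<Gamma>\<close>-submodules of \<open>W\<^sup>\<dagger>\<close> are finitely generated: through its values on a determining set \<open>G\<close>,
  written in terms of the generators \<open>E\<close> of \<open>C\<close>, such a submodule is a subquotient of
  \<open>R\<^sup>G\<^sup>\<times>\<^sup>E\<close>.\<close>

lemma dual_finitely_generated:
  assumes W: "lmodule A W" and G: "determining W G"
    and K: "dual_closed W K" "K \<subseteq> lhom A W C"
  shows "\<exists>B. finite B \<and> B \<subseteq> K \<and> (\<forall>T. dual_closed W T \<longrightarrow> B \<subseteq> T \<longrightarrow> K \<subseteq> T)"
proof -
  have Gc: "finite G" "G \<subseteq> carrier W" using G by (auto simp: determining_def)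
  \<comment> \<open>\<open>rep L\<close> is the set of coefficient vectors \<open>s\<close> in \<open>R\<^sup>G\<^sup>\<times>\<^sup>E\<close> that represent the values on \<open>G\<close> of
    some \<open>\<phi>\<close> in \<open>L\<close>.\<close>
  define comb where "comb s g = (\<Oplus>\<^bsub>C\<^esub>e\<in>E. act (s (g, e)) e)" for s :: "'b \<times> 'c \<Rightarrow> 'r" and g
  define rep where "rep L = {s. (\<forall>i. s i \<in> carrier R) \<and> (\<forall>i. i \<notin> G \<times> E \<longrightarrow> s i = \<zero>\<^bsub>R\<^esub>) \<and>
    (\<exists>\<phi>\<in>L. \<forall>g\<in>G. \<phi> g = comb s g)}" for L :: "('b \<Rightarrow> 'c) set"
  have rep_iff: "s \<in> rep L \<longleftrightarrow> (\<forall>i. s i \<in> carrier R) \<and> (\<forall>i. i \<notin> G \<times> E \<longrightarrow> s i = \<zero>\<^bsub>R\<^esub>) \<and>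
    (\<exists>\<phi>\<in>L. \<forall>g\<in>G. \<phi> g = comb s g)" for s L unfolding rep_def by (rule mem_Collect_eq)
  have repD: "s i \<in> carrier R" "i \<notin> G \<times> E \<Longrightarrow> s i = \<zero>\<^bsub>R\<^esub>" "\<exists>\<phi>\<in>L. \<forall>g\<in>G. \<phi> g = comb s g"
    if "s \<in> rep L" for s L i
    using that[unfolded rep_iff, THEN conjunct1] that[unfolded rep_iff, THEN conjunct2, THEN conjunct1]
      that[unfolded rep_iff, THEN conjunct2, THEN conjunct2]
    by (iprover+)
  have repI: "s \<in> rep L" if a: "\<And>i. s i \<in> carrier R" and b: "\<And>i. i \<notin> G \<times> E \<Longrightarrow> s i = \<zero>\<^bsub>R\<^esub>"
    and c: "\<phi> \<in> L" and e: "\<And>g. g \<in> G \<Longrightarrow> \<phi> g = comb s g" for s L \<phi>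
  proof -
    have "\<exists>\<phi>\<in>L. \<forall>g\<in>G. \<phi> g = comb s g" using c by (rule bexI[rotated]) (rule ballI, rule e)
    then show ?thesis unfolding rep_iff using a b by simp
  qed
  have ae: "act r e \<in> carrier C" if "r \<in> carrier R" "e \<in> carrier C" for r e
    using lmod_hom.closed[OF act_hom[OF that(1)] that(2)] .
  have comb_add: "comb (\<lambda>i. s i \<oplus>\<^bsub>R\<^esub> t i) g = comb s g \<oplus>\<^bsub>C\<^esub> comb t g"
    if "\<And>i. s i \<in> carrier R" "\<And>i. t i \<in> carrier R" for s t g
  proof -
    have "comb (\<lambda>i. s i \<oplus>\<^bsub>R\<^esub> t i) g = (\<Oplus>\<^bsub>C\<^esub>e\<in>E. act (s (g, e)) e \<oplus>\<^bsub>C\<^esub> act (t (g, e)) e)"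
      unfolding comb_def by (rule C.M.finsum_cong') (use E that ae act_add in \<open>auto simp: subset_iff\<close>)
    also have "\<dots> = comb s g \<oplus>\<^bsub>C\<^esub> comb t g"
      unfolding comb_def by (rule C.M.finsum_addf) (use E that ae in auto)
    finally show ?thesis .
  qed
  have comb_mult: "comb (\<lambda>i. r \<otimes>\<^bsub>R\<^esub> s i) g = act r (comb s g)"
    if r: "r \<in> carrier R" and s: "\<And>i. s i \<in> carrier R" for r s g
  proof -
    have "comb (\<lambda>i. r \<otimes>\<^bsub>R\<^esub> s i) g = (\<Oplus>\<^bsub>C\<^esub>e\<in>E. act r (act (s (g, e)) e))"
      unfolding comb_def
      by (rule C.M.finsum_cong') (use E r s ae act_mult in \<open>auto simp: subset_iff\<close>)
    also have "\<dots> = act r (comb s g)"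
      unfolding comb_def
      by (rule lmod_hom.finsum[OF act_hom[OF r], symmetric]) (use E s ae in auto)
    finally show ?thesis .
  qed
  have comb_zero: "comb (\<lambda>_. \<zero>\<^bsub>R\<^esub>) g = \<zero>\<^bsub>C\<^esub>" for g
  proof -
    have "comb (\<lambda>_. \<zero>\<^bsub>R\<^esub>) g \<in> carrier C"
      unfolding comb_def by (rule C.M.finsum_closed) (use E ae in auto)
    then show ?thesis using comb_add[of "\<lambda>_. \<zero>\<^bsub>R\<^esub>" "\<lambda>_. \<zero>\<^bsub>R\<^esub>" g] by simp
  qed
  have rep_closed: "vector_closed R (rep L)" if L: "dual_closed W L" "L \<subseteq> lhom A W C" for L
    unfolding vector_closed_def
  proof (intro conjI ballI)
    have "\<zero>\<^bsub>dg W\<^esub> \<in> L" using L by (simp add: dual_closed_def)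
    then show "(\<lambda>_. \<zero>\<^bsub>R\<^esub>) \<in> rep L"
      by (rule repI[rotated 2]) (use Gc(2) in \<open>auto simp: comb_zero\<close>)
    show "(\<lambda>i. s i \<oplus>\<^bsub>R\<^esub> t i) \<in> rep L" if st: "s \<in> rep L" "t \<in> rep L" for s t
    proof -
      obtain \<phi> \<psi> where \<phi>: "\<phi> \<in> L" "\<forall>g\<in>G. \<phi> g = comb s g" and \<psi>: "\<psi> \<in> L" "\<forall>g\<in>G. \<psi> g = comb t g"
        using repD(3)[OF st(1)] repD(3)[OF st(2)] by (elim bexE)
      note c = repD(1)[OF st(1)] repD(1)[OF st(2)]
      have "\<phi> \<oplus>\<^bsub>dg W\<^esub> \<psi> \<in> L" using L \<phi> \<psi> unfolding dual_closed_def by blast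
      moreover have "(\<phi> \<oplus>\<^bsub>dg W\<^esub> \<psi>) g = comb (\<lambda>i. s i \<oplus>\<^bsub>R\<^esub> t i) g" if "g \<in> G" for g
        using that Gc(2) \<phi>(2) \<psi>(2) by (simp add: comb_add[OF c] subset_iff)
      ultimately show ?thesis
        by (rule repI[rotated 2]) (simp_all add: c repD(2)[OF st(1)] repD(2)[OF st(2)] del: dg_simps)
    qed
    show "(\<lambda>i. r \<otimes>\<^bsub>R\<^esub> s i) \<in> rep L" if r: "r \<in> carrier R" and s: "s \<in> rep L" for r s
    proof -
      obtain \<phi> where \<phi>: "\<phi> \<in> L" "\<forall>g\<in>G. \<phi> g = comb s g" using repD(3)[OF s] by (elim bexE)
      note c = repD(1)[OF s]
      let ?\<gamma> = "restrict (act r) (carrier C)"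
      have "?\<gamma> \<odot>\<^bsub>dg W\<^esub> \<phi> \<in> L"
        using L \<phi>(1) lmod_hom.restrict_in_lhom[OF act_hom[OF r]] unfolding dual_closed_def by blast
      moreover have "(?\<gamma> \<odot>\<^bsub>dg W\<^esub> \<phi>) g = comb (\<lambda>i. r \<otimes>\<^bsub>R\<^esub> s i) g" if g: "g \<in> G" for g
      proof -
        have "\<phi> g \<in> carrier C" using g Gc(2) \<phi>(1) L(2) by (intro lhomD(1)[of _ W]) auto
        then show ?thesis
          using g Gc(2) \<phi>(2) by (auto simp: comb_mult[OF r c])
      qed
      ultimately show ?thesis
        by (rule repI[rotated 2]) (simp_all add: r c repD(2)[OF s] del: dg_simps)
    qed
  qed
  have "\<exists>B. finite B \<and> B \<subseteq> rep K \<and> (\<forall>T. vector_closed R T \<longrightarrow> B \<subseteq> T \<longrightarrow> rep K \<subseteq> T)"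
    by (rule noetherian_vectors[OF cring noetherian finite_cartesian_product[OF Gc(1) E(1)]
          rep_closed[OF K]]) (rule repD, assumption+)+
  then obtain B where B: "finite B" "B \<subseteq> rep K"
    "\<And>T. \<lbrakk>vector_closed R T; B \<subseteq> T\<rbrakk> \<Longrightarrow> rep K \<subseteq> T" by blast
  have "\<forall>b\<in>B. \<exists>\<phi>. \<phi> \<in> K \<and> (\<forall>g\<in>G. \<phi> g = comb b g)"
    using repD(3)[OF subsetD[OF B(2)]] by (simp add: Bex_def)
  from bchoice[OF this] obtain \<beta> where \<beta>: "\<And>b. b \<in> B \<Longrightarrow> \<beta> b \<in> K"
    "\<And>b g. \<lbrakk>b \<in> B; g \<in> G\<rbrakk> \<Longrightarrow> \<beta> b g = comb b g" by blast
  have "K \<subseteq> T" if T: "dual_closed W T" "\<beta> ` B \<subseteq> T" for T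
  proof
    fix \<phi> assume \<phi>: "\<phi> \<in> K"
    have TK: "dual_closed W (T \<inter> K)" using T(1) K(1) by (simp add: dual_closed_def)
    have "B \<subseteq> rep (T \<inter> K)"
    proof
      fix b assume b: "b \<in> B"
      then have "\<beta> b \<in> T \<inter> K" using \<beta>(1) T(2) by blast
      have "b \<in> rep K" using b B(2) by blast
      note rb = repD(1,2)[OF this]
      show "b \<in> rep (T \<inter> K)" by (rule repI[OF rb \<open>\<beta> b \<in> T \<inter> K\<close> \<beta>(2)[OF b]])
    qed
    moreover have "T \<inter> K \<subseteq> lhom A W C" using K(2) by blast
    ultimately have sub: "rep K \<subseteq> rep (T \<inter> K)" using B(3) rep_closed[OF TK] by blast
    have "\<forall>g\<in>G. \<exists>t\<in>E \<rightarrow> carrier R. \<phi> g = (\<Oplus>\<^bsub>C\<^esub>e\<in>E. act (t e) e)"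
    proof
      fix g assume "g \<in> G"
      then have "\<phi> g \<in> carrier C" using Gc(2) \<phi> K(2) by (intro lhomD(1)[of _ W]) auto
      then show "\<exists>t\<in>E \<rightarrow> carrier R. \<phi> g = (\<Oplus>\<^bsub>C\<^esub>e\<in>E. act (t e) e)" by (rule E_gen)
    qed
    from bchoice[OF this[unfolded Bex_def]] obtain t where
      t: "\<And>g. g \<in> G \<Longrightarrow> t g \<in> E \<rightarrow> carrier R" "\<And>g. g \<in> G \<Longrightarrow> \<phi> g = (\<Oplus>\<^bsub>C\<^esub>e\<in>E. act (t g e) e)"
      by blast
    define s where "s = (\<lambda>(g, e). if g \<in> G \<and> e \<in> E then t g e else \<zero>\<^bsub>R\<^esub>)"
    have sc: "\<phi> g = comb s g" if g: "g \<in> G" for g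
      unfolding comb_def t(2)[OF g]
      by (rule C.M.finsum_cong') (use g t(1)[OF g] E ae in \<open>auto simp: s_def Pi_iff subset_iff\<close>)
    have "s i \<in> carrier R" for i using t(1) by (cases i) (auto simp: s_def)
    moreover have "s i = \<zero>\<^bsub>R\<^esub>" if "i \<notin> G \<times> E" for i using that by (cases i) (auto simp: s_def)
    ultimately have "s \<in> rep K" using \<phi> sc by (rule repI)
    with sub have "s \<in> rep (T \<inter> K)" by (rule subsetD)
    from repD(3)[OF this] obtain \<psi> where \<psi>: "\<psi> \<in> T \<inter> K" "\<forall>g\<in>G. \<psi> g = comb s g" by (elim bexE)
    have "\<phi> = \<psi>"
    proof -
      have "\<phi> \<in> lhom A W C" "\<psi> \<in> lhom A W C" "\<forall>g\<in>G. \<phi> g = \<psi> g" using \<phi> \<psi> K(2) sc by auto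
      then show ?thesis using G unfolding determining_def by blast
    qed
    then show "\<phi> \<in> T" using \<psi>(1) by blast
  qed
  moreover have "finite (\<beta> ` B)" "\<beta> ` B \<subseteq> K" using B(1) \<beta>(1) by auto
  ultimately show ?thesis by blast
qed

text \<open>Every \<open>\<Gamma>\<close>-submodule \<open>K\<close> of \<open>W\<^sup>\<dagger>\<close> is the image of \<open>g\<^sup>\<dagger>\<close> for some \<open>g : W \<rightarrow> C\<^sup>r\<close>; the components of \<open>g\<close>
  are generators of \<open>K\<close>. For \<open>K = W\<^sup>\<dagger>\<close> this is a left \<open>add C\<close>-approximation of \<open>W\<close>.\<close>

lemma approximation_exists:
  assumes W: "lmodule A W" and G: "determining W G"
    and K: "dual_closed W K" "K \<subseteq> lhom A W C"
  shows "\<exists>(r::nat) g. g \<in> lhom A W (dirsum C {..<r}) \<and>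
    pullback W g ` lhom A (dirsum C {..<r}) C = K"
proof -
  obtain B where B: "finite B" "B \<subseteq> K" "\<And>T. \<lbrakk>dual_closed W T; B \<subseteq> T\<rbrakk> \<Longrightarrow> K \<subseteq> T"
    using dual_finitely_generated[OF assms] by blast
  obtain r :: nat and \<beta> where \<beta>: "B = \<beta> ` {..<r}"
    using finite_imp_nat_seg_image_inj_on[OF B(1)] unfolding lessThan_def by blast
  let ?D = "dirsum C {..<r}"
  interpret W: lmodule A W by fact
  interpret D: lmodule A ?D by (rule lmodule_dirsum[OF C.lmodule_axioms])
  have \<beta>K: "\<beta> j \<in> K" "\<beta> j \<in> lhom A W C" if "j < r" for j using that B(2) K(2) \<beta> by auto
  define g where "g = (\<lambda>w\<in>carrier W. \<lambda>j\<in>{..<r}. \<beta> j w)"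
  have \<beta>h: "lmod_hom A W C (\<beta> j)" if "j < r" for j by (rule hom[OF W \<beta>K(2)[OF that]])
  have g: "g \<in> lhom A W ?D"
  proof -
    have "lmod_hom A W ?D (\<lambda>w. \<lambda>j\<in>{..<r}. \<beta> j w)"
      by unfold_locales
        (auto simp: dirsum_def lmod_hom.closed[OF \<beta>h] lmod_hom.add[OF \<beta>h] lmod_hom.smult[OF \<beta>h]
          intro!: restrict_ext)
    from lmod_hom.restrict_in_lhom[OF this] show ?thesis by (simp add: g_def)
  qed
  have gh: "lmod_hom A W ?D g" by (rule lmod_hom_of_lhom[OF g W D.lmodule_axioms])
  interpret p: lmod_hom \<Gamma> "dg ?D" "dg W" "pullback W g" by (rule lmod_hom_pullback[OF gh])
  let ?\<pi> = "\<lambda>j. \<lambda>x\<in>carrier ?D. x j"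
  note data = dirsum_retract_data[of r]
  have pi: "pullback W g (?\<pi> j) = \<beta> j" if "j < r" for j
  proof (rule lhom_ext[of _ W])
    show "pullback W g (?\<pi> j) \<in> lhom A W C" using p.closed[of "?\<pi> j"] retract_pi[OF data that] by simp
    show "\<beta> j \<in> lhom A W C" by (rule \<beta>K(2)[OF that])
    show "pullback W g (?\<pi> j) w = \<beta> j w" if "w \<in> carrier W" for w
      using that \<open>j < r\<close> lmod_hom.closed[OF gh that] by (simp add: pullback_apply g_def)
  qed
  have "pullback W g ` lhom A ?D C = K"
  proof
    show "pullback W g ` lhom A ?D C \<subseteq> K"
    proof
      fix \<phi> assume "\<phi> \<in> pullback W g ` lhom A ?D C"
      then obtain \<chi> where \<chi>: "\<chi> \<in> lhom A ?D C" "\<phi> = pullback W g \<chi>" by blast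
      have m: "component (single C {..<r} j) \<chi> \<in> carrier \<Gamma>" "?\<pi> j \<in> carrier (dg ?D)" if "j < r" for j
        using component_in_End[OF data that \<chi>(1)] retract_pi[OF data that] by simp_all
      have "\<phi> = pullback W g (\<Oplus>\<^bsub>dg ?D\<^esub>j\<in>{..<r}. component (single C {..<r} j) \<chi> \<odot>\<^bsub>dg ?D\<^esub> ?\<pi> j)"
        unfolding \<chi>(2) using retract_form_expand[OF data \<chi>(1)] by (rule arg_cong)
      also have "\<dots> = (\<Oplus>\<^bsub>dg W\<^esub>j\<in>{..<r}. pullback W g (component (single C {..<r} j) \<chi> \<odot>\<^bsub>dg ?D\<^esub> ?\<pi> j))"
        by (rule p.finsum) (simp, use p.M.smult_closed[OF m] in blast)
      also have "\<dots> \<in> K"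
      proof (rule p.N.M.finsum_mem)
        show "pullback W g (component (single C {..<r} j) \<chi> \<odot>\<^bsub>dg ?D\<^esub> ?\<pi> j) \<in> K" if "j \<in> {..<r}" for j
        proof -
          have j: "j < r" using that by simp
          have "component (single C {..<r} j) \<chi> \<odot>\<^bsub>dg W\<^esub> \<beta> j \<in> K"
            using K(1) \<beta>K(1)[OF j] component_in_End[OF data j \<chi>(1)] unfolding dual_closed_def by blast
          then show ?thesis using p.smult[OF m[OF j]] pi[OF j] by (simp del: dg_simps)
        qed
      qed (use K in \<open>auto simp: dual_closed_def simp del: dg_simps(2-)\<close>)
      finally show "\<phi> \<in> K" .
    qed
    have "dual_closed W (pullback W g ` lhom A ?D C)"
      unfolding dual_closed_def
    proof (intro conjI ballI)
      show "\<zero>\<^bsub>dg W\<^esub> \<in> pullback W g ` lhom A ?D C"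
        using p.zero p.M.M.zero_closed by (metis dg_simps(1) image_eqI)
      show "\<phi> \<oplus>\<^bsub>dg W\<^esub> \<psi> \<in> pullback W g ` lhom A ?D C"
        if mem: "\<phi> \<in> pullback W g ` lhom A ?D C" "\<psi> \<in> pullback W g ` lhom A ?D C" for \<phi> \<psi>
      proof -
        obtain \<phi>' \<psi>' where m: "\<phi>' \<in> carrier (dg ?D)" "\<psi>' \<in> carrier (dg ?D)"
          "\<phi> = pullback W g \<phi>'" "\<psi> = pullback W g \<psi>'" using mem unfolding dg_simps(1) by blast
        show ?thesis
          using p.add[OF m(1,2)] p.M.M.a_closed[OF m(1,2)] unfolding m(3,4) dg_simps(1) by (metis image_eqI)
      qed
      show "\<gamma> \<odot>\<^bsub>dg W\<^esub> \<phi> \<in> pullback W g ` lhom A ?D C"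
        if \<gamma>: "\<gamma> \<in> lhom A C C" and \<phi>: "\<phi> \<in> pullback W g ` lhom A ?D C" for \<gamma> \<phi>
      proof -
        obtain \<phi>' where m: "\<gamma> \<in> carrier \<Gamma>" "\<phi>' \<in> carrier (dg ?D)" "\<phi> = pullback W g \<phi>'"
          using \<gamma> \<phi> unfolding dg_simps(1) End_simps(1) by blast
        show ?thesis
          using p.smult[OF m(1,2)] p.M.smult_closed[OF m(1,2)] unfolding m(3) dg_simps(1) by (metis image_eqI)
      qed
    qed
    moreover have "B \<subseteq> pullback W g ` lhom A ?D C"
    proof
      fix b assume "b \<in> B"
      then obtain j where j: "j < r" "b = \<beta> j" using \<beta> by auto
      then show "b \<in> pullback W g ` lhom A ?D C" using pi[OF j(1)] retract_pi[OF data j(1)] by (metis image_eqI)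
    qed
    ultimately show "K \<subseteq> pullback W g ` lhom A ?D C" by (rule B(3))
  qed
  with g show ?thesis by blast
qed

text \<open>Iterating the approximations, first for \<open>M\<^sup>\<dagger>\<close> and then for the kernels of the duals, gives an
  infinite complex whose dual is a resolution of \<open>M\<^sup>\<dagger>\<close>.\<close>

proposition dual_exact_complex_exists:
  fixes M :: "('a, 'm) module"
  assumes M: "M \<in> fg_modules A" and C: "C \<in> fg_modules A"
  shows "\<exists>(X :: nat \<Rightarrow> ('a, nat \<Rightarrow> 'c) module) f d. (\<forall>k. X k \<in> add_class A C) \<and>
    f \<in> lhom A M (X 0) \<and> (\<forall>k. d k \<in> lhom A (X k) (X (Suc k))) \<and> (\<forall>n. exact_dual A C n M X f d)"
proof -
  have Mm: "lmodule A M" using M by (simp add: fg_modules_def)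
  let ?D = "\<lambda>r::nat. dirsum C {..<r}"
  have D: "lmodule A (?D r)" for r by (rule lmodule_dirsum[OF C.lmodule_axioms])
  obtain GM where GM: "determining M GM" using determining_if_fg[OF M] by blast
  obtain GC where "determining C GC" using determining_if_fg[OF C] by blast
  note GD = determining_retract[OF dirsum_retract_data this]
  interpret dM: lmodule \<Gamma> "dg M" by (rule lmodule_dagger[OF Mm])
  have "dual_closed M (lhom A M C)"
    using dM.M.zero_closed dM.M.a_closed dM.smult_closed unfolding dual_closed_def dg_simps(1) End_simps(1)
    by blast
  from approximation_exists[OF Mm GM this order_refl] obtain r0 f where
    f: "f \<in> lhom A M (?D r0)" "pullback M f ` lhom A (?D r0) C = lhom A M C" by blast
  have next_ex: "\<exists>s g. g \<in> lhom A (?D r) (?D s) \<and>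
      pullback (?D r) g ` lhom A (?D s) C = lker (dg (?D r)) (dg W) (pullback W h)"
    if "lmod_hom A W (?D r) h" for W :: "('a, 'w) module" and h r
    by (rule approximation_exists[OF D GD dual_closed_lker[OF that]]) (auto simp: lker_def)
  obtain r1 g0 where g0: "g0 \<in> lhom A (?D r0) (?D r1)"
    "pullback (?D r0) g0 ` lhom A (?D r1) C = lker (dg (?D r0)) (dg M) (pullback M f)"
    using next_ex[OF lmod_hom_of_lhom[OF f(1) Mm D]] by blast
  \<comment> \<open>The states are the maps \<open>g : C\<^sup>r \<rightarrow> C\<^sup>s\<close>; a state is followed by a map \<open>g'\<close> out of \<open>C\<^sup>s\<close> such that
    the image of the dual of \<open>g'\<close> is the kernel of the dual of \<open>g\<close>.\<close>
  define P where "P = (\<lambda>(r, s, g). g \<in> lhom A (?D r) (?D s))"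
  define Q where "Q = (\<lambda>(r, s, g) (r', s', g'). r' = s \<and>
    pullback (?D s) g' ` lhom A (?D s') C = lker (dg (?D s)) (dg (?D r)) (pullback (?D r) g))"
  have "\<exists>x. \<forall>n. (P (x n) \<and> (n = 0 \<longrightarrow> x n = (r0, r1, g0))) \<and> Q (x n) (x (Suc n))"
  proof (rule dependent_nat_choice)
    show "\<exists>x. P x \<and> (0 = (0::nat) \<longrightarrow> x = (r0, r1, g0))" using g0(1) by (auto simp: P_def)
    fix x and n :: nat assume x: "P x \<and> (n = 0 \<longrightarrow> x = (r0, r1, g0))"
    obtain r s g where xe: "x = (r, s, g)" by (rule prod_cases3)
    have "lmod_hom A (?D r) (?D s) g" by (rule lmod_hom_of_lhom[OF _ D D]) (use x in \<open>simp add: P_def xe\<close>)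
    from next_ex[OF this] obtain s' g' where "g' \<in> lhom A (?D s) (?D s')"
      "pullback (?D s) g' ` lhom A (?D s') C = lker (dg (?D s)) (dg (?D r)) (pullback (?D r) g)" by blast
    then show "\<exists>y. (P y \<and> (Suc n = 0 \<longrightarrow> y = (r0, r1, g0))) \<and> Q x y"
      by (intro exI[of _ "(s, s', g')"]) (simp add: P_def Q_def xe)
  qed
  then obtain x where x: "\<And>n. P (x n)" "x 0 = (r0, r1, g0)" "\<And>n. Q (x n) (x (Suc n))" by blast
  define X where "X n = ?D (fst (x n))" for n
  define d where "d n = snd (snd (x n))" for n
  have snd_x: "fst (snd (x n)) = fst (x (Suc n))" for n
    using x(3)[of n] by (simp add: Q_def split_beta)
  have "X k \<in> add_class A C" for k unfolding X_def by (rule dirsum_in_add_class)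
  moreover have "f \<in> lhom A M (X 0)" using f(1) by (simp add: X_def x(2))
  moreover have "d k \<in> lhom A (X k) (X (Suc k))" for k
    using x(1)[of k] by (simp add: P_def split_beta X_def d_def snd_x)
  moreover have "exact_dual A C n M X f d" for n
    unfolding exact_dual_def Let_def dg_simps(1)
  proof (intro conjI allI impI)
    have e: "fst (x 0) = r0" "fst (x (Suc 0)) = r1" using snd_x[of 0] x(2) by simp_all
    show "pullback M f ` lhom A (X 0) C = lhom A M C" using f(2) by (simp add: X_def e)
    show "pullback (X 0) (d 0) ` lhom A (X 1) C = lker (dg (X 0)) (dg M) (pullback M f)"
      using g0(2) x(2) e by (simp add: X_def d_def)
    show "pullback (X (Suc k)) (d (Suc k)) ` lhom A (X (Suc (Suc k))) C =
        lker (dg (X (Suc k))) (dg (X k)) (pullback (X k) (d k))" for k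
      using x(3)[of k] by (simp add: Q_def split_beta X_def d_def snd_x)
  qed
  ultimately show ?thesis by blast
qed

theorem UP_eq_TF:
  assumes C: "C \<in> fg_modules A"
  shows "(UP_class A n C :: ('a, 'm) module set) = TF_class A n C"
proof (cases "n = 0")
  case True
  then show ?thesis by (simp add: UP_class_def TF_class_def)
next
  case False
  have iff: "exact_copresentation A n M X f d \<longleftrightarrow> M \<in> TF_class A n C"
    if M: "M \<in> fg_modules A" and X: "\<And>k. k < n \<Longrightarrow> X k \<in> add_class A C"
      and f: "f \<in> lhom A M (X 0)" and d: "\<And>k. Suc k < n \<Longrightarrow> d k \<in> lhom A (X k) (X (Suc k))"
      and ex: "exact_dual A C n M X f d"
    for M :: "('a, 'm) module" and X :: "nat \<Rightarrow> ('a, nat \<Rightarrow> 'c) module" and f d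
  proof -
    have Mm: "lmodule A M" using M by (simp add: fg_modules_def)
    show ?thesis
      using exact_copresentation_iff[OF Mm _ X f d ex] False M by (simp add: TF_class_def)
  qed
  show ?thesis
  proof
    show "UP_class A n C \<subseteq> (TF_class A n C :: ('a, 'm) module set)"
    proof
      fix M :: "('a, 'm) module" assume "M \<in> UP_class A n C"
      then obtain X :: "nat \<Rightarrow> ('a, nat \<Rightarrow> 'c) module" and f d where
        M: "M \<in> fg_modules A" and X: "\<And>k. k < n \<Longrightarrow> X k \<in> add_class A C"
        and co: "exact_copresentation A n M X f d" and ex: "exact_dual A C n M X f d"
        using False unfolding UP_class_def by blast
      show "M \<in> TF_class A n C"
        using iff[OF M X _ _ ex] co by (simp add: exact_copresentation_def)
    qed
    show "(TF_class A n C :: ('a, 'm) module set) \<subseteq> UP_class A n C"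
    proof
      fix M :: "('a, 'm) module" assume TF: "M \<in> TF_class A n C"
      then have M: "M \<in> fg_modules A" by (simp add: TF_class_def)
      obtain X :: "nat \<Rightarrow> ('a, nat \<Rightarrow> 'c) module" and f d where
        X: "\<And>k. X k \<in> add_class A C" and f: "f \<in> lhom A M (X 0)"
        and d: "\<And>k. d k \<in> lhom A (X k) (X (Suc k))" and ex: "exact_dual A C n M X f d"
        using dual_exact_complex_exists[OF M C] by blast
      have "exact_copresentation A n M X f d" using iff[OF M X f d ex] TF by blast
      then show "M \<in> UP_class A n C" unfolding UP_class_def using M X ex by blast
    qed
  qed
qed

lemma Syz_1_eq_UP:
  assumes C: "C \<in> fg_modules A"
  shows "(Syz_class A 1 C :: ('a, 'm) module set) = UP_class A 1 C"
proof
  show "(UP_class A 1 C :: ('a, 'm) module set) \<subseteq> Syz_class A 1 C"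
    unfolding UP_class_def Syz_class_def by blast
  show "Syz_class A 1 C \<subseteq> (UP_class A 1 C :: ('a, 'm) module set)"
  proof
    fix M :: "('a, 'm) module" assume "M \<in> Syz_class A 1 C"
    then obtain X :: "nat \<Rightarrow> ('a, nat \<Rightarrow> 'c) module" and f d where
      M: "M \<in> fg_modules A" and X: "X 0 \<in> add_class A C" and co: "exact_copresentation A 1 M X f d"
      unfolding Syz_class_def by auto
    have "lmodule A M" using M by (simp add: fg_modules_def)
    then have "inj_on (eval_map A C M) (carrier M)"
      using inj_eval_map_if_embeds X co by (auto simp: exact_copresentation_def)
    then show "M \<in> UP_class A 1 C" unfolding UP_eq_TF[OF C] using M by (simp add: TF_class_def)
  qed
qed

end

section \<open>Module-finite algebras\<close>

lemma (in module_finite_algebra) smult_eq_mult: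
  assumes "r \<in> carrier R" "a \<in> carrier \<Lambda>"
  shows "(r \<odot>\<^bsub>\<Lambda>\<^esub> \<one>\<^bsub>\<Lambda>\<^esub>) \<otimes>\<^bsub>\<Lambda>\<^esub> a = r \<odot>\<^bsub>\<Lambda>\<^esub> a" "a \<otimes>\<^bsub>\<Lambda>\<^esub> (r \<odot>\<^bsub>\<Lambda>\<^esub> \<one>\<^bsub>\<Lambda>\<^esub>) = r \<odot>\<^bsub>\<Lambda>\<^esub> a"
  using assms smult_mult_left[of r "\<one>\<^bsub>\<Lambda>\<^esub>" a] smult_mult_right[of r a "\<one>\<^bsub>\<Lambda>\<^esub>"] by simp_all

text \<open>A finitely generated right \<open>\<Lambda>\<close>-module is finitely generated over \<open>R\<close>, which acts through the
  centre of \<open>\<Lambda>\<close>.\<close>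

lemma noetherian_duality_opp_ring:
  fixes R :: "('r, 'x) ring_scheme" and \<Lambda> :: "('r, 'l, 'y) module_scheme" and C :: "('l, 'c) module"
  assumes noeth: "noetherian_ring R" and alg: "module_finite_algebra R \<Lambda>"
    and C: "C \<in> fg_modules (opp_ring \<Lambda>)"
  shows "\<exists>E. noetherian_duality (opp_ring \<Lambda>) C R (\<lambda>r c. (r \<odot>\<^bsub>\<Lambda>\<^esub> \<one>\<^bsub>\<Lambda>\<^esub>) \<odot>\<^bsub>C\<^esub> c) E"
proof -
  interpret \<Lambda>: module_finite_algebra R \<Lambda> by fact
  interpret C: lmodule "opp_ring \<Lambda>" C using C by (simp add: fg_modules_def)
  let ?act = "\<lambda>r c. (r \<odot>\<^bsub>\<Lambda>\<^esub> \<one>\<^bsub>\<Lambda>\<^esub>) \<odot>\<^bsub>C\<^esub> c"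
  have opp: "carrier (opp_ring \<Lambda>) = carrier \<Lambda>" "x \<otimes>\<^bsub>opp_ring \<Lambda>\<^esub> y = y \<otimes>\<^bsub>\<Lambda>\<^esub> x"
    "x \<oplus>\<^bsub>opp_ring \<Lambda>\<^esub> y = x \<oplus>\<^bsub>\<Lambda>\<^esub> y" "\<zero>\<^bsub>opp_ring \<Lambda>\<^esub> = \<zero>\<^bsub>\<Lambda>\<^esub>" "\<one>\<^bsub>opp_ring \<Lambda>\<^esub> = \<one>\<^bsub>\<Lambda>\<^esub>" for x y
    by (simp_all add: opp_ring_def)
  note l_distr = C.smult_l_distr[unfolded opp] and r_distr = C.smult_r_distr[unfolded opp]
    and assoc = C.smult_assoc1[unfolded opp] and closed = C.smult_closed[unfolded opp]
    and one = C.smult_one[unfolded opp] and null = C.smult_l_null[unfolded opp]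
  have z: "r \<odot>\<^bsub>\<Lambda>\<^esub> \<one>\<^bsub>\<Lambda>\<^esub> \<in> carrier \<Lambda>" if "r \<in> carrier R" for r using that by simp
  have act_smult: "?act r (a \<odot>\<^bsub>C\<^esub> c) = (r \<odot>\<^bsub>\<Lambda>\<^esub> a) \<odot>\<^bsub>C\<^esub> c" "a \<odot>\<^bsub>C\<^esub> ?act r c = (r \<odot>\<^bsub>\<Lambda>\<^esub> a) \<odot>\<^bsub>C\<^esub> c"
    if "r \<in> carrier R" "a \<in> carrier \<Lambda>" "c \<in> carrier C" for r a c
    using assoc[OF z[OF that(1)] that(2,3)] assoc[OF that(2) z[OF that(1)] that(3)]
      \<Lambda>.smult_eq_mult[OF that(1,2)] by simp_all
  have act_closed: "?act r c \<in> carrier C" if "r \<in> carrier R" "c \<in> carrier C" for r c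
    by (rule closed[OF z[OF that(1)] that(2)])
  have act_add: "?act (r \<oplus>\<^bsub>R\<^esub> s) c = ?act r c \<oplus>\<^bsub>C\<^esub> ?act s c"
    if "r \<in> carrier R" "s \<in> carrier R" "c \<in> carrier C" for r s c
    using that by (simp add: \<Lambda>.smult_l_distr l_distr z)
  have act_mult: "?act (r \<otimes>\<^bsub>R\<^esub> s) c = ?act r (?act s c)"
    if "r \<in> carrier R" "s \<in> carrier R" "c \<in> carrier C" for r s c
    using that by (simp add: act_smult(1) z \<Lambda>.smult_assoc1)
  have act_hom: "lmod_hom (opp_ring \<Lambda>) C C (?act r)" if r: "r \<in> carrier R" for r
    by unfold_locales (use r in \<open>simp_all add: opp act_closed r_distr z act_smult\<close>)
  obtain G where G: "finite G" "G \<subseteq> carrier \<Lambda>"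
    "carrier \<Lambda> = {(\<Oplus>\<^bsub>\<Lambda>\<^esub>g\<in>G. c g \<odot>\<^bsub>\<Lambda>\<^esub> g) | c. c \<in> G \<rightarrow> carrier R}"
    using \<Lambda>.module_finite unfolding finitely_generated_def by (elim exE conjE)
  obtain H where H: "finite H" "H \<subseteq> carrier C"
    "carrier C = {(\<Oplus>\<^bsub>C\<^esub>g\<in>H. c g \<odot>\<^bsub>C\<^esub> g) | c. c \<in> H \<rightarrow> carrier \<Lambda>}"
    using C unfolding fg_modules_def finitely_generated_def opp by blast
  define E where "E = (\<lambda>(a, c). a \<odot>\<^bsub>C\<^esub> c) ` (G \<times> H)"
  have E: "finite E" "E \<subseteq> carrier C" using G(1,2) H(1,2) closed by (auto simp: E_def subset_iff)
  define V where "V = {(\<Oplus>\<^bsub>C\<^esub>e\<in>E. ?act (t e) e) | t. t \<in> E \<rightarrow> carrier R}"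
  have ae: "?act (t e) e \<in> carrier C" if "t \<in> E \<rightarrow> carrier R" "e \<in> E" for t e
    by (rule act_closed) (use that E in auto)
  have VI: "(\<Oplus>\<^bsub>C\<^esub>e\<in>E. ?act (t e) e) \<in> V" if "t \<in> E \<rightarrow> carrier R" for t
    using that unfolding V_def by blast
  have V_carrier: "V \<subseteq> carrier C"
    unfolding V_def using ae by (auto intro!: C.M.finsum_closed)
  have V_add: "x \<oplus>\<^bsub>C\<^esub> y \<in> V" if xy: "x \<in> V" "y \<in> V" for x y
  proof -
    obtain s t where st: "s \<in> E \<rightarrow> carrier R" "x = (\<Oplus>\<^bsub>C\<^esub>e\<in>E. ?act (s e) e)"
      "t \<in> E \<rightarrow> carrier R" "y = (\<Oplus>\<^bsub>C\<^esub>e\<in>E. ?act (t e) e)" using xy unfolding V_def by blast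
    have "x \<oplus>\<^bsub>C\<^esub> y = (\<Oplus>\<^bsub>C\<^esub>e\<in>E. ?act (s e) e \<oplus>\<^bsub>C\<^esub> ?act (t e) e)"
      unfolding st(2,4) by (rule C.M.finsum_addf[symmetric]) (use st(1,3) ae in blast)+
    also have "\<dots> = (\<Oplus>\<^bsub>C\<^esub>e\<in>E. ?act (s e \<oplus>\<^bsub>R\<^esub> t e) e)"
    proof (rule C.M.finsum_cong')
      have st': "(\<lambda>e. s e \<oplus>\<^bsub>R\<^esub> t e) \<in> E \<rightarrow> carrier R" using st(1,3) by (simp add: Pi_iff)
      show "(\<lambda>e. ?act (s e \<oplus>\<^bsub>R\<^esub> t e) e) \<in> E \<rightarrow> carrier C" using ae[OF st'] by blast
      show "?act (s e) e \<oplus>\<^bsub>C\<^esub> ?act (t e) e = ?act (s e \<oplus>\<^bsub>R\<^esub> t e) e" if "e \<in> E" for e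
        by (rule act_add[symmetric]) (use st(1,3) that E(2) in auto)
    qed simp
    also have "\<dots> \<in> V" by (rule VI) (use st(1,3) in \<open>simp add: Pi_iff\<close>)
    finally show ?thesis .
  qed
  have V_act: "?act r x \<in> V" if r: "r \<in> carrier R" and x: "x \<in> V" for r x
  proof -
    obtain t where t: "t \<in> E \<rightarrow> carrier R" "x = (\<Oplus>\<^bsub>C\<^esub>e\<in>E. ?act (t e) e)"
      using x unfolding V_def by blast
    have rt: "(\<lambda>e. r \<otimes>\<^bsub>R\<^esub> t e) \<in> E \<rightarrow> carrier R" using t(1) r by (simp add: Pi_iff)
    have "?act r x = (\<Oplus>\<^bsub>C\<^esub>e\<in>E. ?act r (?act (t e) e))"
      unfolding t(2) by (rule lmod_hom.finsum[OF act_hom[OF r] E(1) ae[OF t(1)]])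
    also have "\<dots> = (\<Oplus>\<^bsub>C\<^esub>e\<in>E. ?act (r \<otimes>\<^bsub>R\<^esub> t e) e)"
    proof (rule C.M.finsum_cong')
      show "(\<lambda>e. ?act (r \<otimes>\<^bsub>R\<^esub> t e) e) \<in> E \<rightarrow> carrier C" using ae[OF rt] by blast
      show "?act r (?act (t e) e) = ?act (r \<otimes>\<^bsub>R\<^esub> t e) e" if "e \<in> E" for e
        by (rule act_mult[symmetric]) (use r t(1) that E(2) in auto)
    qed simp
    also have "\<dots> \<in> V" by (rule VI[OF rt])
    finally show ?thesis .
  qed
  have act_zero: "?act \<zero>\<^bsub>R\<^esub> c = \<zero>\<^bsub>C\<^esub>" and act_one: "?act \<one>\<^bsub>R\<^esub> c = c" if "c \<in> carrier C" for c
    using that by (simp_all add: null one)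
  have V_gen: "e \<in> V" if e: "e \<in> E" for e
  proof -
    let ?t = "\<lambda>e'. if e = e' then \<one>\<^bsub>R\<^esub> else \<zero>\<^bsub>R\<^esub>"
    have t: "?t \<in> E \<rightarrow> carrier R" by simp
    have "(\<Oplus>\<^bsub>C\<^esub>e'\<in>E. ?act (?t e') e') = (\<Oplus>\<^bsub>C\<^esub>e'\<in>E. if e = e' then e' else \<zero>\<^bsub>C\<^esub>)"
      by (rule C.M.finsum_cong') (use E(2) act_zero act_one in \<open>auto simp: subset_iff\<close>)
    also have "\<dots> = e" by (rule C.M.finsum_singleton) (use e E in auto)
    finally show ?thesis using VI[OF t] by simp
  qed
  have V_zero: "\<zero>\<^bsub>C\<^esub> \<in> V"
  proof -
    have "(\<Oplus>\<^bsub>C\<^esub>e\<in>E. ?act \<zero>\<^bsub>R\<^esub> e) = (\<Oplus>\<^bsub>C\<^esub>e\<in>E. \<zero>\<^bsub>C\<^esub>)"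
      by (rule C.M.finsum_cong') (use E(2) act_zero in \<open>auto simp: subset_iff\<close>)
    then show ?thesis using VI[of "\<lambda>_. \<zero>\<^bsub>R\<^esub>"] by simp
  qed
  \<comment> \<open>\<open>V\<close> is the \<open>R\<close>-span of \<open>E\<close>; it contains \<open>\<Lambda> h\<close> for every generator \<open>h\<close> of \<open>C\<close>.\<close>
  have smult_V: "a \<odot>\<^bsub>C\<^esub> h \<in> V" if a: "a \<in> carrier \<Lambda>" and h: "h \<in> H" for a h
  proof -
    have hC: "h \<in> carrier C" using h H(2) by blast
    obtain c where c: "c \<in> G \<rightarrow> carrier R" "a = (\<Oplus>\<^bsub>\<Lambda>\<^esub>g\<in>G. c g \<odot>\<^bsub>\<Lambda>\<^esub> g)"
      using a unfolding G(3) by blast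
    have "a \<in> {a \<in> carrier \<Lambda>. a \<odot>\<^bsub>C\<^esub> h \<in> V}"
      unfolding c(2)
    proof (rule \<Lambda>.M.finsum_mem[OF G(1)])
      show "\<zero>\<^bsub>\<Lambda>\<^esub> \<in> {a \<in> carrier \<Lambda>. a \<odot>\<^bsub>C\<^esub> h \<in> V}" using V_zero hC by (simp add: null)
      show "x \<oplus>\<^bsub>\<Lambda>\<^esub> y \<in> {a \<in> carrier \<Lambda>. a \<odot>\<^bsub>C\<^esub> h \<in> V}"
        if "x \<in> {a \<in> carrier \<Lambda>. a \<odot>\<^bsub>C\<^esub> h \<in> V}" "y \<in> {a \<in> carrier \<Lambda>. a \<odot>\<^bsub>C\<^esub> h \<in> V}" for x y
        using that V_add hC by (simp add: l_distr)
      show "c g \<odot>\<^bsub>\<Lambda>\<^esub> g \<in> {a \<in> carrier \<Lambda>. a \<odot>\<^bsub>C\<^esub> h \<in> V}" if g: "g \<in> G" for g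
      proof -
        have m: "c g \<in> carrier R" "g \<in> carrier \<Lambda>" using g c(1) G(2) by auto
        have "g \<odot>\<^bsub>C\<^esub> h \<in> V" by (rule V_gen) (use g h in \<open>auto simp: E_def\<close>)
        from V_act[OF m(1) this] show ?thesis unfolding act_smult(1)[OF m hC] using m by simp
      qed
    qed blast
    then show ?thesis by simp
  qed
  have "c \<in> V" if c: "c \<in> carrier C" for c
  proof -
    obtain t where t: "t \<in> H \<rightarrow> carrier \<Lambda>" "c = (\<Oplus>\<^bsub>C\<^esub>g\<in>H. t g \<odot>\<^bsub>C\<^esub> g)"
      using c unfolding H(3) by blast
    show ?thesis
      unfolding t(2)
      by (rule C.M.finsum_mem[OF H(1) V_zero V_carrier V_add]) (use t(1) smult_V in auto)
  qed
  then have "\<exists>t\<in>E \<rightarrow> carrier R. c = (\<Oplus>\<^bsub>C\<^esub>e\<in>E. ?act (t e) e)" if "c \<in> carrier C" for c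
    using that unfolding V_def by blast
  then have "noetherian_duality (opp_ring \<Lambda>) C R ?act E"
    using noeth act_hom act_add act_mult E
    by (intro noetherian_duality.intro noetherian_duality_axioms.intro duality.intro
        C.lmodule_axioms \<Lambda>.R.cring_axioms)
  then show ?thesis by blast
qed

theorem lemma4p7:
  fixes R :: "('r, 'x) ring_scheme"
    and \<Lambda> :: "('r, 'l, 'y) module_scheme"
    and C :: "('l, 'c) module"
  assumes "cring R" and "noetherian_ring R"
    and "module_finite_algebra R \<Lambda>"
    and "C \<in> fg_modules (opp_ring \<Lambda>)"
  shows "(\<forall>n\<in>{0, 1}. (Syz_class (opp_ring \<Lambda>) n C :: ('l, 'm) module set) = UP_class (opp_ring \<Lambda>) n C) \<and>
    (\<forall>n. (TF_class (opp_ring \<Lambda>) n C :: ('l, 'm) module set) = UP_class (opp_ring \<Lambda>) n C)"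
proof -
  obtain E where "noetherian_duality (opp_ring \<Lambda>) C R (\<lambda>r c. (r \<odot>\<^bsub>\<Lambda>\<^esub> \<one>\<^bsub>\<Lambda>\<^esub>) \<odot>\<^bsub>C\<^esub> c) E"
    using noetherian_duality_opp_ring[OF assms(2-4)] by blast
  then interpret noetherian_duality "opp_ring \<Lambda>" C R "\<lambda>r c. (r \<odot>\<^bsub>\<Lambda>\<^esub> \<one>\<^bsub>\<Lambda>\<^esub>) \<odot>\<^bsub>C\<^esub> c" E .
  have "(Syz_class (opp_ring \<Lambda>) 0 C :: ('l, 'm) module set) = UP_class (opp_ring \<Lambda>) 0 C"
    by (simp add: Syz_class_def UP_class_def)
  then show ?thesis using Syz_1_eq_UP[OF assms(4)] UP_eq_TF[OF assms(4)] by auto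
qed

end
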